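(* Let $\Gamma'$ be a network with vertex set $\mathbf v(\Gamma')=[d]=\{1,\dots,d\}$ and edge set $\mathbf e(\Gamma')$, and let $\mathbf m'=(m'_e)_{e\in\mathbf e(\Gamma')}$ be an assignment of bond dimensions on $\Gamma'$. Let $\Gamma$ be the augmentation of $\Gamma'$ at nodes $\{1,2\}$, that is, $\mathbf v(\Gamma)=\{0\}\cup[d]$ and $\mathbf e(\Gamma)=\mathbf e(\Gamma')\cup\{(0,1),(0,2)\}$. Let $\mathbf m$ be the assignment of bond dimensions on $\Gamma$ with $m_e=m'_e$ for all $e\in\mathbf e(\Gamma')$ and $m_{01}=m_{02}=m$. Let $\mathbf n$ be the assignment of physical dimensions on $\Gamma$ where $n_0=2$ and, for every $j\ne0$, $n_j=\prod_{e\in\mathbf e(\Gamma),\,e\ni j}m_e$ is the critical dimension. Then $(\Gamma,\mathbf m,\mathbf n)$ is defective and $$\delta^\Gamma_{\mathbf m,\mathbf n}=\mathrm{fiberdefect}^\Gamma_{\mathbf m,\mathbf n}=(m-1)(m_{12}^2-1).$$ Moreover, a generic tensor $T\in\mathcal{TNS}^\Gamma_{\mathbf m,\mathbf n}$ has, up to the action of $GL(V_1)\times\cdots\times GL(V_d)$, the form $$T=\Big(\bigoplus_{i=1}^mJ_1(z_i)\Big)\boxtimes T(\Gamma',\mathbf m')$$ for generic $z_1,\dots,z_m\in V_0\simeq\mathbb C^2$. Here $\bigoplus_{i=1}^mJ_1(z_i)$ is regarded as a tensor in $V_0\otimes V_1''\otimes V_2''\otimes\mathbb C^1\otimes\cdots\otimes\mathbb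 C^1$ and $T(\Gamma',\mathbf m')\in\mathbb C^1\otimes V_1'\otimes V_2'\otimes V_3\otimes\cdots\otimes V_d$.
   Context: Everything is over $\mathbb C$. A network is a finite connected graph; $m_{12}$ denotes the bond dimension of the edge $(1,2)$. Tensor network varieties. For a finite connected graph $\Gamma$ with bond dimensions $\mathbf m=(m_e)_{e\in\mathbf e(\Gamma)}$ and physical dimensions $\mathbf n=(n_i)_{i\in\mathbf v(\Gamma)}$ (positive integers), orient the edges arbitrarily, take for each edge $e$ a bond space $E_e$ of dimension $m_e$ and its dual $E_e^*$, and set $W_i=\bigotimes_{e\ni i}E'_e$, where $E'_e=E_e$ if $i$ is the source of $e$ and $E_e'=E_e^*$ if $i$ is the target. The graph tensor is $T(\Gamma,\mathbf m)=\bigotimes_e\mathrm{id}_{E_e}\in\bigotimes_e(E_e\otimes E_e^* )\simeq\bigotimes_{i\in\mathbf v(\Gamma)}W_i$. With $V_i=\mathbb C^{n_i}$, $\mathcal{TNS}^\Gamma_{\mathbf m,\mathbf n}\subseteq\bigotimes_iV_i$ is the Zariski closure of the set of all $(\bigotimes_iX_i)(T(\Gamma,\mathbf m))$ with $X_i\in\mathrm{Hom}(W_i,V_i)$. Defects. The parameter count is $p=\sum_{i\in\mathbf v(\Gamma)}\big(n_i\prod_{e\ni i}m_e-1\big)-\sum_{e\in\mathbf e(\Gamma)}(m_e^2-1)+1$; the expected dimension is $\min\{p,\prod_in_i\}$; $\delta^\Gamma_{\mathbf m,\mathbf n}$ is the expected dimension minus $\dim\mathcal{TNS}^\Gamma_{\mathbf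 m,\mathbf n}$ (affine dimension); $\mathrm{fiberdefect}^\Gamma_{\mathbf m,\mathbf n}=p-\dim\mathcal{TNS}^\Gamma_{\mathbf m,\mathbf n}$. Defective means that the dimension is strictly smaller than the expected dimension. Normal form notation. $V_1',V_2'$ and $V_j$ ($j\ge3$) are identified with the spaces $W_j$ of the network $(\Gamma',\mathbf m')$, and $V_1=V_1''\otimes V_1'$, $V_2=V_2''\otimes V_2'$ with $V_1''=V_2''=\mathbb C^m$ having bases $(b_i)$, $(c_i)$. Then $\bigoplus_{i=1}^mJ_1(z_i)=\sum_{i=1}^mz_i\otimes b_i\otimes c_i$ is the $m\times m$ diagonal pencil with diagonal entries $z_1,\dots,z_m$, and $\boxtimes$ denotes the Kronecker product: the tensor product of the two tensors regrouped factorwise as an element of $V_0\otimes V_1\otimes V_2\otimes V_3\otimes\cdots\otimes V_d$.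
   Formalization: Defectiveness is claimed only when m > 1 and m_12 > 1, since for m = 1 or m_12 = 1 the defect formula gives 0 and the network is not defective; if (1,2) is not an edge, m_12 is taken to be 1; the defect formulas and the normal form are claimed in all cases. *)

theory Defs
  imports "HOL-Analysis.Abstract_Topology" "Jordan_Normal_Form.Matrix"
begin

section \<open>Zariski topology on coordinate spaces\<close>

text \<open>
  The coordinate space with finite index set \<open>I\<close> is the set of functions \<open>x :: 'i \<Rightarrow> complex\<close>
  that vanish off \<open>I\<close>. The Zariski topology is put on the whole type; its restriction to
  \<open>coord_space I\<close> is the usual one, and \<open>coord_space I\<close> is closed, so closures of subsets of
  \<open>coord_space I\<close> may be taken in the whole type.
\<close>

definition coord_space :: "'i set \<Rightarrow> ('i \<Rightarrow> complex) set" where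
  "coord_space I = {x. \<forall>i. i \<notin> I \<longrightarrow> x i = 0}"

inductive_set poly_funs :: "(('i \<Rightarrow> complex) \<Rightarrow> complex) set" where
  const: "(\<lambda>_. c) \<in> poly_funs"
| coord: "(\<lambda>x. x i) \<in> poly_funs"
| add: "p \<in> poly_funs \<Longrightarrow> q \<in> poly_funs \<Longrightarrow> (\<lambda>x. p x + q x) \<in> poly_funs"
| mult: "p \<in> poly_funs \<Longrightarrow> q \<in> poly_funs \<Longrightarrow> (\<lambda>x. p x * q x) \<in> poly_funs"

definition zariski :: "('i \<Rightarrow> complex) topology" where
  "zariski = topology_generated_by {{x. p x \<noteq> 0} |p. p \<in> poly_funs}"

definition irreducible_closedin :: "'a topology \<Rightarrow> 'a set \<Rightarrow> bool" where
  "irreducible_closedin X Z \<longleftrightarrow> closedin X Z \<and> Z \<noteq> {} \<and>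
     (\<forall>A B. closedin X A \<and> closedin X B \<and> Z = A \<union> B \<longrightarrow> Z = A \<or> Z = B)"

text \<open>
  Krull dimension: the supremum of the lengths \<open>k\<close> of chains \<open>Z\<^sub>0 \<subset> \<dots> \<subset> Z\<^sub>k\<close> of irreducible closed
  sets. It is a natural number, hence only meaningful where these lengths are bounded, as they
  are for subsets of a finite-dimensional coordinate space.
\<close>

definition krull_dim :: "'a topology \<Rightarrow> nat" where
  "krull_dim X = Sup {k. \<exists>Z. (\<forall>i\<le>k. irreducible_closedin X (Z i)) \<and> (\<forall>i<k. Z i \<subset> Z (Suc i))}"

definition variety_dim :: "('i \<Rightarrow> complex) set \<Rightarrow> nat" where
  "variety_dim S = krull_dim (subtopology zariski S)"

text \<open>A property holds for a generic point of \<open>S\<close> if it holds on a dense Zariski-open subset of \<open>S\<close>.\<close>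

definition generically :: "('i \<Rightarrow> complex) set \<Rightarrow> (('i \<Rightarrow> complex) \<Rightarrow> bool) \<Rightarrow> bool" where
  "generically S P \<longleftrightarrow>
     (\<exists>U. openin (subtopology zariski S) U \<and> S \<subseteq> zariski closure_of U \<and> (\<forall>x\<in>U. P x))"

section \<open>Tensors in coordinates\<close>

text \<open>
  If the factor at \<open>v \<in> V\<close> has a basis indexed by \<open>I v\<close>, the tensor product over \<open>V\<close> is
  \<open>coord_space (Pi\<^sub>E V I)\<close>. A linear map between factors is given by its matrix
  \<open>X v\<close>, whose first argument is the row; entries outside \<open>J v \<times> I v\<close> are irrelevant.
\<close>

definition tensor_map ::
  "'v set \<Rightarrow> ('v \<Rightarrow> 'a set) \<Rightarrow> ('v \<Rightarrow> 'b set) \<Rightarrow> ('v \<Rightarrow> 'b \<Rightarrow> 'a \<Rightarrow> complex)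
    \<Rightarrow> (('v \<Rightarrow> 'a) \<Rightarrow> complex) \<Rightarrow> (('v \<Rightarrow> 'b) \<Rightarrow> complex)" where
  "tensor_map V I J X T =
     (\<lambda>b. if b \<in> Pi\<^sub>E V J then \<Sum>a\<in>Pi\<^sub>E V I. (\<Prod>v\<in>V. X v (b v) (a v)) * T a else 0)"

text \<open>The Kronecker product groups the two factors at each \<open>v\<close> by pairing their basis indices.\<close>

definition kron ::
  "'v set \<Rightarrow> (('v \<Rightarrow> 'a) \<Rightarrow> complex) \<Rightarrow> (('v \<Rightarrow> 'b) \<Rightarrow> complex) \<Rightarrow> ('v \<Rightarrow> 'a \<times> 'b) \<Rightarrow> complex" where
  "kron V S T =
     (\<lambda>h. if h \<in> extensional V then S (\<lambda>v\<in>V. fst (h v)) * T (\<lambda>v\<in>V. snd (h v)) else 0)"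

definition GL :: "nat \<Rightarrow> complex mat set" where
  "GL n = {A \<in> carrier_mat n n. invertible_mat A}"

definition phys_indices :: "('v \<Rightarrow> nat) \<Rightarrow> 'v \<Rightarrow> nat set" where
  "phys_indices n v = {..<n v}"

definition mat_action ::
  "'v set \<Rightarrow> ('v \<Rightarrow> nat) \<Rightarrow> ('v \<Rightarrow> complex mat) \<Rightarrow> (('v \<Rightarrow> nat) \<Rightarrow> complex) \<Rightarrow> ('v \<Rightarrow> nat) \<Rightarrow> complex" where
  "mat_action V n g = tensor_map V (phys_indices n) (phys_indices n) (\<lambda>v i j. g v $$ (i, j))"

text \<open>Change of coordinates along bijections \<open>\<phi> v\<close> of the bases of the factors.\<close>

definition reindex ::
  "'v set \<Rightarrow> ('v \<Rightarrow> 'a set) \<Rightarrow> ('v \<Rightarrow> 'b set) \<Rightarrow> ('v \<Rightarrow> 'a \<Rightarrow> 'b)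
    \<Rightarrow> (('v \<Rightarrow> 'a) \<Rightarrow> complex) \<Rightarrow> (('v \<Rightarrow> 'b) \<Rightarrow> complex)" where
  "reindex V I J \<phi> = tensor_map V I J (\<lambda>v b a. of_bool (b = \<phi> v a))"

section \<open>Tensor network varieties\<close>

definition network :: "'v set \<Rightarrow> 'v set set \<Rightarrow> bool" where
  "network V E \<longleftrightarrow> finite V \<and> V \<noteq> {} \<and> (\<forall>e\<in>E. e \<subseteq> V \<and> card e = 2) \<and>
     (\<forall>u\<in>V. \<forall>v\<in>V. (u, v) \<in> {(x, y). {x, y} \<in> E}\<^sup>*)"

text \<open>
  The basis of \<open>W\<^sub>v\<close> consists of the tensor products of basis vectors of the bond spaces at \<open>v\<close>.
  Both \<open>E\<^sub>e\<close> and its dual have dimension \<open>m e\<close>, and in dual bases \<open>id \<in> E\<^sub>e \<otimes> E\<^sub>e\<^sup>*\<close> is the Kronecker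
  delta whichever end of \<open>e\<close> is the source, so no orientation enters. At a vertex without edges,
  \<open>W\<^sub>v\<close> is the empty tensor product, with the single basis index \<open>\<lambda>_. undefined\<close>; hence adding an
  isolated vertex to \<open>V\<close> tensors \<open>graph_tensor V E m\<close> with the one-dimensional space.
\<close>

definition bond_indices :: "'v set set \<Rightarrow> ('v set \<Rightarrow> nat) \<Rightarrow> 'v \<Rightarrow> ('v set \<Rightarrow> nat) set" where
  "bond_indices E m v = Pi\<^sub>E {e \<in> E. v \<in> e} (\<lambda>e. {..<m e})"

definition graph_tensor ::
  "'v set \<Rightarrow> 'v set set \<Rightarrow> ('v set \<Rightarrow> nat) \<Rightarrow> ('v \<Rightarrow> 'v set \<Rightarrow> nat) \<Rightarrow> complex" where
  "graph_tensor V E m =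
     (\<lambda>k. if k \<in> Pi\<^sub>E V (bond_indices E m)
          then \<Prod>e\<in>E. of_bool (\<forall>u\<in>e. \<forall>v\<in>e. k u e = k v e) else 0)"

definition TNS ::
  "'v set \<Rightarrow> 'v set set \<Rightarrow> ('v set \<Rightarrow> nat) \<Rightarrow> ('v \<Rightarrow> nat) \<Rightarrow> (('v \<Rightarrow> nat) \<Rightarrow> complex) set" where
  "TNS V E m n = zariski closure_of
     (range (\<lambda>X. tensor_map V (bond_indices E m) (phys_indices n) X (graph_tensor V E m)))"

definition param_count :: "'v set \<Rightarrow> 'v set set \<Rightarrow> ('v set \<Rightarrow> nat) \<Rightarrow> ('v \<Rightarrow> nat) \<Rightarrow> int" where
  "param_count V E m n =
     (\<Sum>v\<in>V. int (n v * (\<Prod>e\<in>{e \<in> E. v \<in> e}. m e)) - 1) - (\<Sum>e\<in>E. (int (m e))\<^sup>2 - 1) + 1"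

definition expected_dim :: "'v set \<Rightarrow> 'v set set \<Rightarrow> ('v set \<Rightarrow> nat) \<Rightarrow> ('v \<Rightarrow> nat) \<Rightarrow> int" where
  "expected_dim V E m n = min (param_count V E m n) (int (\<Prod>v\<in>V. n v))"

definition TNS_defect :: "'v set \<Rightarrow> 'v set set \<Rightarrow> ('v set \<Rightarrow> nat) \<Rightarrow> ('v \<Rightarrow> nat) \<Rightarrow> int" where
  "TNS_defect V E m n = expected_dim V E m n - int (variety_dim (TNS V E m n))"

definition fiberdefect :: "'v set \<Rightarrow> 'v set set \<Rightarrow> ('v set \<Rightarrow> nat) \<Rightarrow> ('v \<Rightarrow> nat) \<Rightarrow> int" where
  "fiberdefect V E m n = param_count V E m n - int (variety_dim (TNS V E m n))"

definition defective :: "'v set \<Rightarrow> 'v set set \<Rightarrow> ('v set \<Rightarrow> nat) \<Rightarrow> ('v \<Rightarrow> nat) \<Rightarrow> bool" where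
  "defective V E m n \<longleftrightarrow> int (variety_dim (TNS V E m n)) < expected_dim V E m n"

section \<open>The normal form\<close>

text \<open>
  Bases of the factors of \<open>V\<^sub>0 \<otimes> V\<^sub>1'' \<otimes> V\<^sub>2'' \<otimes> \<complex>\<^sup>1 \<otimes> \<dots> \<otimes> \<complex>\<^sup>1\<close>. The point \<open>z\<close> stands for
  \<open>(z\<^sub>0, \<dots>, z\<^bsub>m-1\<^esub>) \<in> (\<complex>\<^sup>2)\<^sup>m\<close>, where \<open>z (i, k)\<close> is the \<open>k\<close>-th coordinate of \<open>z\<^sub>i\<close>; the tensor is
  \<open>\<Sum>\<^sub>i z\<^sub>i \<otimes> b\<^sub>i \<otimes> c\<^sub>i\<close>.
\<close>

definition pencil_indices :: "nat \<Rightarrow> nat \<Rightarrow> nat set" where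
  "pencil_indices m j = (if j = 0 then {..<2} else if j = 1 \<or> j = 2 then {..<m} else {..<1})"

definition diag_pencil :: "nat \<Rightarrow> nat \<Rightarrow> (nat \<times> nat \<Rightarrow> complex) \<Rightarrow> (nat \<Rightarrow> nat) \<Rightarrow> complex" where
  "diag_pencil d m z =
     (\<lambda>a. if a \<in> Pi\<^sub>E {0..d} (pencil_indices m)
          then \<Sum>i<m. z (i, a 0) * of_bool (a 1 = i) * of_bool (a 2 = i) else 0)"

definition normal_indices ::
  "nat \<Rightarrow> nat set set \<Rightarrow> (nat set \<Rightarrow> nat) \<Rightarrow> nat \<Rightarrow> (nat \<times> (nat set \<Rightarrow> nat)) set" where
  "normal_indices m E' m' j = pencil_indices m j \<times> bond_indices E' m' j"

text \<open>
  An identification of \<open>V\<^sub>1'' \<otimes> V\<^sub>1'\<close>, \<open>V\<^sub>2'' \<otimes> V\<^sub>2'\<close> and \<open>\<complex>\<^sup>1 \<otimes> W\<^sub>j\<close> (\<open>j \<ge> 3\<close>) with \<open>V\<^sub>1, V\<^sub>2, V\<^sub>j\<close>, given by a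
  bijection of bases. At the vertex \<open>0\<close>, where no group acts, it is the canonical \<open>V\<^sub>0 \<otimes> \<complex>\<^sup>1 = V\<^sub>0\<close>.
\<close>

definition identification ::
  "nat \<Rightarrow> nat \<Rightarrow> nat set set \<Rightarrow> (nat set \<Rightarrow> nat) \<Rightarrow> (nat \<Rightarrow> nat)
    \<Rightarrow> (nat \<Rightarrow> nat \<times> (nat set \<Rightarrow> nat) \<Rightarrow> nat) \<Rightarrow> bool" where
  "identification d m E' m' n \<phi> \<longleftrightarrow>
     \<phi> 0 = fst \<and> (\<forall>j\<in>{1..d}. bij_betw (\<phi> j) (normal_indices m E' m' j) (phys_indices n j))"

definition normal_form ::
  "nat \<Rightarrow> nat \<Rightarrow> nat set set \<Rightarrow> (nat set \<Rightarrow> nat) \<Rightarrow> (nat \<Rightarrow> nat)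
    \<Rightarrow> (nat \<Rightarrow> nat \<times> (nat set \<Rightarrow> nat) \<Rightarrow> nat) \<Rightarrow> (nat \<times> nat \<Rightarrow> complex) \<Rightarrow> (nat \<Rightarrow> nat) \<Rightarrow> complex" where
  "normal_form d m E' m' n \<phi> z =
     reindex {0..d} (normal_indices m E' m') (phys_indices n) \<phi>
       (kron {0..d} (diag_pencil d m z) (graph_tensor {0..d} E' m'))"

end

theory Submission
  imports Defs "HOL-Computational_Algebra.Fundamental_Theorem_Algebra" "Jordan_Normal_Form.Determinant"
begin

text \<open>
  The group acting by gauge transformations on the bonds \<open>{0, 1}\<close> and \<open>{0, 2}\<close> diagonalizes a generic
  pencil at vertex \<open>0\<close>, so the variety is the closure of the image of the tuples whose pencil is
  diagonal. On such tuples, the gauge matrix of the edge \<open>{1, 2}\<close> may be chosen independently in each of the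
  \<open>m\<close> summands; this gives the defect \<open>(m - 1) (m\<^sub>1\<^sub>2\<^sup>2 - 1)\<close>. At a base point with identity matrices at
  the vertices \<open>1, \<dots>, d\<close> a coordinate slice for the gauge action is exhibited. The restriction of the
  parametrization to the slice is still dominant, because a polynomial that is annihilated by
  vector fields spanning a complement of the slice and vanishes on the slice has no lowest order part.
  It has injective derivative at the base point, by inspection of the coefficients at the
  configurations that are inconsistent on few edges. Hence the dimension is the number of coordinates of the slice.

  The dimension theory is reduced to one counting argument, the algebraic dependence of more than
  \<open>r\<close> polynomials in \<open>r\<close> variables: functions that successively vanish along a chain of irreducible closed
  sets are algebraically independent, and the images of a flag of affine subspaces with injective
  derivative form a strict chain. The generic normal form holds because the image of a
  polynomial map contains an open subset of its closure.
\<close>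

section \<open>Polynomial functions\<close>

text \<open>Why the edge \<open>{1, 2}\<close> is special: once the pencil is diagonal, the bonds
  \<open>{0, 1}\<close> and \<open>{0, 2}\<close> carry the same summand index i, so among 1, ..., d
  this index is visible at the vertices 1 and 2 only. A gauge matrix can depend on i only if both
  ends of its edge see i. The edge \<open>{1, 2}\<close> thus has m gauge matrices instead of one,
  each counted modulo scalars, and m - 1 of them are missing from the parameter count. The value n_0
  = 2 enters twice. At an off-diagonal position (i, j) the pencil has two coordinates, just as many
  as the two new bonds have gauge parameters moving them, so diagonalization uses up these bonds and
  leaves scalings. And two distinct summands have linearly independent vectors in C^2, which
  separates their contributions to the derivative at the base point.\<close>

lemma poly_funs_diff:
  assumes "p \<in> poly_funs" "q \<in> poly_funs"
  shows "(\<lambda>x. p x - q x) \<in> poly_funs"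
proof -
  have "(\<lambda>x. p x + (-1) * q x) \<in> poly_funs"
    by (intro poly_funs.intros assms)
  then show ?thesis by simp
qed

lemma poly_funs_sum:
  assumes "\<And>a. a \<in> A \<Longrightarrow> p a \<in> poly_funs"
  shows "(\<lambda>x. \<Sum>a\<in>A. p a x) \<in> poly_funs"
  using assms by (induction A rule: infinite_finite_induct) (auto intro: poly_funs.intros)

lemma poly_funs_prod:
  assumes "\<And>a. a \<in> A \<Longrightarrow> p a \<in> poly_funs"
  shows "(\<lambda>x. \<Prod>a\<in>A. p a x) \<in> poly_funs"
  using assms by (induction A rule: infinite_finite_induct) (auto intro: poly_funs.intros)

lemma poly_funs_power:
  assumes "p \<in> poly_funs"
  shows "(\<lambda>x. p x ^ n) \<in> poly_funs"
  using assms by (induction n) (auto intro: poly_funs.intros)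

lemma poly_funs_compose:
  assumes "p \<in> poly_funs" "\<And>i. F i \<in> poly_funs"
  shows "(\<lambda>x. p (\<lambda>i. F i x)) \<in> poly_funs"
  using assms by (induction p rule: poly_funs.induct) (auto intro: poly_funs.intros)

lemma poly_funs_if:
  assumes "b \<Longrightarrow> p \<in> poly_funs" "\<not> b \<Longrightarrow> q \<in> poly_funs"
  shows "(\<lambda>x. if b then p x else q x) \<in> poly_funs"
  using assms by (cases b) auto

lemmas poly_funs_intros = poly_funs.intros poly_funs_diff poly_funs_sum poly_funs_prod poly_funs_power
  poly_funs_if

text \<open>Passes from polynomial functions, which come without degree or coefficients, to
  \<open>poly\<close> in one variable, where finiteness of roots and the absence of zero divisors
  are available.\<close>

lemma poly_funs_line:
  assumes "p \<in> poly_funs"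
  shows "\<exists>\<pi>. \<forall>t. p (\<lambda>i. x i + t * v i) = poly \<pi> t"
  using assms
proof (induction p rule: poly_funs.induct)
  case (const c)
  show ?case by (rule exI[of _ "[:c:]"]) simp
next
  case (coord i)
  show ?case by (rule exI[of _ "[:x i, v i:]"]) simp
next
  case (add p q)
  then show ?case by (metis poly_add)
next
  case (mult p q)
  then show ?case by (metis poly_mult)
qed

text \<open>Restrict both factors to the line joining a point where \<open>p\<close> and a point where \<open>q\<close> does not vanish.\<close>

lemma poly_funs_no_zero_divisors:
  fixes p q :: "('i \<Rightarrow> complex) \<Rightarrow> complex"
  assumes "p \<in> poly_funs" "q \<in> poly_funs"
    and conv: "\<And>x y t. x \<in> A \<Longrightarrow> y \<in> A \<Longrightarrow> (\<lambda>i. x i + t * (y i - x i)) \<in> A"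
    and zero: "\<And>x. x \<in> A \<Longrightarrow> p x * q x = 0"
  shows "(\<forall>x\<in>A. p x = 0) \<or> (\<forall>x\<in>A. q x = 0)"
proof (rule ccontr)
  assume "\<not> ?thesis"
  then obtain x y where xy: "x \<in> A" "p x \<noteq> 0" "y \<in> A" "q y \<noteq> 0" by auto
  obtain \<pi> where \<pi>: "\<And>t. p (\<lambda>i. x i + t * (y i - x i)) = poly \<pi> t"
    using poly_funs_line[OF assms(1), of x "\<lambda>i. y i - x i"] by auto
  obtain \<rho> where \<rho>: "\<And>t. q (\<lambda>i. x i + t * (y i - x i)) = poly \<rho> t"
    using poly_funs_line[OF assms(2), of x "\<lambda>i. y i - x i"] by auto
  have "poly (\<pi> * \<rho>) t = 0" for t
    using zero[OF conv[OF xy(1,3), of t]] by (simp add: \<pi> \<rho>)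
  then have "\<pi> * \<rho> = 0" using poly_all_0_iff_0 by blast
  moreover have "poly \<pi> 0 \<noteq> 0" using xy \<pi>[of 0] by simp
  moreover have "poly \<rho> 1 \<noteq> 0" using xy \<rho>[of 1] by simp
  ultimately show False by auto
qed

text \<open>Expansion in the single coordinate \<open>i\<close> with coefficients free of it. That
  \<open>c j\<close> is literally the zero function beyond \<open>n\<close> lets expansions of
  different length be added and multiplied as sequences.\<close>

lemma poly_funs_expand:
  assumes "p \<in> poly_funs"
  shows "\<exists>n c. (\<forall>j. c j \<in> poly_funs) \<and> (\<forall>j x t. c j (x(i := t)) = c j x) \<and>
    (\<forall>j>n. c j = (\<lambda>_. 0)) \<and> (\<forall>x. p x = (\<Sum>j\<le>n. c j x * x i ^ j))"
  using assms
proof (induction p rule: poly_funs.induct)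
  case (const a)
  show ?case
    by (rule exI[of _ 0], rule exI[of _ "\<lambda>j x. if j = 0 then a else 0"]) (auto intro!: poly_funs_intros)
next
  case (coord k)
  show ?case
  proof (cases "k = i")
    case True
    show ?thesis unfolding True
      by (rule exI[of _ 1], rule exI[of _ "\<lambda>j x. if j = 1 then 1 else 0"])
        (auto intro!: poly_funs_intros simp: fun_eq_iff)
  next
    case False
    then show ?thesis
      by (intro exI[of _ 0] exI[of _ "\<lambda>j x. if j = 0 then x k else 0"]) (auto intro!: poly_funs_intros)
  qed
next
  case (add p q)
  from add.IH(1) obtain n c where p: "\<forall>j. c j \<in> poly_funs" "\<forall>j x t. c j (x(i := t)) = c j x"
    "\<forall>j>n. c j = (\<lambda>_. 0)" "\<forall>x. p x = (\<Sum>j\<le>n. c j x * x i ^ j)" by (elim exE conjE)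
  from add.IH(2) obtain m d where q: "\<forall>j. d j \<in> poly_funs" "\<forall>j x t. d j (x(i := t)) = d j x"
    "\<forall>j>m. d j = (\<lambda>_. 0)" "\<forall>x. q x = (\<Sum>j\<le>m. d j x * x i ^ j)" by (elim exE conjE)
  note p = p[rule_format] and q = q[rule_format]
  have "p x = (\<Sum>j\<le>max n m. c j x * x i ^ j)" for x
    unfolding p(4) by (rule sum.mono_neutral_left) (auto simp: p(3))
  moreover have "q x = (\<Sum>j\<le>max n m. d j x * x i ^ j)" for x
    unfolding q(4) by (rule sum.mono_neutral_left) (auto simp: q(3))
  ultimately have "p x + q x = (\<Sum>j\<le>max n m. (c j x + d j x) * x i ^ j)" for x
    by (simp add: sum.distrib algebra_simps)
  then show ?case
    by (intro exI[of _ "max n m"] exI[of _ "\<lambda>j x. c j x + d j x"] conjI allI impI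
        poly_funs.add p(1) q(1)) (simp_all only: p(2,3) q(2,3) max_less_iff_conj add_0_right)
next
  case (mult p q)
  from mult.IH(1) obtain n c where p: "\<forall>j. c j \<in> poly_funs" "\<forall>j x t. c j (x(i := t)) = c j x"
    "\<forall>j>n. c j = (\<lambda>_. 0)" "\<forall>x. p x = (\<Sum>j\<le>n. c j x * x i ^ j)" by (elim exE conjE)
  from mult.IH(2) obtain m d where q: "\<forall>j. d j \<in> poly_funs" "\<forall>j x t. d j (x(i := t)) = d j x"
    "\<forall>j>m. d j = (\<lambda>_. 0)" "\<forall>x. q x = (\<Sum>j\<le>m. d j x * x i ^ j)" by (elim exE conjE)
  note p = p[rule_format] and q = q[rule_format]
  let ?e = "\<lambda>j x. \<Sum>k\<le>j. c k x * d (j - k) x"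
  have "p x * q x = (\<Sum>j\<le>n + m. ?e j x * x i ^ j)" for x
    unfolding p(4) q(4) using polynomial_product[of n "\<lambda>j. c j x" m "\<lambda>j. d j x" "x i"] p(3) q(3)
    by auto
  moreover have "?e j x = 0" if "j > n + m" for j x
  proof (rule sum.neutral, intro ballI)
    fix k assume "k \<in> {..j}"
    show "c k x * d (j - k) x = 0"
    proof (cases "k > n")
      case False
      then have "j - k > m" using that by auto
      then show ?thesis by (simp add: q(3))
    qed (simp add: p(3))
  qed
  ultimately show ?case
    by (intro exI[of _ "n + m"] exI[of _ ?e] conjI allI impI poly_funs_sum poly_funs.mult p(1) q(1))
      (simp_all add: p(2) q(2) fun_eq_iff del: fun_upd_apply)
qed

text \<open>Taylor expansion at \<open>p\<close>: \<open>c k\<close> is the part of degree k. The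
  scaling factor s is adjoined as an extra coordinate \<open>None\<close>, and expansion in this
  coordinate yields the coefficients.\<close>

lemma poly_funs_scale:
  assumes "q \<in> poly_funs"
  shows "\<exists>n c. (\<forall>k. c k \<in> poly_funs) \<and>
    (\<forall>s y. q (\<lambda>i. p i + s * y i) = (\<Sum>k\<le>n. c k y * s ^ k))"
proof -
  have "(\<lambda>z. q (\<lambda>i. p i + z None * z (Some i))) \<in> poly_funs"
    by (rule poly_funs_compose[OF assms]) (intro poly_funs_intros)
  from poly_funs_expand[OF this, of None] obtain n c where
    c: "\<forall>j. c j \<in> poly_funs" "\<forall>j x t. c j (x(None := t)) = c j x"
       "\<forall>x. q (\<lambda>i. p i + x None * x (Some i)) = (\<Sum>j\<le>n. c j x * x None ^ j)"
    by (elim exE conjE)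
  note c = c[rule_format]
  let ?E = "\<lambda>y t u. case u of None \<Rightarrow> t | Some i \<Rightarrow> y i"
  show ?thesis
  proof (intro exI[of _ n] exI[of _ "\<lambda>k y. c k (?E y 0)"] conjI allI)
    show "(\<lambda>y. c k (?E y 0)) \<in> poly_funs" for k
    proof (rule poly_funs_compose[OF c(1)])
      show "(\<lambda>y. ?E y 0 u) \<in> poly_funs" for u
        by (cases u) (simp_all add: poly_funs_intros)
    qed
    have "q (\<lambda>i. p i + s * y i) = (\<Sum>k\<le>n. c k ((?E y 0)(None := s)) * s ^ k)" for s y
      using c(3)[of "(?E y 0)(None := s)"] by simp
    then show "q (\<lambda>i. p i + s * y i) = (\<Sum>k\<le>n. c k (?E y 0) * s ^ k)" for s y
      by (simp only: c(2))
  qed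
qed

lemma poly_funs_tendsto:
  assumes "q \<in> poly_funs" "\<And>i. ((\<lambda>s. \<gamma> s i) \<longlongrightarrow> x i) F"
  shows "((\<lambda>s. q (\<gamma> s)) \<longlongrightarrow> q x) F"
  using assms(1) by (induction q rule: poly_funs.induct) (auto intro!: tendsto_intros assms(2))

text \<open>Chain rule along arbitrary curves. The index type may be infinite, hence the finite set
  \<open>J\<close> of coordinates; the partial derivatives \<open>q' i\<close> are again
  polynomial.\<close>

lemma poly_funs_deriv:
  fixes q :: "('i \<Rightarrow> complex) \<Rightarrow> complex"
  assumes "q \<in> poly_funs"
  shows "\<exists>J q'. finite J \<and> (\<forall>i. q' i \<in> poly_funs) \<and> (\<forall>\<gamma> \<gamma>' t.
    (\<forall>i. ((\<lambda>s. \<gamma> s i) has_field_derivative \<gamma>' i) (at t)) \<longrightarrow>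
    ((\<lambda>s. q (\<gamma> s)) has_field_derivative (\<Sum>i\<in>J. \<gamma>' i * q' i (\<gamma> t))) (at t))"
  using assms
proof (induction q rule: poly_funs.induct)
  case (const c)
  show ?case by (rule exI[of _ "{}"], rule exI[of _ "\<lambda>i x. 0"]) (auto intro!: poly_funs_intros)
next
  case (coord k)
  show ?case by (rule exI[of _ "{k}"], rule exI[of _ "\<lambda>i x. 1"]) (auto intro!: poly_funs_intros)
next
  case (add p q)
  from add.IH(1) obtain J p' where p: "finite J" "\<forall>i. p' i \<in> poly_funs"
    "\<forall>\<gamma> \<gamma>' t. (\<forall>i. ((\<lambda>s. \<gamma> s i) has_field_derivative \<gamma>' i) (at t)) \<longrightarrow>
      ((\<lambda>s. p (\<gamma> s)) has_field_derivative (\<Sum>i\<in>J. \<gamma>' i * p' i (\<gamma> t))) (at t)"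
    by (elim exE conjE)
  from add.IH(2) obtain K q' where q: "finite K" "\<forall>i. q' i \<in> poly_funs"
    "\<forall>\<gamma> \<gamma>' t. (\<forall>i. ((\<lambda>s. \<gamma> s i) has_field_derivative \<gamma>' i) (at t)) \<longrightarrow>
      ((\<lambda>s. q (\<gamma> s)) has_field_derivative (\<Sum>i\<in>K. \<gamma>' i * q' i (\<gamma> t))) (at t)"
    by (elim exE conjE)
  note p = p[rule_format] and q = q[rule_format]
  let ?r = "\<lambda>i x. (if i \<in> J then p' i x else 0) + (if i \<in> K then q' i x else 0)"
  have eq: "(\<Sum>i\<in>J \<union> K. v i * ?r i x) = (\<Sum>i\<in>J. v i * p' i x) + (\<Sum>i\<in>K. v i * q' i x)" for v x
  proof -
    have "(\<Sum>i\<in>J. v i * p' i x) = (\<Sum>i\<in>J\<union>K. v i * (if i \<in> J then p' i x else 0))"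
      by (rule sum.mono_neutral_cong_left) (auto simp: p q)
    moreover have "(\<Sum>i\<in>K. v i * q' i x) = (\<Sum>i\<in>J\<union>K. v i * (if i \<in> K then q' i x else 0))"
      by (rule sum.mono_neutral_cong_left) (auto simp: p q)
    ultimately show ?thesis by (simp add: sum.distrib algebra_simps)
  qed
  show ?case
    by (rule exI[of _ "J \<union> K"], rule exI[of _ ?r])
      (simp only: eq finite_Un p(1) q(1) simp_thms, intro allI conjI impI poly_funs_intros p(2) q(2) DERIV_add p(3) q(3), simp_all)
next
  case (mult p q)
  from mult.IH(1) obtain J p' where p: "finite J" "\<forall>i. p' i \<in> poly_funs"
    "\<forall>\<gamma> \<gamma>' t. (\<forall>i. ((\<lambda>s. \<gamma> s i) has_field_derivative \<gamma>' i) (at t)) \<longrightarrow>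
      ((\<lambda>s. p (\<gamma> s)) has_field_derivative (\<Sum>i\<in>J. \<gamma>' i * p' i (\<gamma> t))) (at t)"
    by (elim exE conjE)
  from mult.IH(2) obtain K q' where q: "finite K" "\<forall>i. q' i \<in> poly_funs"
    "\<forall>\<gamma> \<gamma>' t. (\<forall>i. ((\<lambda>s. \<gamma> s i) has_field_derivative \<gamma>' i) (at t)) \<longrightarrow>
      ((\<lambda>s. q (\<gamma> s)) has_field_derivative (\<Sum>i\<in>K. \<gamma>' i * q' i (\<gamma> t))) (at t)"
    by (elim exE conjE)
  note p = mult.hyps(1) p[rule_format] and q = mult.hyps(2) q[rule_format]
  let ?r = "\<lambda>i x. (if i \<in> J then p' i x * q x else 0) + (if i \<in> K then q' i x * p x else 0)"
  have eq: "(\<Sum>i\<in>J \<union> K. v i * ?r i x) = (\<Sum>i\<in>J. v i * p' i x) * q x + (\<Sum>i\<in>K. v i * q' i x) * p x" for v x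
  proof -
    have "(\<Sum>i\<in>J. v i * p' i x) * q x = (\<Sum>i\<in>J\<union>K. v i * (if i \<in> J then p' i x * q x else 0))"
      unfolding sum_distrib_right by (rule sum.mono_neutral_cong_left) (auto simp: p q)
    moreover have "(\<Sum>i\<in>K. v i * q' i x) * p x = (\<Sum>i\<in>J\<union>K. v i * (if i \<in> K then q' i x * p x else 0))"
      unfolding sum_distrib_right by (rule sum.mono_neutral_cong_left) (auto simp: p q)
    ultimately show ?thesis by (simp add: sum.distrib algebra_simps)
  qed
  show ?case
    by (rule exI[of _ "J \<union> K"], rule exI[of _ ?r])
      (simp only: eq finite_Un p(2) q(2) simp_thms, intro allI conjI impI poly_funs_intros p(1,3) q(1,3) DERIV_mult p(4) q(4), simp_all)
qed

section \<open>The Zariski topology\<close>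

lemma openin_zariski:
  "openin zariski U \<longleftrightarrow> (\<forall>x\<in>U. \<exists>p\<in>poly_funs. p x \<noteq> 0 \<and> {y. p y \<noteq> 0} \<subseteq> U)"
proof
  assume "openin zariski U"
  then have "generate_topology_on {{x. p x \<noteq> 0} |p. p \<in> poly_funs} U"
    by (simp add: zariski_def openin_topology_generated_by_iff)
  then show "\<forall>x\<in>U. \<exists>p\<in>poly_funs. p x \<noteq> 0 \<and> {y. p y \<noteq> 0} \<subseteq> U"
  proof (induction rule: generate_topology_on.induct)
    case (Int a b)
    show ?case
    proof
      fix x assume "x \<in> a \<inter> b"
      then obtain p q where "p \<in> poly_funs" "p x \<noteq> 0" "{y. p y \<noteq> 0} \<subseteq> a"
        "q \<in> poly_funs" "q x \<noteq> 0" "{y. q y \<noteq> 0} \<subseteq> b" using Int by blast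
      then show "\<exists>p\<in>poly_funs. p x \<noteq> 0 \<and> {y. p y \<noteq> 0} \<subseteq> a \<inter> b"
        by (intro bexI[of _ "\<lambda>x. p x * q x"]) (auto intro: poly_funs.mult)
    qed
  next
    case (UN K)
    show ?case
    proof
      fix x assume "x \<in> \<Union>K"
      then obtain k where k: "k \<in> K" "x \<in> k" by blast
      then obtain p where "p \<in> poly_funs" "p x \<noteq> 0" "{y. p y \<noteq> 0} \<subseteq> k" using UN.IH by blast
      then show "\<exists>p\<in>poly_funs. p x \<noteq> 0 \<and> {y. p y \<noteq> 0} \<subseteq> \<Union>K" using k by blast
    qed
  next
    case (Basis s)
    then show ?case by blast
  qed simp
next
  assume *: "\<forall>x\<in>U. \<exists>p\<in>poly_funs. p x \<noteq> 0 \<and> {y. p y \<noteq> 0} \<subseteq> U"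
  have "\<Union>{{y. p y \<noteq> 0} |p. p \<in> poly_funs \<and> {y. p y \<noteq> 0} \<subseteq> U} = U"
    using * by blast
  moreover have "openin zariski {y. p y \<noteq> 0}" if "p \<in> poly_funs" for p
    using that unfolding zariski_def by (intro topology_generated_by_Basis) blast
  then have "openin zariski (\<Union>{{y. p y \<noteq> 0} |p. p \<in> poly_funs \<and> {y. p y \<noteq> 0} \<subseteq> U})"
    by (intro openin_Union) blast
  ultimately show "openin zariski U" by simp
qed

lemma topspace_zariski [simp]: "topspace zariski = UNIV"
proof -
  have "openin zariski UNIV"
    unfolding openin_zariski by (auto intro!: bexI[of _ "\<lambda>_. 1"] poly_funs.intros)
  then show ?thesis using openin_subset by fastforce
qed

lemma openin_basic: "p \<in> poly_funs \<Longrightarrow> openin zariski {x. p x \<noteq> 0}"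
  by (auto simp: openin_zariski)

lemma closedin_basic: "p \<in> poly_funs \<Longrightarrow> closedin zariski {x. p x = 0}"
proof -
  assume "p \<in> poly_funs"
  then have "openin zariski {x. p x \<noteq> 0}" by (rule openin_basic)
  moreover have "{x. p x \<noteq> 0} = UNIV - {x. p x = 0}" by auto
  ultimately show ?thesis by (simp add: closedin_def)
qed

text \<open>The closure is the zero set of the vanishing ideal. Later arguments on closures run
  through vanishing polynomials by this equivalence.\<close>

lemma closure_of_zariski:
  "x \<in> zariski closure_of S \<longleftrightarrow> (\<forall>p\<in>poly_funs. (\<forall>s\<in>S. p s = 0) \<longrightarrow> p x = 0)"
proof
  assume x: "x \<in> zariski closure_of S"
  show "\<forall>p\<in>poly_funs. (\<forall>s\<in>S. p s = 0) \<longrightarrow> p x = 0"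
  proof (intro ballI impI)
    fix p assume p: "p \<in> poly_funs" "\<forall>s\<in>S. p s = 0"
    have "zariski closure_of S \<subseteq> {x. p x = 0}"
      by (rule closure_of_minimal) (use p closedin_basic in auto)
    then show "p x = 0" using x by auto
  qed
next
  assume *: "\<forall>p\<in>poly_funs. (\<forall>s\<in>S. p s = 0) \<longrightarrow> p x = 0"
  show "x \<in> zariski closure_of S"
    unfolding in_closure_of
  proof (intro conjI allI impI)
    fix T assume "x \<in> T \<and> openin zariski T"
    then obtain p where p: "p \<in> poly_funs" "p x \<noteq> 0" "{y. p y \<noteq> 0} \<subseteq> T"
      using openin_zariski by blast
    then obtain s where "s \<in> S" "p s \<noteq> 0" using * by blast
    then show "\<exists>y. y \<in> S \<and> y \<in> T" using p by blast
  qed simp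
qed

lemma irreducible_closedin_mult:
  assumes "irreducible_closedin (subtopology zariski Y) Z"
    and "p \<in> poly_funs" "q \<in> poly_funs" "\<And>x. x \<in> Z \<Longrightarrow> p x * q x = 0"
  shows "(\<forall>x\<in>Z. p x = 0) \<or> (\<forall>x\<in>Z. q x = 0)"
proof -
  have Z: "closedin (subtopology zariski Y) Z" using assms(1) irreducible_closedin_def by blast
  have cl: "closedin (subtopology zariski Y) (Z \<inter> {x. r x = 0})" if "r \<in> poly_funs" for r
  proof -
    obtain C where C: "closedin zariski C" "Z = C \<inter> Y" using Z by (auto simp: closedin_subtopology)
    then have "Z \<inter> {x. r x = 0} = (C \<inter> {x. r x = 0}) \<inter> Y" by auto
    then show ?thesis using C(1) closedin_basic[OF that] closedin_subtopology by blast
  qed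
  have "Z = (Z \<inter> {x. p x = 0}) \<union> (Z \<inter> {x. q x = 0})" using assms(4) by auto
  then have "Z = Z \<inter> {x. p x = 0} \<or> Z = Z \<inter> {x. q x = 0}"
    using assms(1) cl[OF assms(2)] cl[OF assms(3)] unfolding irreducible_closedin_def by blast
  then show ?thesis by auto
qed

lemma closedin_zariski_separate:
  assumes "closedin (subtopology zariski Y) Z" "x \<in> Y" "x \<notin> Z"
  obtains q where "q \<in> poly_funs" "q x \<noteq> 0" "\<And>z. z \<in> Z \<Longrightarrow> q z = 0"
proof -
  obtain C where C: "closedin zariski C" "Z = C \<inter> Y" using assms by (auto simp: closedin_subtopology)
  then have "openin zariski (- C)" "x \<in> - C" using assms by (auto simp: closedin_def Compl_eq_Diff_UNIV)
  then obtain q where "q \<in> poly_funs" "q x \<noteq> 0" "{y. q y \<noteq> 0} \<subseteq> - C"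
    using openin_zariski by blast
  then show ?thesis using C that by blast
qed

text \<open>The premise on products says that the vanishing ideal of \<open>S\<close> is prime; two
  proper closed pieces covering the closure would provide functions \<open>p\<close> and
  \<open>q\<close> that violate it.\<close>

lemma irreducible_closedin_closure:
  assumes "S \<noteq> {}" "zariski closure_of S \<subseteq> Y"
    and *: "\<And>p q. p \<in> poly_funs \<Longrightarrow> q \<in> poly_funs \<Longrightarrow> (\<And>x. x \<in> S \<Longrightarrow> p x * q x = 0) \<Longrightarrow>
      (\<forall>x\<in>S. p x = 0) \<or> (\<forall>x\<in>S. q x = 0)"
  shows "irreducible_closedin (subtopology zariski Y) (zariski closure_of S)"
  unfolding irreducible_closedin_def
proof (intro conjI allI impI)
  have SY: "S \<subseteq> zariski closure_of S" by (simp add: closure_of_subset)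
  show "closedin (subtopology zariski Y) (zariski closure_of S)"
    using assms(2) by (meson closedin_closure_of closedin_subset_topspace)
  show "zariski closure_of S \<noteq> {}" using SY assms(1) by auto
  fix A B assume AB: "closedin (subtopology zariski Y) A \<and> closedin (subtopology zariski Y) B \<and>
    zariski closure_of S = A \<union> B"
  show "zariski closure_of S = A \<or> zariski closure_of S = B"
  proof (rule ccontr)
    assume "\<not> ?thesis"
    then obtain a b where ab: "a \<in> zariski closure_of S" "a \<notin> A" "b \<in> zariski closure_of S" "b \<notin> B"
      using AB by blast
    obtain p where p: "p \<in> poly_funs" "p a \<noteq> 0" "\<And>z. z \<in> A \<Longrightarrow> p z = 0"
      using closedin_zariski_separate[of Y A a] AB ab assms(2) by blast
    obtain q where q: "q \<in> poly_funs" "q b \<noteq> 0" "\<And>z. z \<in> B \<Longrightarrow> q z = 0"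
      using closedin_zariski_separate[of Y B b] AB ab assms(2) by blast
    have "p x * q x = 0" if "x \<in> S" for x
      using that SY AB p(3) q(3) by auto
    then have "(\<forall>x\<in>S. p x = 0) \<or> (\<forall>x\<in>S. q x = 0)" using * p(1) q(1) by blast
    then show False using ab p q by (auto simp: closure_of_zariski)
  qed
qed

lemma closure_of_image_eqI:
  fixes f :: "'b \<Rightarrow> ('i \<Rightarrow> complex) \<Rightarrow> complex"
  assumes "\<And>q. q \<in> poly_funs \<Longrightarrow> (\<And>x. x \<in> A \<Longrightarrow> q (\<lambda>b. f b x) = 0) \<Longrightarrow> (\<And>x. x \<in> B \<Longrightarrow> q (\<lambda>b. f b x) = 0)"
    and "A \<subseteq> B"
  shows "zariski closure_of ((\<lambda>x b. f b x) ` A) = zariski closure_of ((\<lambda>x b. f b x) ` B)"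
proof -
  have "(\<forall>s\<in>(\<lambda>x b. f b x) ` A. q s = 0) \<longleftrightarrow> (\<forall>s\<in>(\<lambda>x b. f b x) ` B. q s = 0)" if "q \<in> poly_funs" for q
    using assms that by blast
  then show ?thesis by (auto simp: set_eq_iff closure_of_zariski)
qed

lemma closure_of_zariskiD:
  assumes "x \<in> zariski closure_of S" "p \<in> poly_funs" "\<And>s. s \<in> S \<Longrightarrow> p s = 0"
  shows "p x = 0"
  using assms by (simp add: closure_of_zariski)

section \<open>Algebraic dependence\<close>

lemma homogeneous_system_nontrivial:
  fixes M :: "'a \<Rightarrow> 'b \<Rightarrow> complex"
  assumes "finite B" "finite A" "card B < card A"
  shows "\<exists>c. (\<exists>a\<in>A. c a \<noteq> 0) \<and> (\<forall>b\<in>B. (\<Sum>a\<in>A. c a * M a b) = 0)"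
  using assms
proof (induction B arbitrary: A M rule: finite_induct)
  case empty
  then have "A \<noteq> {}" by auto
  then show ?case by (intro exI[of _ "\<lambda>_. 1"]) auto
next
  case (insert b B)
  show ?case
  proof (cases "\<forall>a\<in>A. M a b = 0")
    case True
    have "card B < card A" using insert by auto
    from insert.IH[OF insert.prems(1) this, of M] True show ?thesis by auto
  next
    case False
    then obtain a0 where a0: "a0 \<in> A" "M a0 b \<noteq> 0" by auto
    let ?A = "A - {a0}"
    have "card B < card ?A" "finite ?A" using insert a0 by auto
    from insert.IH[OF this(2,1), of "\<lambda>a b'. M a b' - M a b / M a0 b * M a0 b'"]
    obtain c where c: "\<exists>a\<in>?A. c a \<noteq> 0"
      "\<And>b'. b' \<in> B \<Longrightarrow> (\<Sum>a\<in>?A. c a * (M a b' - M a b / M a0 b * M a0 b')) = 0" by blast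
    define c0 where "c0 = - (\<Sum>a\<in>?A. c a * M a b) / M a0 b"
    have sum: "(\<Sum>a\<in>A. (c(a0 := c0)) a * M a b') = c0 * M a0 b' + (\<Sum>a\<in>?A. c a * M a b')" for b'
      by (subst sum.remove[OF insert.prems(1) a0(1)]) (auto intro!: sum.cong)
    have "(\<Sum>a\<in>A. (c(a0 := c0)) a * M a b') = 0" if "b' \<in> insert b B" for b'
    proof (cases "b' = b")
      case True
      then show ?thesis using a0 by (simp only: sum) (simp add: c0_def)
    next
      case False
      have "c0 * M a0 b' = - (\<Sum>a\<in>?A. c a * (M a b / M a0 b * M a0 b'))"
        unfolding c0_def minus_divide_left [symmetric] mult_minus_left sum_divide_distrib sum_distrib_right
        by (simp add: mult.assoc)
      then show ?thesis using c(2)[of b'] that False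
        by (simp only: sum) (simp add: right_diff_distrib sum_subtractf)
    qed
    moreover have "\<exists>a\<in>A. (c(a0 := c0)) a \<noteq> 0" using c(1) by auto
    ultimately show ?thesis by blast
  qed
qed

section \<open>Degree bounds in each coordinate and vanishing on grids\<close>

definition degree_le :: "'i \<Rightarrow> nat \<Rightarrow> (('i \<Rightarrow> complex) \<Rightarrow> complex) \<Rightarrow> bool" where
  "degree_le i n q \<longleftrightarrow> (\<forall>x. \<exists>\<pi>. degree \<pi> \<le> n \<and> (\<forall>t. q (x(i := t)) = poly \<pi> t))"

lemma degree_le_mono: "degree_le i n q \<Longrightarrow> n \<le> m \<Longrightarrow> degree_le i m q"
  unfolding degree_le_def by (meson le_trans)

lemma degree_le_const: "degree_le i n (\<lambda>_. c)"
  unfolding degree_le_def by (auto intro: exI[of _ "[:c:]"])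

lemma degree_le_coord: "degree_le i 1 (\<lambda>x. x k)"
  unfolding degree_le_def
proof
  fix x :: "'a \<Rightarrow> complex"
  show "\<exists>\<pi>. degree \<pi> \<le> 1 \<and> (\<forall>t. (x(i := t)) k = poly \<pi> t)"
    by (rule exI[of _ "if k = i then [:0, 1:] else [:x k:]"]) auto
qed

lemma degree_le_add:
  assumes "degree_le i n p" "degree_le i n q"
  shows "degree_le i n (\<lambda>x. p x + q x)"
  unfolding degree_le_def
proof
  fix x
  obtain \<pi> \<rho> where "degree \<pi> \<le> n" "\<forall>t. p (x(i := t)) = poly \<pi> t"
    "degree \<rho> \<le> n" "\<forall>t. q (x(i := t)) = poly \<rho> t" using assms unfolding degree_le_def by blast
  then show "\<exists>\<pi>. degree \<pi> \<le> n \<and> (\<forall>t. p (x(i := t)) + q (x(i := t)) = poly \<pi> t)"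
    by (intro exI[of _ "\<pi> + \<rho>"]) (auto intro: degree_add_le)
qed

lemma degree_le_mult:
  assumes "degree_le i n p" "degree_le i m q"
  shows "degree_le i (n + m) (\<lambda>x. p x * q x)"
  unfolding degree_le_def
proof
  fix x
  obtain \<pi> \<rho> where *: "degree \<pi> \<le> n" "\<forall>t. p (x(i := t)) = poly \<pi> t"
    "degree \<rho> \<le> m" "\<forall>t. q (x(i := t)) = poly \<rho> t" using assms unfolding degree_le_def by blast
  moreover have "degree (\<pi> * \<rho>) \<le> n + m" using degree_mult_le[of \<pi> \<rho>] * by linarith
  ultimately show "\<exists>\<pi>. degree \<pi> \<le> n + m \<and> (\<forall>t. p (x(i := t)) * q (x(i := t)) = poly \<pi> t)"
    by (intro exI[of _ "\<pi> * \<rho>"]) auto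
qed

lemma degree_le_sum:
  assumes "\<And>a. a \<in> A \<Longrightarrow> degree_le i n (q a)"
  shows "degree_le i n (\<lambda>x. \<Sum>a\<in>A. q a x)"
  using assms
  by (induction A rule: infinite_finite_induct) (auto intro: degree_le_const degree_le_add)

lemma degree_le_power:
  assumes "degree_le i n q"
  shows "degree_le i (n * k) (\<lambda>x. q x ^ k)"
  using assms
  by (induction k) (auto intro: degree_le_const degree_le_mult)

lemma degree_le_prod:
  assumes "\<And>a. a \<in> A \<Longrightarrow> degree_le i n (q a)"
  shows "degree_le i (card A * n) (\<lambda>x. \<Prod>a\<in>A. q a x)"
  using assms
  by (induction A rule: infinite_finite_induct) (auto intro: degree_le_const degree_le_mult)

lemma poly_funs_degree_le:
  assumes "p \<in> poly_funs"
  shows "\<exists>n. \<forall>i. degree_le i n p"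
  using assms
proof (induction p rule: poly_funs.induct)
  case (add p q)
  then obtain n m where nm: "\<forall>i. degree_le i n p" "\<forall>i. degree_le i m q" by blast
  have "degree_le i (max n m) (\<lambda>x. p x + q x)" for i
    by (intro degree_le_add degree_le_mono[OF nm(1)[rule_format]] degree_le_mono[OF nm(2)[rule_format]]) auto
  then show ?case by blast
next
  case (mult p q)
  then obtain n m where nm: "\<forall>i. degree_le i n p" "\<forall>i. degree_le i m q" by blast
  have "degree_le i (n + m) (\<lambda>x. p x * q x)" for i
    using nm by (intro degree_le_mult) auto
  then show ?case by blast
qed (rule exI, rule allI, rule degree_le_const degree_le_coord)+

text \<open>Coordinate by coordinate, the values at 0, ..., n are n + 1 roots of a polynomial of
  degree at most n. The reference point \<open>p\<close> takes up the coordinates outside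
  \<open>T\<close>; the induction moves one coordinate at a time into it.\<close>

lemma zero_on_grid:
  assumes "finite T" "\<And>i. i \<in> T \<Longrightarrow> degree_le i n q"
    and "\<And>x. (\<And>i. i \<in> T \<Longrightarrow> x i \<in> of_nat ` {..n}) \<Longrightarrow> (\<And>i. i \<notin> T \<Longrightarrow> x i = p i) \<Longrightarrow> q x = 0"
    and "\<And>i. i \<notin> T \<Longrightarrow> x i = p i"
  shows "q x = 0"
  using assms
proof (induction T arbitrary: p x rule: finite_induct)
  case empty
  then show ?case by simp
next
  case (insert i T)
  have zero: "q (x(i := of_nat a)) = 0" if "a \<le> n" for a
  proof (rule insert.IH[of "p(i := of_nat a)"])
    show "degree_le j n q" if "j \<in> T" for j using insert.prems(1) that by blast
    show "(x(i := of_nat a)) j = (p(i := of_nat a)) j" if "j \<notin> T" for j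
      using insert.prems(3)[of j] that by auto
    show "q x' = 0" if "\<And>j. j \<in> T \<Longrightarrow> x' j \<in> of_nat ` {..n}"
      "\<And>j. j \<notin> T \<Longrightarrow> x' j = (p(i := of_nat a)) j" for x'
    proof (rule insert.prems(2))
      show "x' j \<in> of_nat ` {..n}" if "j \<in> insert i T" for j
        using that \<open>\<And>j. j \<in> T \<Longrightarrow> x' j \<in> of_nat ` {..n}\<close>
          \<open>\<And>j. j \<notin> T \<Longrightarrow> x' j = (p(i := of_nat a)) j\<close>[of i] \<open>a \<le> n\<close> insert.hyps by auto
      show "x' j = p j" if "j \<notin> insert i T" for j
        using that \<open>\<And>j. j \<notin> T \<Longrightarrow> x' j = (p(i := of_nat a)) j\<close>[of j] by auto
    qed
  qed
  obtain \<pi> where \<pi>: "degree \<pi> \<le> n" "\<And>t. q (x(i := t)) = poly \<pi> t"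
    using insert.prems(1)[of i] unfolding degree_le_def by blast
  have "\<pi> = 0"
  proof (rule ccontr)
    assume "\<pi> \<noteq> 0"
    have "of_nat ` {..n} \<subseteq> {t. poly \<pi> t = 0}" using zero \<pi>(2) by auto
    then have "card (of_nat ` {..n} :: complex set) \<le> card {t. poly \<pi> t = 0}"
      by (intro card_mono poly_roots_finite \<open>\<pi> \<noteq> 0\<close>)
    moreover have "card (of_nat ` {..n} :: complex set) = n + 1"
      by (subst card_image) (auto simp: inj_on_def)
    ultimately show False using card_poly_roots_bound[OF \<open>\<pi> \<noteq> 0\<close>] \<pi>(1) by linarith
  qed
  then show ?case using \<pi>(2)[of "x i"] by simp
qed

lemma monomials_independent:
  assumes "finite U" "\<And>y. (\<Sum>e\<in>Pi\<^sub>E U (\<lambda>_. {..k}). c e * (\<Prod>u\<in>U. y u ^ e u)) = (0::complex)"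
    and "e \<in> Pi\<^sub>E U (\<lambda>_. {..k::nat})"
  shows "c e = 0"
  using assms
proof (induction U arbitrary: c e rule: finite_induct)
  case empty
  then show ?case by simp
next
  case (insert u U)
  have split: "(\<Sum>e\<in>Pi\<^sub>E (insert u U) (\<lambda>_. {..k}). c e * (\<Prod>u\<in>insert u U. y u ^ e u)) =
    (\<Sum>a\<le>k. (\<Sum>e\<in>Pi\<^sub>E U (\<lambda>_. {..k}). c (e(u := a)) * (\<Prod>u\<in>U. y u ^ e u)) * y u ^ a)" for y
  proof -
    have "(\<Prod>v\<in>insert u U. y v ^ (g(u := a)) v) = y u ^ a * (\<Prod>u\<in>U. y u ^ g u)" for g a
    proof -
      have "(\<Prod>v\<in>U. y v ^ (g(u := a)) v) = (\<Prod>u\<in>U. y u ^ g u)"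
        using insert.hyps by (intro prod.cong) auto
      then show ?thesis using insert.hyps by simp
    qed
    then show ?thesis
      unfolding PiE_insert_eq
      by (subst sum.reindex[OF inj_combinator[OF insert.hyps(2)]])
        (simp add: sum.cartesian_product' sum_distrib_left sum_distrib_right mult_ac)
  qed
  obtain a e' where e: "a \<le> k" "e' \<in> Pi\<^sub>E U (\<lambda>_. {..k})" "e = e'(u := a)"
    using insert.prems(2) unfolding PiE_insert_eq by auto
  have "(\<Sum>e\<in>Pi\<^sub>E U (\<lambda>_. {..k}). c (e(u := a)) * (\<Prod>u\<in>U. y u ^ e u)) = 0" for y
  proof -
    let ?C = "\<lambda>a. \<Sum>e\<in>Pi\<^sub>E U (\<lambda>_. {..k}). c (e(u := a)) * (\<Prod>u\<in>U. y u ^ e u)"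
    have "(\<Sum>a\<le>k. ?C a * t ^ a) = 0" for t
    proof -
      have "(\<Prod>v\<in>U. (y(u := t)) v ^ e v) = (\<Prod>v\<in>U. y v ^ e v)" for e :: "'a \<Rightarrow> nat"
        using insert.hyps by (intro prod.cong) auto
      then show ?thesis using insert.prems(1)[of "y(u := t)"] unfolding split by simp
    qed
    then have "\<forall>a\<le>k. ?C a = 0" using polyfun_eq_0[of ?C k] by blast
    then show ?thesis using e(1) by blast
  qed
  then have "c (e'(u := a)) = 0" using e(2) by (rule insert.IH)
  then show ?case by (simp only: e(3))
qed

text \<open>There are more monomials of degree at most \<open>k\<close> in the \<open>G u\<close> than points in a grid on which
  their combinations are determined.\<close>

lemma algebraically_dependent:
  fixes G :: "'k \<Rightarrow> ('i \<Rightarrow> complex) \<Rightarrow> complex"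
  assumes "finite T" "finite U" "card T < card U" "\<And>u. u \<in> U \<Longrightarrow> G u \<in> poly_funs"
  shows "\<exists>P. P \<in> poly_funs \<and> (\<exists>y. P y \<noteq> 0) \<and>
    (\<forall>y y'. (\<forall>u\<in>U. y u = y' u) \<longrightarrow> P y = P y') \<and>
    (\<forall>x. (\<forall>i. i \<notin> T \<longrightarrow> x i = p i) \<longrightarrow> P (\<lambda>u. G u x) = 0)"
proof -
  have "\<forall>u\<in>U. \<exists>n. \<forall>i. degree_le i n (G u)" using poly_funs_degree_le assms(4) by blast
  then obtain g0 where g0: "\<And>u i. u \<in> U \<Longrightarrow> degree_le i (g0 u) (G u)" by metis
  define g where "g = Max (g0 ` U)"
  have g: "degree_le i g (G u)" if "u \<in> U" for u i
    using degree_le_mono[OF g0[OF that]] that assms(2) by (simp add: g_def)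
  \<comment> \<open>Write c = \<open>card U * g + 1\<close> and t = \<open>card T\<close>. The grid
    has at most (c (k + 1))^t points, and k = c^t turns this into k (k + 1)^t, which is less than
    the number of monomials, at least (k + 1)^(t + 1).\<close>
  define k where "k = (card U * g + 1) ^ card T"
  define n where "n = card U * (g * k)"
  define A where "A = Pi\<^sub>E U (\<lambda>_. {..k})"
  define B where "B = Pi\<^sub>E T (\<lambda>_. {..n})"
  have fin: "finite A" "finite B" using assms by (auto simp: A_def B_def intro!: finite_PiE)
  have "card B = (n + 1) ^ card T" using assms(1) by (simp add: B_def card_PiE)
  also have "\<dots> \<le> ((card U * g + 1) * (k + 1)) ^ card T"
    by (rule power_mono) (auto simp: n_def algebra_simps)
  also have "\<dots> = k * (k + 1) ^ card T" by (simp only: power_mult_distrib k_def)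
  also have "\<dots> < (k + 1) * (k + 1) ^ card T" by simp
  also have "\<dots> = (k + 1) ^ (card T + 1)" by simp
  also have "\<dots> \<le> (k + 1) ^ card U" using assms(3) by (intro power_increasing) auto
  also have "\<dots> = card A" using assms(2) by (simp add: A_def card_PiE)
  finally have "card B < card A" .
  define pt where "pt b i = (if i \<in> T then of_nat (b i) else p i)" for b :: "'i \<Rightarrow> nat" and i
  obtain c where c: "\<exists>a\<in>A. c a \<noteq> 0" "\<And>b. b \<in> B \<Longrightarrow> (\<Sum>e\<in>A. c e * (\<Prod>u\<in>U. G u (pt b) ^ e u)) = 0"
    using homogeneous_system_nontrivial[OF fin(2,1) \<open>card B < card A\<close>,
        of "\<lambda>e b. \<Prod>u\<in>U. G u (pt b) ^ e u"] by blast
  let ?P = "\<lambda>y. \<Sum>e\<in>A. c e * (\<Prod>u\<in>U. y u ^ e u)"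
  show ?thesis
  proof (intro exI[of _ ?P] conjI allI impI)
    show "?P \<in> poly_funs" by (intro poly_funs_intros)
    show "\<exists>y. ?P y \<noteq> 0"
      using monomials_independent[OF assms(2), of c k] c(1) unfolding A_def by blast
    show "?P y = ?P y'" if "\<forall>u\<in>U. y u = y' u" for y y'
      using that by (intro sum.cong arg_cong2[of _ _ _ _ "(*)"] prod.cong) auto
    show "?P (\<lambda>u. G u x) = 0" if x: "\<forall>i. i \<notin> T \<longrightarrow> x i = p i" for x
    proof (rule zero_on_grid[OF assms(1), where n = n and q = "\<lambda>x. ?P (\<lambda>u. G u x)" and p = p])
      show "degree_le i n (\<lambda>x. ?P (\<lambda>u. G u x))" for i
      proof (rule degree_le_sum)
        fix e assume e: "e \<in> A"
        have "degree_le i (0 + card U * (g * k)) (\<lambda>x. c e * (\<Prod>u\<in>U. G u x ^ e u))"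
        proof (intro degree_le_mult degree_le_const degree_le_prod)
          fix u assume u: "u \<in> U"
          then have "e u \<le> k" using e by (auto simp: A_def)
          then show "degree_le i (g * k) (\<lambda>x. G u x ^ e u)"
            by (intro degree_le_mono[OF degree_le_power[OF g[OF u]]]) auto
        qed
        then show "degree_le i n (\<lambda>x. c e * (\<Prod>u\<in>U. G u x ^ e u))" by (simp add: n_def)
      qed
    next
      fix x assume x: "\<And>i. i \<in> T \<Longrightarrow> x i \<in> of_nat ` {..n}" "\<And>i. i \<notin> T \<Longrightarrow> x i = p i"
      have "\<forall>i\<in>T. \<exists>a\<le>n. x i = of_nat a" using x(1) by auto
      then obtain b where b: "\<And>i. i \<in> T \<Longrightarrow> b i \<le> n \<and> x i = of_nat (b i)" by metis
      have "x = pt (restrict b T)" using b x(2) by (auto simp: fun_eq_iff pt_def)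
      moreover have "restrict b T \<in> B" using b by (auto simp: B_def)
      ultimately show "?P (\<lambda>u. G u x) = 0" using c(2) by simp
    qed (use x in blast)
  qed
qed

section \<open>Dimension of parametrized varieties\<close>

text \<open>In a relation between the \<open>q i\<close>, a power of the last one can be cancelled on \<open>Z s\<close>; the rest
  restricts to a relation between the others on \<open>Z (s - 1)\<close>.\<close>

lemma chain_algebraically_independent:
  fixes q :: "nat \<Rightarrow> ('b \<Rightarrow> complex) \<Rightarrow> complex"
  assumes "\<And>i. i \<le> s \<Longrightarrow> irreducible_closedin (subtopology zariski Y) (Z i)"
    and "\<And>i. i < s \<Longrightarrow> Z i \<subseteq> Z (Suc i)" "\<And>i. q i \<in> poly_funs"
    and "\<And>i z. i < s \<Longrightarrow> z \<in> Z i \<Longrightarrow> q i z = 0" "\<And>i. i < s \<Longrightarrow> \<exists>z\<in>Z (Suc i). q i z \<noteq> 0"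
    and "P \<in> poly_funs" "\<And>y y'. (\<And>i. i < s \<Longrightarrow> y i = y' i) \<Longrightarrow> P y = P y'"
    and "\<And>x. x \<in> Z s \<Longrightarrow> P (\<lambda>i. q i x) = 0"
  shows "P y = 0"
  using assms
proof (induction s arbitrary: P y)
  case 0
  have "Z 0 \<noteq> {}" using "0.prems"(1)[of 0] unfolding irreducible_closedin_def by blast
  then obtain x where "x \<in> Z 0" by blast
  then have "P (\<lambda>i. q i x) = 0" by (rule "0.prems"(8))
  moreover have "P (\<lambda>i. q i x) = P y" by (rule "0.prems"(7)) simp
  ultimately show ?case by simp
next
  case (Suc s)
  from poly_funs_expand[OF Suc.prems(6), of s] obtain n c where
    c: "\<forall>j. c j \<in> poly_funs" "\<forall>j x t. c j (x(s := t)) = c j x" "\<forall>j>n. c j = (\<lambda>_. 0)"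
       "\<forall>x. P x = (\<Sum>j\<le>n. c j x * x s ^ j)" by (elim exE conjE)
  note c = c[rule_format]
  have dep: "c j y = c j y'" if "j \<le> n" and eq: "\<And>i. i < s \<Longrightarrow> y i = y' i" for j y y'
  proof -
    have P: "P (y(s := t)) = (\<Sum>j\<le>n. c j y * t ^ j)" for y t
      unfolding c(4) c(2) by simp
    have "(\<Sum>j\<le>n. c j y * t ^ j) = (\<Sum>j\<le>n. c j y' * t ^ j)" for t
      unfolding P[symmetric] by (rule Suc.prems(7)) (use eq in \<open>auto simp: less_Suc_eq\<close>)
    then show ?thesis using polyfun_eq_coeffs[of "\<lambda>j. c j y" n "\<lambda>j. c j y'"] that(1) by blast
  qed
  show ?case
  proof (rule ccontr)
    assume "P y \<noteq> 0"
    then have "(\<Sum>j\<le>n. c j y * y s ^ j) \<noteq> 0" by (simp only: c(4) not_False_eq_True)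
    moreover have "(\<Sum>j\<le>n. c j y * y s ^ j) = 0" if "\<forall>j\<le>n. c j y * y s ^ j = 0"
      using that by (intro sum.neutral) simp
    ultimately obtain j where "j \<le> n" "c j y * y s ^ j \<noteq> 0" by blast
    then have "j \<le> n \<and> c j y \<noteq> 0" by auto
    then have ex: "\<exists>j. j \<le> n \<and> (\<exists>y. c j y \<noteq> 0)" by blast
    define j0 where "j0 = (LEAST j. j \<le> n \<and> (\<exists>y. c j y \<noteq> 0))"
    have j0: "j0 \<le> n" "\<exists>y. c j0 y \<noteq> 0" using LeastI_ex[OF ex] by (auto simp: j0_def)
    have below: "c j y = 0" if "j < j0" for j y
    proof (rule ccontr)
      assume "c j y \<noteq> 0"
      then have "j0 \<le> j" unfolding j0_def using that j0(1) by (intro Least_le) auto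
      then show False using that by simp
    qed
    define H where "H x = (\<Sum>j=j0..n. c j (\<lambda>i. q i x) * q s x ^ (j - j0))" for x
    have "(\<lambda>x. c j (\<lambda>i. q i x)) \<in> poly_funs" for j by (rule poly_funs_compose[OF c(1) Suc.prems(3)])
    then have Hp: "H \<in> poly_funs" unfolding H_def
      by (intro poly_funs_sum poly_funs.mult poly_funs_power Suc.prems(3))
    have PH: "P (\<lambda>i. q i x) = q s x ^ j0 * H x" for x
    proof -
      have "P (\<lambda>i. q i x) = (\<Sum>j=j0..n. c j (\<lambda>i. q i x) * q s x ^ j)"
        unfolding c(4) by (rule sum.mono_neutral_right) (auto simp: below)
      also have "\<dots> = q s x ^ j0 * H x" unfolding H_def sum_distrib_left
        by (intro sum.cong refl) (simp add: mult.left_commute flip: power_add)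
      finally show ?thesis .
    qed
    have "(\<forall>x\<in>Z (Suc s). q s x ^ j0 = 0) \<or> (\<forall>x\<in>Z (Suc s). H x = 0)"
      using Suc.prems(8)
      by (intro irreducible_closedin_mult[OF Suc.prems(1)] poly_funs_power Suc.prems(3) Hp)
        (simp_all flip: PH)
    moreover obtain z where "z \<in> Z (Suc s)" "q s z \<noteq> 0" using Suc.prems(5)[of s] by blast
    ultimately have H0: "\<forall>x\<in>Z (Suc s). H x = 0" by auto
    have "c j0 y = 0" for y
    proof (rule Suc.IH[of "c j0"])
      show "c j0 (\<lambda>i. q i x) = 0" if x: "x \<in> Z s" for x
      proof -
        have "H x = c j0 (\<lambda>i. q i x) + (\<Sum>j\<in>{j0<..n}. c j (\<lambda>i. q i x) * q s x ^ (j - j0))"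
          unfolding H_def using j0(1) by (subst sum.head) auto
        also have "(\<Sum>j\<in>{j0<..n}. c j (\<lambda>i. q i x) * q s x ^ (j - j0)) = 0"
          using Suc.prems(4)[of s x] x by (intro sum.neutral) auto
        finally show ?thesis using H0 Suc.prems(2)[of s] x by auto
      qed
      show "c j0 \<in> poly_funs" by (rule c(1))
      show "c j0 y = c j0 y'" if "\<And>i. i < s \<Longrightarrow> y i = y' i" for y y'
        using dep[OF j0(1)] that by blast
      show "irreducible_closedin (subtopology zariski Y) (Z i)" if "i \<le> s" for i
        by (rule Suc.prems(1)) (use that in simp)
      show "Z i \<subseteq> Z (Suc i)" if "i < s" for i by (rule Suc.prems(2)) (use that in simp)
      show "q i z = 0" if "i < s" "z \<in> Z i" for i z using Suc.prems(4)[of i z] that by simp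
      show "\<exists>z\<in>Z (Suc i). q i z \<noteq> 0" if "i < s" for i by (rule Suc.prems(5)) (use that in simp)
      show "q i \<in> poly_funs" for i by (rule Suc.prems(3))
    qed
    then show False using j0 by blast
  qed
qed

text \<open>Between consecutive members choose a function that vanishes on the smaller but not on
  the larger set. More than \<open>card S\<close> of them, pulled back to the parameter space,
  satisfy a relation, whereas functions chosen along a chain are independent.\<close>

lemma chain_length_le:
  fixes f :: "'b \<Rightarrow> ('i \<Rightarrow> complex) \<Rightarrow> complex"
  assumes f: "\<And>b. f b \<in> poly_funs" and "finite S"
    and Y: "Y = zariski closure_of ((\<lambda>x b. f b x) ` {x. \<forall>i. i \<notin> S \<longrightarrow> x i = p i})"
    and Z: "\<forall>i\<le>k. irreducible_closedin (subtopology zariski Y) (Z i)" "\<forall>i<k. Z i \<subset> Z (Suc i)"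
  shows "k \<le> card S"
proof (rule ccontr)
  assume "\<not> k \<le> card S"
  have "\<exists>q. q \<in> poly_funs \<and> (\<forall>z\<in>Z i. q z = 0) \<and> (\<exists>z\<in>Z (Suc i). q z \<noteq> 0)" if i: "i < k" for i
  proof -
    obtain z where z: "z \<in> Z (Suc i)" "z \<notin> Z i" using Z(2) i by blast
    have "irreducible_closedin (subtopology zariski Y) (Z j)" if "j \<le> k" for j using Z(1) that by blast
    then have "closedin (subtopology zariski Y) (Z i)" "closedin (subtopology zariski Y) (Z (Suc i))"
      using i by (simp_all add: irreducible_closedin_def)
    then have zY: "z \<in> Y" using z(1) closedin_subset[of "subtopology zariski Y" "Z (Suc i)"] by auto
    show ?thesis
    proof (rule closedin_zariski_separate[OF \<open>closedin (subtopology zariski Y) (Z i)\<close> zY z(2)])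
      fix q :: "('b \<Rightarrow> complex) \<Rightarrow> complex"
      assume "q \<in> poly_funs" "q z \<noteq> 0" "\<And>z. z \<in> Z i \<Longrightarrow> q z = 0"
      then show ?thesis using z(1) by (intro exI[of _ q]) blast
    qed
  qed
  then have "\<forall>i. \<exists>q. i < k \<longrightarrow> q \<in> poly_funs \<and> (\<forall>z\<in>Z i. q z = 0) \<and> (\<exists>z\<in>Z (Suc i). q z \<noteq> 0)"
    by blast
  from choice[OF this] obtain q0 where
    q0: "\<forall>i<k. q0 i \<in> poly_funs \<and> (\<forall>z\<in>Z i. q0 i z = 0) \<and> (\<exists>z\<in>Z (Suc i). q0 i z \<noteq> 0)" by blast
  note q0 = q0[rule_format]
  define q where "q i = (if i < k then q0 i else (\<lambda>_. 0))" for i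
  have qp: "q i \<in> poly_funs" for i using q0 poly_funs.const by (auto simp: q_def)
  have qf: "(\<lambda>x. q u (\<lambda>b. f b x)) \<in> poly_funs" for u by (rule poly_funs_compose[OF qp f])
  have "card S < card {..<k}" using \<open>\<not> k \<le> card S\<close> by simp
  note AD = algebraically_dependent[OF \<open>finite S\<close> finite_lessThan this, of "\<lambda>u x. q u (\<lambda>b. f b x)" p, OF qf]
  from AD obtain P y0 where P: "P \<in> poly_funs" "P y0 \<noteq> 0"
    "\<forall>y y'. (\<forall>u\<in>{..<k}. y u = y' u) \<longrightarrow> P y = P y'"
    "\<forall>x. (\<forall>i. i \<notin> S \<longrightarrow> x i = p i) \<longrightarrow> P (\<lambda>u. q u (\<lambda>b. f b x)) = 0" by (elim exE conjE)
  have PY: "P (\<lambda>u. q u y) = 0" if "y \<in> Y" for y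
  proof -
    have Pq: "(\<lambda>y. P (\<lambda>u. q u y)) \<in> poly_funs" by (rule poly_funs_compose[OF P(1) qp])
    show ?thesis
      by (rule closure_of_zariskiD[OF that[unfolded Y] Pq]) (use P(4) in auto)
  qed
  have "P y = 0" for y
  proof (rule chain_algebraically_independent[where P = P and s = k and Z = Z and Y = Y and q = q])
    show "P (\<lambda>i. q i x) = 0" if "x \<in> Z k" for x
    proof (rule PY)
      have "closedin (subtopology zariski Y) (Z k)" using Z(1) by (simp add: irreducible_closedin_def)
      then show "x \<in> Y" using that closedin_subset[of "subtopology zariski Y" "Z k"] by auto
    qed
    show "P y = P y'" if "\<And>i. i < k \<Longrightarrow> y i = y' i" for y y' using P(3) that by auto
    show "q i z = 0" if "i < k" "z \<in> Z i" for i z using that q0[of i] by (auto simp: q_def)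
    show "\<exists>z\<in>Z (Suc i). q i z \<noteq> 0" if "i < k" for i using that q0[of i] by (auto simp: q_def)
    show "irreducible_closedin (subtopology zariski Y) (Z i)" if "i \<le> k" for i using Z(1) that by blast
    show "Z i \<subseteq> Z (Suc i)" if "i < k" for i using Z(2) that by blast
  qed (rule qp P(1))+
  then show False using P(2) by blast
qed

text \<open>Division by s^r leaves the coefficient of order r and terms that tend to 0. The
  coefficients may themselves depend on s, as happens when a polynomial identity is followed along a
  curve.\<close>

lemma lowest_coefficient_tendsto:
  fixes C :: "nat \<Rightarrow> complex \<Rightarrow> complex"
  assumes "\<And>s. s \<noteq> 0 \<Longrightarrow> (\<Sum>k\<le>n. C k s * s ^ k) = 0"
    and "\<And>k s. k < r \<Longrightarrow> C k s = 0" and "r \<le> n"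
    and "\<And>k. (C k \<longlongrightarrow> l k) (at 0)"
  shows "l r = 0"
proof -
  let ?D = "\<lambda>s. \<Sum>k\<in>{r..n}. C k s * s ^ (k - r)"
  have "?D s = 0" if "s \<noteq> 0" for s
  proof -
    have "(\<Sum>k\<le>n. C k s * s ^ k) = (\<Sum>k\<in>{r..n}. C k s * s ^ k)"
      by (rule sum.mono_neutral_right) (auto simp: assms(2))
    also have "\<dots> = s ^ r * ?D s"
      unfolding sum_distrib_left by (intro sum.cong refl) (simp add: mult.left_commute flip: power_add)
    finally show ?thesis using assms(1)[OF that] that by simp
  qed
  then have "(?D \<longlongrightarrow> 0) (at 0)"
    by (intro tendsto_eventually) (auto simp: eventually_at intro!: exI[of _ 1])
  moreover have "(?D \<longlongrightarrow> (\<Sum>k\<in>{r..n}. l k * 0 ^ (k - r))) (at 0)"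
    by (intro tendsto_intros assms(4))
  ultimately have "(\<Sum>k\<in>{r..n}. l k * 0 ^ (k - r)) = 0"
    by (intro tendsto_unique[OF at_neq_bot])
  moreover have "(\<Sum>k\<in>{r..n}. l k * 0 ^ (k - r)) = l r + (\<Sum>k\<in>{r<..n}. l k * 0 ^ (k - r))"
    using assms(3) by (subst sum.head) auto
  moreover have "(\<Sum>k\<in>{r<..n}. l k * 0 ^ (k - r)) = 0"
    by (rule sum.neutral) auto
  ultimately show ?thesis by simp
qed

text \<open>Membership in \<open>poly_funs\<close> restricts to functionals of finitely many
  coordinates. These respect coordinatewise limits and may be substituted into polynomials, also
  when the index type is infinite.\<close>

definition linear_functional :: "(('b \<Rightarrow> complex) \<Rightarrow> complex) \<Rightarrow> bool" where
  "linear_functional \<Lambda> \<longleftrightarrow> \<Lambda> \<in> poly_funs \<and> (\<forall>x y c. \<Lambda> (\<lambda>b. x b + c * y b) = \<Lambda> x + c * \<Lambda> y)"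

lemma linear_functional_poly: "linear_functional \<Lambda> \<Longrightarrow> \<Lambda> \<in> poly_funs"
  by (simp add: linear_functional_def)

lemma linear_functional_add_scaled: "linear_functional \<Lambda> \<Longrightarrow> \<Lambda> (\<lambda>b. x b + c * y b) = \<Lambda> x + c * \<Lambda> y"
  by (simp add: linear_functional_def)

lemma linear_functional_zero: "linear_functional \<Lambda> \<Longrightarrow> \<Lambda> (\<lambda>_. 0) = 0"
  using linear_functional_add_scaled[of \<Lambda> "\<lambda>_. 0" "-1" "\<lambda>_. 0"] by simp

lemma linear_functional_sum:
  assumes "linear_functional \<Lambda>"
  shows "\<Lambda> (\<lambda>b. \<Sum>a\<in>A. c a * y a b) = (\<Sum>a\<in>A. c a * \<Lambda> (y a))"
proof (induction A rule: infinite_finite_induct)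
  case (insert a A)
  then show ?case
    using linear_functional_add_scaled[OF assms, of "\<lambda>b. \<Sum>a\<in>A. c a * y a b" "c a" "y a"]
    by (simp add: add.commute)
qed (simp_all add: linear_functional_zero[OF assms])

lemma linear_functional_coord: "linear_functional (\<lambda>x. x b)"
  by (simp add: linear_functional_def poly_funs.coord)

lemma linear_functional_combine:
  assumes "linear_functional \<Lambda>" "linear_functional \<Gamma>"
  shows "linear_functional (\<lambda>x. \<Lambda> x + c * \<Gamma> x)"
  using assms unfolding linear_functional_def
  by (auto intro!: poly_funs_intros simp: algebra_simps)

lemma linear_functional_scale: "linear_functional \<Lambda> \<Longrightarrow> linear_functional (\<lambda>x. c * \<Lambda> x)"
  unfolding linear_functional_def by (auto intro!: poly_funs_intros simp: algebra_simps)

text \<open>The new vector \<open>w a\<close> minus its projection to the old ones is nonzero in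
  some coordinate \<open>b\<close> by independence. This coordinate, corrected to kill the old
  vectors and normalized, is dual to \<open>w a\<close>; subtracting multiples of it repairs the old
  functionals.\<close>

lemma dual_family:
  fixes w :: "'s \<Rightarrow> 'b \<Rightarrow> complex"
  assumes "finite S" "\<And>c. (\<And>b. (\<Sum>\<rho>\<in>S. c \<rho> * w \<rho> b) = 0) \<Longrightarrow> \<forall>\<rho>\<in>S. c \<rho> = 0"
  shows "\<exists>\<Lambda>. \<forall>\<rho>\<in>S. linear_functional (\<Lambda> \<rho>) \<and> (\<forall>\<sigma>\<in>S. \<Lambda> \<rho> (w \<sigma>) = of_bool (\<rho> = \<sigma>))"
  using assms
proof (induction S rule: finite_induct)
  case (insert a S)
  have "\<forall>\<rho>\<in>S. c \<rho> = 0" if "\<And>b. (\<Sum>\<rho>\<in>S. c \<rho> * w \<rho> b) = 0" for c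
  proof -
    have "(\<Sum>\<rho>\<in>S. (c(a := 0)) \<rho> * w \<rho> b) = (\<Sum>\<rho>\<in>S. c \<rho> * w \<rho> b)" for b
      using insert.hyps by (intro sum.cong) auto
    then have "\<forall>\<rho>\<in>insert a S. (c(a := 0)) \<rho> = 0"
      using insert.hyps that by (intro insert.prems) simp
    then show ?thesis using insert.hyps by (metis fun_upd_other insertCI)
  qed
  from insert.IH[OF this] obtain \<Lambda> where
    \<Lambda>: "\<And>\<rho>. \<rho> \<in> S \<Longrightarrow> linear_functional (\<Lambda> \<rho>)" "\<And>\<rho> \<sigma>. \<rho> \<in> S \<Longrightarrow> \<sigma> \<in> S \<Longrightarrow> \<Lambda> \<rho> (w \<sigma>) = of_bool (\<rho> = \<sigma>)"
    by blast
  define r where "r b = w a b - (\<Sum>\<rho>\<in>S. \<Lambda> \<rho> (w a) * w \<rho> b)" for b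
  have "\<exists>b. r b \<noteq> 0"
  proof (rule ccontr)
    assume "\<nexists>b. r b \<noteq> 0"
    let ?c = "\<lambda>\<rho>. if \<rho> = a then 1 else - \<Lambda> \<rho> (w a)"
    have "(\<Sum>\<rho>\<in>insert a S. ?c \<rho> * w \<rho> b) = r b" for b
    proof -
      have "(\<Sum>\<rho>\<in>S. ?c \<rho> * w \<rho> b) = - (\<Sum>\<rho>\<in>S. \<Lambda> \<rho> (w a) * w \<rho> b)"
        unfolding sum_negf[symmetric] using insert.hyps by (intro sum.cong) auto
      then show ?thesis using insert.hyps by (simp add: r_def)
    qed
    then have "\<forall>\<rho>\<in>insert a S. ?c \<rho> = 0"
      using \<open>\<nexists>b. r b \<noteq> 0\<close> by (intro insert.prems) simp
    then show False by simp
  qed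
  then obtain b where b: "r b \<noteq> 0" by blast
  define \<Gamma> where "\<Gamma> x = inverse (r b) * (x b + (-1) * (\<Sum>\<rho>\<in>S. w \<rho> b * \<Lambda> \<rho> x))" for x
  have "linear_functional (\<lambda>x. \<Sum>\<rho>\<in>A. w \<rho> b * \<Lambda> \<rho> x)" if "A \<subseteq> S" for A
    using finite_subset[OF that insert.hyps(1)] that
  proof (induction A rule: finite_induct)
    case empty
    then show ?case by (simp add: linear_functional_def poly_funs.const)
  next
    case (insert \<rho> A)
    then have "linear_functional (\<lambda>x. (\<Sum>\<rho>\<in>A. w \<rho> b * \<Lambda> \<rho> x) + w \<rho> b * \<Lambda> \<rho> x)"
      by (intro linear_functional_combine \<Lambda>(1)) auto
    then show ?case using insert.hyps by (simp add: add.commute)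
  qed
  then have \<Gamma>_lin: "linear_functional \<Gamma>" unfolding \<Gamma>_def
    by (intro linear_functional_scale linear_functional_combine linear_functional_coord) simp
  have \<Gamma>_S: "\<Gamma> (w \<sigma>) = 0" if "\<sigma> \<in> S" for \<sigma>
  proof -
    have "(\<Sum>\<rho>\<in>S. w \<rho> b * \<Lambda> \<rho> (w \<sigma>)) = (\<Sum>\<rho>\<in>S. if \<rho> = \<sigma> then w \<sigma> b else 0)"
      using that by (intro sum.cong) (auto simp: \<Lambda>(2))
    then show ?thesis using that insert.hyps by (simp add: \<Gamma>_def)
  qed
  have \<Gamma>_a: "\<Gamma> (w a) = 1" using b by (simp add: \<Gamma>_def r_def mult.commute)
  let ?L = "\<lambda>\<rho>. if \<rho> = a then \<Gamma> else (\<lambda>x. \<Lambda> \<rho> x + (- \<Lambda> \<rho> (w a)) * \<Gamma> x)"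
  have "linear_functional (?L \<rho>) \<and> (\<forall>\<sigma>\<in>insert a S. ?L \<rho> (w \<sigma>) = of_bool (\<rho> = \<sigma>))"
    if "\<rho> \<in> insert a S" for \<rho>
  proof (cases "\<rho> = a")
    case True
    then show ?thesis using \<Gamma>_lin \<Gamma>_S \<Gamma>_a insert.hyps by auto
  next
    case False
    then have "\<rho> \<in> S" using that by simp
    have "linear_functional (\<lambda>x. \<Lambda> \<rho> x + (- \<Lambda> \<rho> (w a)) * \<Gamma> x)"
      by (rule linear_functional_combine[OF \<Lambda>(1)[OF \<open>\<rho> \<in> S\<close>] \<Gamma>_lin])
    then show ?thesis using False \<open>\<rho> \<in> S\<close> \<Gamma>_S \<Gamma>_a \<Lambda>(2)[OF \<open>\<rho> \<in> S\<close>] by simp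
  qed
  then show ?case by (intro exI[of _ ?L]) blast
qed simp

lemma affine_irreducible:
  fixes f :: "'b \<Rightarrow> ('i \<Rightarrow> complex) \<Rightarrow> complex"
  assumes f: "\<And>b. f b \<in> poly_funs"
    and "zariski closure_of ((\<lambda>x b. f b x) ` {x. \<forall>i. i \<notin> S \<longrightarrow> x i = p i}) \<subseteq> Y"
  shows "irreducible_closedin (subtopology zariski Y)
    (zariski closure_of ((\<lambda>x b. f b x) ` {x. \<forall>i. i \<notin> S \<longrightarrow> x i = p i}))"
proof (rule irreducible_closedin_closure[OF _ assms(2)])
  let ?M = "{x. \<forall>i. i \<notin> S \<longrightarrow> x i = p i}"
  have "p \<in> ?M" by simp
  then show "(\<lambda>x b. f b x) ` ?M \<noteq> {}" by blast
  fix P Q :: "('b \<Rightarrow> complex) \<Rightarrow> complex"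
  assume PQ: "P \<in> poly_funs" "Q \<in> poly_funs" "\<And>y. y \<in> (\<lambda>x b. f b x) ` ?M \<Longrightarrow> P y * Q y = 0"
  have "(\<forall>x\<in>?M. P (\<lambda>b. f b x) = 0) \<or> (\<forall>x\<in>?M. Q (\<lambda>b. f b x) = 0)"
  proof (rule poly_funs_no_zero_divisors)
    show "(\<lambda>x. P (\<lambda>b. f b x)) \<in> poly_funs" by (rule poly_funs_compose[OF PQ(1) f])
    show "(\<lambda>x. Q (\<lambda>b. f b x)) \<in> poly_funs" by (rule poly_funs_compose[OF PQ(2) f])
    show "P (\<lambda>b. f b x) * Q (\<lambda>b. f b x) = 0" if "x \<in> ?M" for x
      by (rule PQ(3)) (rule imageI[OF that])
  qed simp
  then show "(\<forall>x\<in>(\<lambda>x b. f b x) ` ?M. P x = 0) \<or> (\<forall>x\<in>(\<lambda>x b. f b x) ` ?M. Q x = 0)" by simp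
qed

text \<open>A relation between the dual functionals of the tangent vectors would, by its lowest order
  part at \<open>p\<close>, be a relation between the coordinates.\<close>

lemma closure_strict_mono:
  fixes f :: "'b \<Rightarrow> ('i \<Rightarrow> complex) \<Rightarrow> complex"
  assumes f: "\<And>b. f b \<in> poly_funs" and S: "finite S" "T \<subseteq> S" "a \<in> S" "a \<notin> T"
    and deriv: "\<And>y b. (\<And>i. i \<notin> S \<Longrightarrow> y i = 0) \<Longrightarrow>
      ((\<lambda>t. f b (\<lambda>i. p i + t * y i)) has_field_derivative (\<Sum>\<rho>\<in>S. y \<rho> * w \<rho> b)) (at 0)"
    and indep: "\<And>c. (\<And>b. (\<Sum>\<rho>\<in>S. c \<rho> * w \<rho> b) = 0) \<Longrightarrow> \<forall>\<rho>\<in>S. c \<rho> = 0"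
  shows "zariski closure_of ((\<lambda>x b. f b x) ` {x. \<forall>i. i \<notin> T \<longrightarrow> x i = p i}) \<subset>
    zariski closure_of ((\<lambda>x b. f b x) ` {x. \<forall>i. i \<notin> insert a T \<longrightarrow> x i = p i})"
proof
  let ?M = "\<lambda>T. {x. \<forall>i. i \<notin> T \<longrightarrow> x i = p i}"
  let ?F = "\<lambda>x b. f b x"
  show "zariski closure_of (?F ` ?M T) \<subseteq> zariski closure_of (?F ` ?M (insert a T))"
    by (intro closure_of_mono image_mono) auto
  show "zariski closure_of (?F ` ?M T) \<noteq> zariski closure_of (?F ` ?M (insert a T))"
  proof
    assume eq: "zariski closure_of (?F ` ?M T) = zariski closure_of (?F ` ?M (insert a T))"
    obtain \<Lambda> where \<Lambda>: "\<And>\<rho>. \<rho> \<in> S \<Longrightarrow> linear_functional (\<Lambda> \<rho>)"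
      "\<And>\<rho> \<sigma>. \<rho> \<in> S \<Longrightarrow> \<sigma> \<in> S \<Longrightarrow> \<Lambda> \<rho> (w \<sigma>) = of_bool (\<rho> = \<sigma>)"
      using dual_family[of S w, OF S(1) indep] by blast
    define U where "U = insert a T"
    have U: "finite U" "U \<subseteq> S" "finite T" using S finite_subset by (auto simp: U_def)
    \<comment> \<open>Dual coordinates of the image, centred at the image of \<open>p\<close>. If
      the closures agreed, a relation holding for the \<open>card T\<close> parameters would hold on
      the larger subspace, where these coordinates are to first order the parameters
      themselves.\<close>
    define g where "g u y = (if u \<in> U then \<Lambda> u y - \<Lambda> u (?F p) else 0)" for u y
    have g_poly: "g u \<in> poly_funs" for u
      using linear_functional_poly[OF \<Lambda>(1)[of u]] U(2) unfolding g_def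
      by (intro poly_funs_if poly_funs_diff poly_funs.const) auto
    have gf: "(\<lambda>x. g u (?F x)) \<in> poly_funs" for u by (rule poly_funs_compose[OF g_poly f])
    have "card T < card U" using U S by (simp add: U_def)
    note AD = algebraically_dependent[OF U(3) U(1) this, of "\<lambda>u x. g u (?F x)" p, OF gf]
    from AD obtain P y0 where P: "P \<in> poly_funs" "P y0 \<noteq> 0"
      "\<forall>y y'. (\<forall>u\<in>U. y u = y' u) \<longrightarrow> P y = P y'"
      "\<forall>x. (\<forall>i. i \<notin> T \<longrightarrow> x i = p i) \<longrightarrow> P (\<lambda>u. g u (?F x)) = 0" by (elim exE conjE)
    note P = P[rule_format]
    have Pg: "(\<lambda>y. P (\<lambda>u. g u y)) \<in> poly_funs" by (rule poly_funs_compose[OF P(1) g_poly])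
    have "P (\<lambda>u. g u y) = 0" if "y \<in> zariski closure_of (?F ` ?M T)" for y
      by (rule closure_of_zariskiD[OF that Pg]) (use P(4) in auto)
    then have "\<forall>y\<in>zariski closure_of (?F ` ?M U). P (\<lambda>u. g u y) = 0"
      by (simp add: eq U_def)
    moreover have "?F ` ?M U \<subseteq> zariski closure_of (?F ` ?M U)" by (simp add: closure_of_subset)
    ultimately have zero: "P (\<lambda>u. g u (?F x)) = 0" if "x \<in> ?M U" for x
      using that by blast
    from poly_funs_scale[OF P(1), of "\<lambda>_. 0"] obtain n c where
      c: "\<forall>k. c k \<in> poly_funs" "\<forall>s y. P (\<lambda>i. 0 + s * y i) = (\<Sum>k\<le>n. c k y * s ^ k)"
      by (elim exE conjE)
    note c = c[rule_format]
    have "c k y = 0" if "k \<le> n" for k y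
      using that
    proof (induction k arbitrary: y rule: less_induct)
      case (less r)
      define y' where "y' i = (if i \<in> U then y i else 0)" for i
      define X where "X s i = p i + s * y' i" for s i
      \<comment> \<open>The rescaled dual coordinates converge to \<open>y\<close> as s tends to 0.
        Outside \<open>U\<close>, where \<open>P\<close> does not look, \<open>Y\<close> is set to
        its limit.\<close>
      define Y where "Y s u = (if u \<in> U then g u (?F (X s)) / s else y u)" for s u
      have lim: "((\<lambda>s. Y s u) \<longlongrightarrow> y u) (at 0)" for u
      proof (cases "u \<in> U")
        case True
        then have lin: "linear_functional (\<Lambda> u)" using \<Lambda> U by blast
        let ?d = "\<lambda>b. \<Sum>\<rho>\<in>S. y' \<rho> * w \<rho> b"
        have "((\<lambda>s. (f b (X s) - f b p) / s) \<longlongrightarrow> ?d b) (at 0)" for b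
        proof -
          have "y' i = 0" if "i \<notin> S" for i using that U(2) by (auto simp: y'_def)
          then have "((\<lambda>t. f b (X t)) has_field_derivative ?d b) (at 0)"
            unfolding X_def by (rule deriv)
          moreover have "X 0 = p" by (simp add: X_def fun_eq_iff)
          ultimately show ?thesis unfolding has_field_derivative_iff by simp
        qed
        then have "((\<lambda>s. \<Lambda> u (\<lambda>b. (f b (X s) - f b p) / s)) \<longlongrightarrow> \<Lambda> u ?d) (at 0)"
          by (intro poly_funs_tendsto[OF linear_functional_poly[OF lin]])
        moreover have "\<Lambda> u (\<lambda>b. (f b (X s) - f b p) / s) = g u (?F (X s)) / s" for s
        proof -
          have "\<Lambda> u (\<lambda>b. (f b (X s) - f b p) / s) = \<Lambda> u (\<lambda>b. 0 + inverse s * (f b (X s) + (- 1) * f b p))"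
            by (rule arg_cong[of _ _ "\<Lambda> u"]) (simp add: fun_eq_iff divide_inverse mult.commute)
          also have "\<dots> = inverse s * \<Lambda> u (\<lambda>b. f b (X s) + (- 1) * f b p)"
            by (subst linear_functional_add_scaled[OF lin]) (simp add: linear_functional_zero[OF lin])
          also have "\<Lambda> u (\<lambda>b. f b (X s) + (- 1) * f b p) = g u (?F (X s))"
            unfolding linear_functional_add_scaled[OF lin] g_def using True by simp
          finally show ?thesis by (simp add: divide_inverse mult.commute)
        qed
        moreover have "\<Lambda> u ?d = y u"
        proof -
          have "\<Lambda> u ?d = (\<Sum>\<rho>\<in>S. y' \<rho> * \<Lambda> u (w \<rho>))" by (rule linear_functional_sum[OF lin])
          also have "\<dots> = (\<Sum>\<rho>\<in>S. if \<rho> = u then y u else 0)"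
            using True U(2) \<Lambda>(2) by (intro sum.cong refl) (auto simp: y'_def subset_iff)
          also have "\<dots> = y u" using True U(2) S(1) by auto
          finally show ?thesis .
        qed
        ultimately show ?thesis using True by (simp add: Y_def)
      qed (simp add: Y_def)
      show ?case
      proof (rule lowest_coefficient_tendsto[where C = "\<lambda>k s. c k (Y s)" and n = n and r = r
            and l = "\<lambda>k. c k y"])
        show "(\<Sum>k\<le>n. c k (Y s) * s ^ k) = 0" if "s \<noteq> 0" for s
        proof -
          have "(\<Sum>k\<le>n. c k (Y s) * s ^ k) = P (\<lambda>i. 0 + s * Y s i)" by (simp only: c(2))
          also have "\<dots> = P (\<lambda>u. g u (?F (X s)))" by (rule P(3)) (use that in \<open>simp add: Y_def\<close>)
          also have "\<dots> = 0" by (rule zero) (simp add: X_def y'_def)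
          finally show ?thesis .
        qed
        show "c k (Y s) = 0" if "k < r" for k s using less.IH[OF that] less.prems that by simp
        show "((\<lambda>s. c k (Y s)) \<longlongrightarrow> c k y) (at 0)" for k
          by (rule poly_funs_tendsto[OF c(1) lim])
      qed (rule less.prems)
    qed
    then have "P y = 0" for y using c(2)[of 1 y] by simp
    then show False using P(2) by blast
  qed
qed

text \<open>\<open>w \<rho>\<close> is the column of the derivative at \<open>p\<close> for the
  coordinate \<open>\<rho>\<close>, and \<open>indep\<close> is injectivity of the derivative along
  the affine subspace. The flag for the lower bound comes from an enumeration of
  \<open>S\<close>.\<close>

theorem variety_dim_parametrized:
  fixes f :: "'b \<Rightarrow> ('i \<Rightarrow> complex) \<Rightarrow> complex"
  assumes f: "\<And>b. f b \<in> poly_funs" and S: "finite S"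
    and deriv: "\<And>y b. (\<And>i. i \<notin> S \<Longrightarrow> y i = 0) \<Longrightarrow>
      ((\<lambda>t. f b (\<lambda>i. p i + t * y i)) has_field_derivative (\<Sum>\<rho>\<in>S. y \<rho> * w \<rho> b)) (at 0)"
    and indep: "\<And>c. (\<And>b. (\<Sum>\<rho>\<in>S. c \<rho> * w \<rho> b) = 0) \<Longrightarrow> \<forall>\<rho>\<in>S. c \<rho> = 0"
  shows "variety_dim (zariski closure_of ((\<lambda>x b. f b x) ` {x. \<forall>i. i \<notin> S \<longrightarrow> x i = p i})) = card S"
proof -
  let ?cl = "\<lambda>T. zariski closure_of ((\<lambda>x b. f b x) ` {x. \<forall>i. i \<notin> T \<longrightarrow> x i = p i})"
  let ?Y = "?cl S"
  let ?K = "{k. \<exists>Z. (\<forall>i\<le>k. irreducible_closedin (subtopology zariski ?Y) (Z i)) \<and> (\<forall>i<k. Z i \<subset> Z (Suc i))}"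
  have up: "k \<le> card S" if "k \<in> ?K" for k
  proof -
    from that obtain Z where Z: "\<forall>i\<le>k. irreducible_closedin (subtopology zariski ?Y) (Z i)"
      "\<forall>i<k. Z i \<subset> Z (Suc i)" by auto
    show ?thesis by (rule chain_length_le[OF f S refl Z])
  qed
  obtain h where h: "bij_betw h {0..<card S} S" using ex_bij_betw_nat_finite[OF S] by blast
  define T where "T j = h ` {0..<j}" for j
  have TS: "T j \<subseteq> S" if "j \<le> card S" for j
  proof -
    have "T j \<subseteq> h ` {0..<card S}" unfolding T_def using that by (intro image_mono) auto
    then show ?thesis using h by (simp add: bij_betw_def)
  qed
  have "irreducible_closedin (subtopology zariski ?Y) (?cl (T i))" if "i \<le> card S" for i
  proof (rule affine_irreducible[OF f])
    show "?cl (T i) \<subseteq> ?Y" using TS[OF that] by (intro closure_of_mono image_mono) auto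
  qed
  moreover have "?cl (T i) \<subset> ?cl (T (Suc i))" if "i < card S" for i
  proof -
    have "h i \<in> S" using h that by (auto simp: bij_betw_def)
    moreover have "h i \<notin> T i"
    proof
      assume "h i \<in> T i"
      then obtain j where j: "j < i" "h j = h i" by (auto simp: T_def)
      have "j = i" by (rule inj_onD[OF bij_betw_imp_inj_on[OF h] j(2)]) (use j that in auto)
      then show False using j by simp
    qed
    moreover have T_Suc: "T (Suc i) = insert (h i) (T i)" by (auto simp: T_def less_Suc_eq)
    moreover have "T i \<subseteq> S" using TS that by simp
    ultimately show ?thesis unfolding T_Suc
      by (intro closure_strict_mono[where f = f and S = S and w = w, OF f S _ _ _ deriv indep])
  qed
  ultimately have "card S \<in> ?K"
    by (intro CollectI exI[of _ "\<lambda>i. ?cl (T i)"] conjI allI impI)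
  then show ?thesis unfolding variety_dim_def krull_dim_def
    by (intro cSup_eq_maximum) (use up in auto)
qed

section \<open>Polynomials annihilated by vector fields\<close>

text \<open>The lowest order part of \<open>q\<close> at \<open>p\<close> is annihilated by the constant vector fields \<open>v p\<close>.\<close>

lemma annihilated_by_vector_fields_zero:
  fixes q :: "('i \<Rightarrow> complex) \<Rightarrow> complex"
  assumes q: "q \<in> poly_funs" and zero: "\<And>x. (\<And>i. i \<in> R \<Longrightarrow> x i = p i) \<Longrightarrow> q x = 0"
    and fields: "\<And>y. \<exists>v. (\<forall>i\<in>R. v p i = y i) \<and> (\<forall>i. (\<lambda>x. v x i) \<in> poly_funs) \<and>
      (\<forall>x. ((\<lambda>t. q (\<lambda>i. x i + t * v x i)) has_field_derivative 0) (at 0))"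
  shows "q x = 0"
proof -
  from poly_funs_scale[OF q, of p] obtain n c where
    c: "\<forall>k. c k \<in> poly_funs" "\<forall>s y. q (\<lambda>i. p i + s * y i) = (\<Sum>k\<le>n. c k y * s ^ k)"
    by (elim exE conjE)
  note c = c[rule_format]
  from poly_funs_deriv[OF q] obtain J q' where q': "finite J" "\<forall>i. q' i \<in> poly_funs"
    "\<forall>\<gamma> \<gamma>' t. (\<forall>i. ((\<lambda>s. \<gamma> s i) has_field_derivative \<gamma>' i) (at t)) \<longrightarrow>
    ((\<lambda>s. q (\<gamma> s)) has_field_derivative (\<Sum>i\<in>J. \<gamma>' i * q' i (\<gamma> t))) (at t)" by (elim exE conjE)
  have dq: "((\<lambda>t. q (\<lambda>i. x i + t * v i)) has_field_derivative (\<Sum>i\<in>J. v i * q' i x)) (at 0)" for x v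
    proof -
    have "((\<lambda>t. x i + t * v i) has_field_derivative v i) (at 0)" for i
      by (auto intro!: derivative_eq_intros)
    then show ?thesis using q'(3)[rule_format, of "\<lambda>t i. x i + t * v i" v 0] by simp
  qed
  have "\<forall>k. \<exists>dk. (\<forall>y v. ((\<lambda>t. c k (\<lambda>i. y i + t * v i)) has_field_derivative dk y v) (at 0)) \<and>
    (\<forall>y (v :: complex \<Rightarrow> 'i \<Rightarrow> complex) v0. (\<forall>i. ((\<lambda>s. v s i) \<longlongrightarrow> v0 i) (at 0)) \<longrightarrow> ((\<lambda>s. dk y (v s)) \<longlongrightarrow> dk y v0) (at 0))"
  proof
    fix k
    from poly_funs_deriv[OF c(1)[of k]] obtain J c' where c': "finite J" "\<forall>i. c' i \<in> poly_funs"
      "\<forall>\<gamma> \<gamma>' t. (\<forall>i. ((\<lambda>s. \<gamma> s i) has_field_derivative \<gamma>' i) (at t)) \<longrightarrow>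
      ((\<lambda>s. c k (\<gamma> s)) has_field_derivative (\<Sum>i\<in>J. \<gamma>' i * c' i (\<gamma> t))) (at t)" by (elim exE conjE)
    show "\<exists>dk. (\<forall>y v. ((\<lambda>t. c k (\<lambda>i. y i + t * v i)) has_field_derivative dk y v) (at 0)) \<and>
      (\<forall>y (v :: complex \<Rightarrow> 'i \<Rightarrow> complex) v0. (\<forall>i. ((\<lambda>s. v s i) \<longlongrightarrow> v0 i) (at 0)) \<longrightarrow> ((\<lambda>s. dk y (v s)) \<longlongrightarrow> dk y v0) (at 0))"
    proof (intro exI[of _ "\<lambda>y v. \<Sum>i\<in>J. v i * c' i y"] conjI allI impI)
      show "((\<lambda>t. c k (\<lambda>i. y i + t * v i)) has_field_derivative (\<Sum>i\<in>J. v i * c' i y)) (at 0)" for y v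
        proof -
        have "((\<lambda>t. y i + t * v i) has_field_derivative v i) (at 0)" for i
          by (auto intro!: derivative_eq_intros)
        then show ?thesis using c'(3)[rule_format, of "\<lambda>t i. y i + t * v i" v 0] by simp
      qed
      show "((\<lambda>s. \<Sum>i\<in>J. v s i * c' i y) \<longlongrightarrow> (\<Sum>i\<in>J. v0 i * c' i y)) (at 0)"
        if "\<forall>i. ((\<lambda>s. v s i) \<longlongrightarrow> v0 i) (at 0)" for y v0 and v :: "complex \<Rightarrow> 'i \<Rightarrow> complex"
        using that by (intro tendsto_intros) auto
    qed
  qed
  from choice[OF this] obtain dc where
    dc: "\<forall>k y v. ((\<lambda>t. c k (\<lambda>i. y i + t * v i)) has_field_derivative dc k y v) (at 0)"
    and dc_lim: "\<forall>k y (v :: complex \<Rightarrow> 'i \<Rightarrow> complex) v0. (\<forall>i. ((\<lambda>s. v s i) \<longlongrightarrow> v0 i) (at 0)) \<longrightarrow>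
      ((\<lambda>s. dc k y (v s)) \<longlongrightarrow> dc k y v0) (at 0)" by blast
  note dc = dc[rule_format] and dc_lim = dc_lim[rule_format]
  have "c k y = 0" if "k \<le> n" for k y
    using that
  proof (induction k arbitrary: y rule: less_induct)
    case (less r)
    obtain v where v: "\<And>i. i \<in> R \<Longrightarrow> v p i = y i" "\<And>i. (\<lambda>x. v x i) \<in> poly_funs"
      "\<And>x. ((\<lambda>t. q (\<lambda>i. x i + t * v x i)) has_field_derivative 0) (at 0)" using fields[of y] by blast
    \<comment> \<open>The field at the moving point p + s y' tends to \<open>v p\<close>.
      Coefficients below order r vanish by induction, so in the lowest order only the constant field
      \<open>v p\<close> acts, and it acts on \<open>c r\<close>.\<close>
    have dcr: "dc r y' (v p) = 0" for y'
    proof (rule lowest_coefficient_tendsto[where C = "\<lambda>k s. dc k y' (v (\<lambda>i. p i + s * y' i))"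
          and n = n and r = r and l = "\<lambda>k. dc k y' (v p)"])
      show "(\<Sum>k\<le>n. dc k y' (v (\<lambda>i. p i + s * y' i)) * s ^ k) = 0" if "s \<noteq> 0" for s
      proof -
        let ?x = "\<lambda>i. p i + s * y' i"
        let ?w = "v ?x"
        have "((\<lambda>t. \<Sum>k\<le>n. c k (\<lambda>i. y' i + t * ?w i) * s ^ k) has_field_derivative
          (\<Sum>k\<le>n. dc k y' ?w * s ^ k)) (at 0)"
          by (intro DERIV_sum DERIV_cmult_right dc)
        moreover have "(\<Sum>k\<le>n. c k (\<lambda>i. y' i + t * ?w i) * s ^ k) = q (\<lambda>i. ?x i + t * (s * ?w i))" for t
          unfolding c(2)[symmetric] by (rule arg_cong[of _ _ q]) (simp add: fun_eq_iff algebra_simps)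
        ultimately have "((\<lambda>t. q (\<lambda>i. ?x i + t * (s * ?w i))) has_field_derivative
          (\<Sum>k\<le>n. dc k y' ?w * s ^ k)) (at 0)" by simp
        then have "(\<Sum>k\<le>n. dc k y' ?w * s ^ k) = (\<Sum>i\<in>J. s * ?w i * q' i ?x)"
          using dq[of ?x "\<lambda>i. s * ?w i"] by (rule DERIV_unique)
        also have "\<dots> = s * (\<Sum>i\<in>J. ?w i * q' i ?x)" by (simp add: sum_distrib_left mult.assoc)
        also have "(\<Sum>i\<in>J. ?w i * q' i ?x) = 0" using dq[of ?x ?w] v(3)[of ?x] by (rule DERIV_unique)
        finally show ?thesis by simp
      qed
      show "dc k y' (v (\<lambda>i. p i + s * y' i)) = 0" if "k < r" for k s
      proof -
        have "c k = (\<lambda>_. 0)" using less.IH[OF that] less.prems that by (simp add: fun_eq_iff)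
        then have "((\<lambda>_. 0) has_field_derivative dc k y' (v (\<lambda>i. p i + s * y' i))) (at (0::complex))"
          using dc[of k y' "v (\<lambda>i. p i + s * y' i)"] by simp
        then show ?thesis using DERIV_const DERIV_unique by blast
      qed
      show "((\<lambda>s. dc k y' (v (\<lambda>i. p i + s * y' i))) \<longlongrightarrow> dc k y' (v p)) (at 0)" for k
      proof (rule dc_lim)
        show "((\<lambda>s. v (\<lambda>i. p i + s * y' i) i) \<longlongrightarrow> v p i) (at 0)" for i
          by (rule poly_funs_tendsto[OF v(2)]) (auto intro!: tendsto_eq_intros)
      qed
    qed (rule less.prems)
    \<comment> \<open>\<open>c r\<close> is constant along lines in direction \<open>v p\<close>.
      Going from \<open>y\<close> by minus \<open>v p\<close> ends at a vector that is 0 on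
      \<open>R\<close>; this is a direction inside the slice, where \<open>q\<close> vanishes to all
      orders.\<close>
    obtain \<pi> where \<pi>: "\<And>t. c r (\<lambda>i. y i + t * v p i) = poly \<pi> t"
      using poly_funs_line[OF c(1)[of r], of y "v p"] by blast
    have "poly (pderiv \<pi>) t = 0" for t
    proof -
      have "((\<lambda>s. c r (\<lambda>i. (y i + t * v p i) + s * v p i)) has_field_derivative 0) (at 0)"
        using dc[of r "\<lambda>i. y i + t * v p i" "v p"] by (simp only: dcr)
      moreover have "c r (\<lambda>i. (y i + t * v p i) + s * v p i) = poly \<pi> (s + t)" for s
        unfolding \<pi>[symmetric] by (simp add: algebra_simps)
      ultimately have "((\<lambda>s. poly \<pi> (s + t)) has_field_derivative 0) (at 0)" by simp
      then have "(poly \<pi> has_field_derivative 0) (at (0 + t))" by (simp only: DERIV_shift)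
      then have "(poly \<pi> has_field_derivative 0) (at t)" by simp
      then show ?thesis using poly_DERIV DERIV_unique by blast
    qed
    then have "pderiv \<pi> = 0" using poly_all_0_iff_0 by blast
    then have "degree \<pi> = 0" by (simp add: pderiv_eq_0_iff)
    then have "poly \<pi> 0 = poly \<pi> (-1)" by (metis degree_eq_zeroE poly_0 mult_zero_right poly_pCons)
    then have "c r y = c r (\<lambda>i. y i + (-1) * v p i)" by (simp flip: \<pi>)
    also have "\<dots> = 0"
    proof -
      let ?y = "\<lambda>i. y i + (-1) * v p i"
      have "(\<Sum>k\<le>n. c k ?y * s ^ k) = 0" for s
        unfolding c(2)[symmetric] by (rule zero) (simp add: v(1))
      then show ?thesis using polyfun_eq_0[of "\<lambda>k. c k ?y" n] less.prems by blast
    qed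
    finally show ?case .
  qed
  then have "q (\<lambda>i. p i + 1 * (x i - p i)) = 0" unfolding c(2) by simp
  then show ?thesis by simp
qed

text \<open>The fields are tangent to the fibres of \<open>f\<close>, and their values at
  \<open>p\<close> realize any prescribed coordinates in \<open>R\<close>. A polynomial vanishing on
  the image of the slice, pulled back along \<open>f\<close>, is annihilated by them.\<close>

lemma closure_of_image_slice:
  fixes f :: "'b \<Rightarrow> ('i \<Rightarrow> complex) \<Rightarrow> complex"
  assumes f: "\<And>b. f b \<in> poly_funs"
    and fields: "\<And>y. \<exists>v. (\<forall>i\<in>R. v p i = y i) \<and> (\<forall>i. (\<lambda>x. v x i) \<in> poly_funs) \<and>
      (\<forall>x b. ((\<lambda>t. f b (\<lambda>i. x i + t * v x i)) has_field_derivative 0) (at 0))"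
  shows "zariski closure_of ((\<lambda>x b. f b x) ` {x. \<forall>i\<in>R. x i = p i}) = zariski closure_of (range (\<lambda>x b. f b x))"
proof (rule closure_of_image_eqI)
  fix q :: "('b \<Rightarrow> complex) \<Rightarrow> complex" and x :: "'i \<Rightarrow> complex"
  assume q: "q \<in> poly_funs" "\<And>x. x \<in> {x. \<forall>i\<in>R. x i = p i} \<Longrightarrow> q (\<lambda>b. f b x) = 0"
  show "q (\<lambda>b. f b x) = 0"
  proof (rule annihilated_by_vector_fields_zero[where q = "\<lambda>x. q (\<lambda>b. f b x)" and R = R and p = p])
    show "(\<lambda>x. q (\<lambda>b. f b x)) \<in> poly_funs" by (rule poly_funs_compose[OF q(1) f])
    show "q (\<lambda>b. f b x) = 0" if "\<And>i. i \<in> R \<Longrightarrow> x i = p i" for x using q(2) that by blast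
    fix y
    obtain v where v: "\<And>i. i \<in> R \<Longrightarrow> v p i = y i" "\<And>i. (\<lambda>x. v x i) \<in> poly_funs"
      "\<And>x b. ((\<lambda>t. f b (\<lambda>i. x i + t * v x i)) has_field_derivative 0) (at 0)" using fields[of y] by blast
    from poly_funs_deriv[OF q(1)] obtain J q' where q': "finite J" "\<forall>i. q' i \<in> poly_funs"
      "\<forall>\<gamma> \<gamma>' t. (\<forall>i. ((\<lambda>s. \<gamma> s i) has_field_derivative \<gamma>' i) (at t)) \<longrightarrow>
      ((\<lambda>s. q (\<gamma> s)) has_field_derivative (\<Sum>i\<in>J. \<gamma>' i * q' i (\<gamma> t))) (at t)" by (elim exE conjE)
    have "((\<lambda>t. q (\<lambda>b. f b (\<lambda>i. x i + t * v x i))) has_field_derivative 0) (at 0)" for x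
      using q'(3)[rule_format, of "\<lambda>t b. f b (\<lambda>i. x i + t * v x i)" "\<lambda>_. 0" 0] v(3) by simp
    then show "\<exists>v. (\<forall>i\<in>R. v p i = y i) \<and> (\<forall>i. (\<lambda>x. v x i) \<in> poly_funs) \<and>
      (\<forall>x. ((\<lambda>t. q (\<lambda>b. f b (\<lambda>i. x i + t * v x i))) has_field_derivative 0) (at 0))"
      using v by (intro exI[of _ v]) blast
  qed
qed simp

section \<open>Images of polynomial maps contain open sets\<close>

definition indep_funs :: "'i \<Rightarrow> (('i \<Rightarrow> complex) \<Rightarrow> complex) set" where
  "indep_funs i = {q \<in> poly_funs. \<forall>x t. q (x(i := t)) = q x}"

lemma indep_funs_poly: "q \<in> indep_funs i \<Longrightarrow> q \<in> poly_funs"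
  by (simp add: indep_funs_def)

lemma indep_funs_upd: "q \<in> indep_funs i \<Longrightarrow> q (x(i := t)) = q x"
  by (simp add: indep_funs_def)

lemma indep_funs_const: "(\<lambda>_. a) \<in> indep_funs i"
  by (simp add: indep_funs_def poly_funs.const)

lemma indep_funs_diff: "p \<in> indep_funs i \<Longrightarrow> q \<in> indep_funs i \<Longrightarrow> (\<lambda>x. p x - q x) \<in> indep_funs i"
  by (simp add: indep_funs_def poly_funs_diff del: fun_upd_apply)

lemma indep_funs_mult: "p \<in> indep_funs i \<Longrightarrow> q \<in> indep_funs i \<Longrightarrow> (\<lambda>x. p x * q x) \<in> indep_funs i"
  by (simp add: indep_funs_def poly_funs.mult del: fun_upd_apply)

lemma indep_funs_power: "p \<in> indep_funs i \<Longrightarrow> (\<lambda>x. p x ^ n) \<in> indep_funs i"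
  by (simp add: indep_funs_def poly_funs_power del: fun_upd_apply)

text \<open>The bound is strict: \<open>n\<close> counts coefficients, so that length 0 is the zero
  polynomial and a remainder modulo degree m has length m.\<close>

definition poly_in :: "'i \<Rightarrow> (nat \<Rightarrow> ('i \<Rightarrow> complex) \<Rightarrow> complex) \<Rightarrow> nat \<Rightarrow> ('i \<Rightarrow> complex) \<Rightarrow> complex" where
  "poly_in i c n x = (\<Sum>j<n. c j x * x i ^ j)"

lemma poly_in_poly_funs: "(\<And>j. c j \<in> indep_funs i) \<Longrightarrow> poly_in i c n \<in> poly_funs"
  unfolding poly_in_def by (intro poly_funs_sum poly_funs.mult poly_funs_power poly_funs.coord indep_funs_poly)

lemma poly_in_upd: "(\<And>j. c j \<in> indep_funs i) \<Longrightarrow> poly_in i c n (x(i := t)) = (\<Sum>j<n. c j x * t ^ j)"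
  by (simp add: poly_in_def indep_funs_upd del: fun_upd_apply) simp

lemma poly_funs_poly_in:
  assumes "q \<in> poly_funs"
  obtains n c where "\<forall>j. c j \<in> indep_funs i" "q = poly_in i c n"
proof -
  from poly_funs_expand[OF assms, of i] obtain n c where
    c: "\<forall>j. c j \<in> poly_funs" "\<forall>j x t. c j (x(i := t)) = c j x" "\<forall>j>n. c j = (\<lambda>_. 0)"
       "\<forall>x. q x = (\<Sum>j\<le>n. c j x * x i ^ j)" by (elim exE conjE)
  have "q = poly_in i c (Suc n)" using c(4) by (simp add: poly_in_def fun_eq_iff lessThan_Suc_atMost)
  moreover have "\<forall>j. c j \<in> indep_funs i" using c by (simp add: indep_funs_def)
  ultimately show ?thesis using that by blast
qed

text \<open>The leading coefficient \<open>p m\<close> may vanish somewhere, so each division step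
  multiplies by it; \<open>N\<close> counts these steps. A step replaces \<open>c\<close> by
  \<open>p m\<close> times \<open>c\<close> minus \<open>c n\<close> times the shifted divisor,
  which is shorter by one.\<close>

lemma pseudo_division:
  assumes p: "\<And>j. p j \<in> indep_funs i" and c: "\<And>j. c j \<in> indep_funs i"
  shows "\<exists>N w r. (\<forall>j. w j \<in> indep_funs i) \<and> (\<forall>j. r j \<in> indep_funs i) \<and>
    (\<forall>x. p m x ^ N * poly_in i c n x = poly_in i w (n - m) x * poly_in i p (Suc m) x + poly_in i r m x)"
  using c
proof (induction n arbitrary: c)
  case 0
  show ?case
    by (rule exI[of _ 0], rule exI[of _ "\<lambda>_ _. 0"], rule exI[of _ "\<lambda>_ _. 0"])
      (simp add: poly_in_def indep_funs_const)
next
  case (Suc n)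
  show ?case
  proof (cases "n < m")
    case True
    let ?r = "\<lambda>j. if j < Suc n then c j else (\<lambda>_. 0)"
    have "poly_in i c (Suc n) x = poly_in i ?r m x" for x
      unfolding poly_in_def using True by (intro sum.mono_neutral_cong_left) auto
    then show ?thesis using True Suc.prems
      by (intro exI[of _ 0] exI[of _ "\<lambda>_ _. 0"] exI[of _ ?r]) (auto simp: indep_funs_const poly_in_def)
  next
    case False
    define c' where "c' j = (\<lambda>x. p m x * c j x - (if n - m \<le> j then c n x * p (j - (n - m)) x else 0))" for j
    have c': "c' j \<in> indep_funs i" for j
      unfolding c'_def
      by (cases "n - m \<le> j") (auto intro!: indep_funs_diff indep_funs_mult indep_funs_const p Suc.prems)
    from Suc.IH[of c', OF c'] obtain N w r where
      IH: "\<forall>j. w j \<in> indep_funs i" "\<forall>j. r j \<in> indep_funs i"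
        "\<forall>x. p m x ^ N * poly_in i c' n x = poly_in i w (n - m) x * poly_in i p (Suc m) x + poly_in i r m x"
      by (elim exE conjE)
    have key: "p m x * poly_in i c (Suc n) x = poly_in i c' n x + c n x * x i ^ (n - m) * poly_in i p (Suc m) x" for x
    proof -
      have "(\<Sum>j<m. p j x * x i ^ (j + (n - m))) = (\<Sum>j\<in>{n - m..<n}. p (j - (n - m)) x * x i ^ j)"
        by (rule sum.reindex_bij_witness[where i = "\<lambda>j. j - (n - m)" and j = "\<lambda>j. j + (n - m)"])
          (use False in auto)
      also have "\<dots> = (\<Sum>j<n. (if n - m \<le> j then p (j - (n - m)) x else 0) * x i ^ j)"
        by (rule sum.mono_neutral_cong_left) auto
      finally have *: "x i ^ (n - m) * (\<Sum>j<m. p j x * x i ^ j) =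
          (\<Sum>j<n. (if n - m \<le> j then p (j - (n - m)) x else 0) * x i ^ j)"
        by (simp add: sum_distrib_left power_add mult_ac)
      have "x i ^ (n - m) * x i ^ m = x i ^ n" using False by (simp flip: power_add)
      then have "c n x * x i ^ (n - m) * poly_in i p (Suc m) x =
        c n x * (\<Sum>j<n. (if n - m \<le> j then p (j - (n - m)) x else 0) * x i ^ j) + p m x * (c n x * x i ^ n)"
        unfolding *[symmetric] poly_in_def by (simp add: algebra_simps)
      moreover have "poly_in i c' n x = p m x * (\<Sum>j<n. c j x * x i ^ j) -
        c n x * (\<Sum>j<n. (if n - m \<le> j then p (j - (n - m)) x else 0) * x i ^ j)"
        unfolding poly_in_def c'_def sum_distrib_left sum_subtractf[symmetric]
        by (intro sum.cong refl) (simp add: algebra_simps)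
      ultimately show ?thesis by (simp add: poly_in_def algebra_simps)
    qed
    define w' where "w' j = (if j = n - m then (\<lambda>x. p m x ^ N * c n x) else w j)" for j
    have w': "\<forall>j. w' j \<in> indep_funs i"
      unfolding w'_def using IH(1) by (auto intro!: indep_funs_mult indep_funs_power p Suc.prems)
    have "poly_in i w' (Suc n - m) x = poly_in i w (n - m) x + p m x ^ N * c n x * x i ^ (n - m)" for x
    proof -
      have "Suc n - m = Suc (n - m)" using False by simp
      moreover have "(\<Sum>j<n - m. w' j x * x i ^ j) = (\<Sum>j<n - m. w j x * x i ^ j)"
        by (rule sum.cong) (auto simp: w'_def)
      ultimately show ?thesis by (simp add: poly_in_def w'_def)
    qed
    moreover have "p m x ^ Suc N * poly_in i c (Suc n) x =
      p m x ^ N * poly_in i c' n x + p m x ^ N * c n x * x i ^ (n - m) * poly_in i p (Suc m) x" for x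
      using arg_cong[OF key[of x], of "\<lambda>a. p m x ^ N * a"] by (simp add: algebra_simps)
    ultimately have "\<forall>x. p m x ^ Suc N * poly_in i c (Suc n) x =
      poly_in i w' (Suc n - m) x * poly_in i p (Suc m) x + poly_in i r m x"
      using IH(3) by (simp add: algebra_simps)
    then show ?thesis using w' IH(2) by blast
  qed
qed

text \<open>If the last coordinate is algebraic over the others on \<open>Z\<close>, then every root of a relation \<open>p\<close> of
  minimal degree gives a point of \<open>Z\<close>, because every other relation pseudo-divides by \<open>p\<close>; and some
  multiple of \<open>\<beta>\<close> agrees on \<open>Z\<close> with a function \<open>\<gamma>\<close> that does not involve this coordinate.\<close>

lemma lift_one_coordinate:
  fixes Z :: "('i \<Rightarrow> complex) set"
  assumes irr: "\<And>p q. p \<in> poly_funs \<Longrightarrow> q \<in> poly_funs \<Longrightarrow> (\<forall>x\<in>Z. p x * q x = 0) \<Longrightarrow>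
      (\<forall>x\<in>Z. p x = 0) \<or> (\<forall>x\<in>Z. q x = 0)"
    and closed: "\<And>x. (\<forall>q\<in>poly_funs. (\<forall>z\<in>Z. q z = 0) \<longrightarrow> q x = 0) \<Longrightarrow> x \<in> Z"
    and \<beta>: "\<beta> \<in> poly_funs" "\<not> (\<forall>z\<in>Z. \<beta> z = 0)"
  shows "\<exists>\<alpha>\<in>indep_funs i. \<not> (\<forall>z\<in>Z. \<alpha> z = 0) \<and>
    (\<forall>x. \<alpha> x \<noteq> 0 \<longrightarrow> (\<forall>q\<in>indep_funs i. (\<forall>z\<in>Z. q z = 0) \<longrightarrow> q x = 0) \<longrightarrow>
      (\<exists>t. x(i := t) \<in> Z \<and> \<beta> (x(i := t)) \<noteq> 0))"
proof -
  define van where "van q \<longleftrightarrow> (\<forall>z\<in>Z. q z = 0)" for q :: "('i \<Rightarrow> complex) \<Rightarrow> complex"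
  define W where "W = {x. \<forall>q\<in>indep_funs i. van q \<longrightarrow> q x = 0}"
  have van_mult: "van p \<or> van q" if "p \<in> poly_funs" "q \<in> poly_funs" "van (\<lambda>x. p x * q x)" for p q
    using irr[OF that(1,2)] that(3) by (auto simp: van_def)
  have van_power: "van p" if "p \<in> poly_funs" "van (\<lambda>x. p x ^ N)" for p N
    using that(2)
  proof (induction N)
    case 0
    then have "Z = {}" by (auto simp: van_def)
    then show ?case by (simp add: van_def)
  next
    case (Suc N)
    then have "van p \<or> van (\<lambda>x. p x ^ N)"
      by (intro van_mult that(1) poly_funs_power) simp
    then show ?case using Suc.IH by blast
  qed
  have top: "\<exists>e<n. \<not> van (c e) \<and> van (\<lambda>x. poly_in i c (Suc e) x + g x)"
    if "van (\<lambda>x. poly_in i c n x + g x)" "\<exists>j<n. \<not> van (c j)" for c n g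
  proof -
    define e where "e = Max {j. j < n \<and> \<not> van (c j)}"
    have fin: "finite {j. j < n \<and> \<not> van (c j)}" "{j. j < n \<and> \<not> van (c j)} \<noteq> {}" using that(2) by auto
    have e: "e < n" "\<not> van (c e)" using Max_in[OF fin] by (auto simp: e_def)
    have above: "van (c j)" if "e < j" "j < n" for j
    proof (rule ccontr)
      assume "\<not> van (c j)"
      then have "j \<le> e" unfolding e_def using fin(1) that by (intro Max_ge) auto
      then show False using that by simp
    qed
    have "poly_in i c (Suc e) z = poly_in i c n z" if "z \<in> Z" for z
      unfolding poly_in_def using above e that
      by (intro sum.mono_neutral_left) (auto simp: van_def)
    then show ?thesis using that(1) e by (auto simp: van_def)
  qed
  obtain b nb where b: "\<forall>j. b j \<in> indep_funs i" "\<beta> = poly_in i b nb"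
    using poly_funs_poly_in[OF \<beta>(1), of i] by metis
  have \<beta>_van: "\<not> van \<beta>" using \<beta>(2) by (simp add: van_def)
  show ?thesis
  \<comment> \<open>In the first case the coordinate is transcendental over the others: every
    relation has coefficients that vanish on \<open>Z\<close>. Then the fibre over a point of
    \<open>W\<close> is a whole line, and a nonvanishing coefficient of \<beta> serves as
    \<alpha>.\<close>
  proof (cases "\<forall>n c. (\<forall>j. c j \<in> indep_funs i) \<longrightarrow> van (poly_in i c n) \<longrightarrow> (\<forall>j<n. van (c j))")
    case True
    have "\<exists>j<nb. \<not> van (b j)"
    proof (rule ccontr)
      assume "\<not> ?thesis"
      then have "van (poly_in i b nb)" by (auto simp: van_def poly_in_def intro!: sum.neutral)
      then show False using \<beta>_van b by simp
    qed
    then obtain j where j: "j < nb" "\<not> van (b j)" by blast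
    have "\<exists>t. x(i := t) \<in> Z \<and> \<beta> (x(i := t)) \<noteq> 0" if "b j x \<noteq> 0" "x \<in> W" for x
    proof -
      have "\<not> (\<forall>t. (\<Sum>j\<le>nb - 1. b j x * t ^ j) = 0)"
        using polyfun_eq_0[of "\<lambda>j. b j x" "nb - 1"] that(1) j(1) by auto
      moreover have "{..<nb} = {..nb - 1}" using j(1) by auto
      ultimately obtain t where t: "(\<Sum>j<nb. b j x * t ^ j) \<noteq> 0" by auto
      have "x(i := t) \<in> Z"
      proof (rule closed, intro ballI impI)
        fix q assume q: "q \<in> poly_funs" "\<forall>z\<in>Z. q z = 0"
        obtain c n where c: "\<forall>j. c j \<in> indep_funs i" "q = poly_in i c n"
          using poly_funs_poly_in[OF q(1), of i] by metis
        then have "\<forall>j<n. van (c j)" using True q(2) by (auto simp: van_def)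
        then have "c j x = 0" if "j < n" for j using \<open>x \<in> W\<close> c(1) that by (auto simp: W_def)
        then show "q (x(i := t)) = 0" using c by (simp add: poly_in_upd del: fun_upd_apply)
      qed
      moreover have "\<beta> (x(i := t)) \<noteq> 0" using t b by (simp add: poly_in_upd del: fun_upd_apply)
      ultimately show ?thesis by blast
    qed
    then show ?thesis using j b(1) by (intro bexI[of _ "b j"]) (auto simp: van_def W_def)
  next
    case False
    then obtain n c where nc: "\<forall>j. c j \<in> indep_funs i" "van (poly_in i c n)" "\<exists>j<n. \<not> van (c j)" by blast
    let ?P = "\<lambda>m. \<exists>p. (\<forall>j. p j \<in> indep_funs i) \<and> van (poly_in i p (Suc m)) \<and> \<not> van (p m)"
    have "\<exists>m. ?P m" using top[of c n "\<lambda>_. 0"] nc by auto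
    define m where "m = (LEAST m. ?P m)"
    have "?P m" unfolding m_def using LeastI_ex[OF \<open>\<exists>m. ?P m\<close>] .
    then obtain p where p: "\<And>j. p j \<in> indep_funs i" "van (poly_in i p (Suc m))" "\<not> van (p m)" by blast
    have minimal: "van (c j)" if c: "\<forall>j. c j \<in> indep_funs i" "van (poly_in i c k)" "k \<le> m" "j < k" for c k j
    proof (rule ccontr)
      assume "\<not> van (c j)"
      then obtain e where e: "e < k" "\<not> van (c e)" "van (poly_in i c (Suc e))"
        using top[of c k "\<lambda>_. 0"] c by auto
      then have "m \<le> e" unfolding m_def using c(1) by (intro Least_le) blast
      then show False using e c by simp
    qed
    have m: "m > 0"
    proof (rule ccontr)
      assume "\<not> m > 0"
      then show False using p by (simp add: poly_in_def van_def)
    qed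
    have root: "x(i := t) \<in> Z" if "x \<in> W" "p m x \<noteq> 0" "(\<Sum>j\<le>m. p j x * t ^ j) = 0" for x t
    proof (rule closed, intro ballI impI)
      fix q assume q: "q \<in> poly_funs" "\<forall>z\<in>Z. q z = 0"
      obtain c n where c: "\<forall>j. c j \<in> indep_funs i" "q = poly_in i c n"
        using poly_funs_poly_in[OF q(1), of i] by metis
      from pseudo_division[of p i c m n] p(1) c(1) obtain N w r where
        d: "\<forall>j. w j \<in> indep_funs i" "\<forall>j. r j \<in> indep_funs i"
        "\<forall>x. p m x ^ N * poly_in i c n x = poly_in i w (n - m) x * poly_in i p (Suc m) x + poly_in i r m x"
        by blast
      have "van (poly_in i r m)" unfolding van_def
      proof
        fix z assume "z \<in> Z"
        then show "poly_in i r m z = 0" using d(3)[rule_format, of z] q(2) p(2) c(2) by (auto simp: van_def)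
      qed
      then have "van (r j)" if "j < m" for j using minimal[OF d(2)] that by blast
      then have "r j x = 0" if "j < m" for j using \<open>x \<in> W\<close> d(2) that by (auto simp: W_def)
      then have "poly_in i r m (x(i := t)) = 0" using d(2) by (simp add: poly_in_upd del: fun_upd_apply)
      moreover have "poly_in i p (Suc m) (x(i := t)) = 0"
        using that(3) p(1) by (simp add: poly_in_upd lessThan_Suc_atMost del: fun_upd_apply sum.lessThan_Suc)
      ultimately have "p m x ^ N * q (x(i := t)) = 0"
        using d(3)[rule_format, of "x(i := t)"] c(2) p(1) by (simp add: indep_funs_upd del: fun_upd_apply)
      then show "q (x(i := t)) = 0" using that(2) by simp
    qed
    \<comment> \<open>Degrees e < m of elements r with r + s \<beta> = 0 on \<open>Z\<close>, that
      is, of multiples of \<beta> modulo the relations. Minimal degree 0 means that the coordinate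
      has been eliminated from a multiple of \<beta>.\<close>
    let ?R = "\<lambda>e. e < m \<and> (\<exists>r s. (\<forall>j. r j \<in> indep_funs i) \<and> s \<in> poly_funs \<and>
      van (\<lambda>x. poly_in i r (Suc e) x + s x * \<beta> x) \<and> \<not> van (r e))"
    have R_ex: "\<exists>e. ?R e"
    proof -
      from pseudo_division[of p i b m nb] p(1) b(1) obtain N w r where
        d: "\<forall>j. w j \<in> indep_funs i" "\<forall>j. r j \<in> indep_funs i"
        "\<forall>x. p m x ^ N * poly_in i b nb x = poly_in i w (nb - m) x * poly_in i p (Suc m) x + poly_in i r m x"
        by blast
      have eq: "p m z ^ N * \<beta> z = poly_in i r m z" if "z \<in> Z" for z
        using d(3)[rule_format, of z] p(2) b(2) that by (simp add: van_def)
      have "\<exists>j<m. \<not> van (r j)"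
      proof (rule ccontr)
        assume "\<not> ?thesis"
        then have "van (poly_in i r m)" by (auto simp: van_def poly_in_def intro!: sum.neutral)
        then have "van (\<lambda>x. p m x ^ N * \<beta> x)" using eq by (simp add: van_def)
        then have "van (\<lambda>x. p m x ^ N) \<or> van \<beta>"
          by (intro van_mult poly_funs_power \<beta>(1) indep_funs_poly[OF p(1)])
        then show False using \<beta>_van van_power[OF indep_funs_poly[OF p(1)]] p(3) by blast
      qed
      moreover have "van (\<lambda>x. poly_in i r m x + (- (p m x ^ N)) * \<beta> x)" using eq by (simp add: van_def)
      ultimately obtain e where "e < m" "\<not> van (r e)" "van (\<lambda>x. poly_in i r (Suc e) x + (- (p m x ^ N)) * \<beta> x)"
        using top[of r m "\<lambda>x. (- (p m x ^ N)) * \<beta> x"] by auto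
      moreover have "(\<lambda>x. - (p m x ^ N)) \<in> poly_funs"
        using poly_funs_diff[OF poly_funs.const[of 0] poly_funs_power[OF indep_funs_poly[OF p(1)]]] by simp
      ultimately show ?thesis using d(2) by (intro exI[of _ e]) blast
    qed
    define e where "e = (LEAST e. ?R e)"
    have "?R e" unfolding e_def using LeastI_ex[OF R_ex] .
    then obtain r s where r: "e < m" "\<And>j. r j \<in> indep_funs i" "s \<in> poly_funs"
      "van (\<lambda>x. poly_in i r (Suc e) x + s x * \<beta> x)" "\<not> van (r e)" by blast
    \<comment> \<open>Otherwise divide \<open>p\<close> by \<open>r\<close>. The remainder is again
      a multiple of \<beta> on \<open>Z\<close>, so its coefficients vanish there by minimality of
      \<open>e\<close>. Then w r vanishes on \<open>Z\<close>, hence w does. For e > 0 the quotient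
      w has at most m coefficients, so these vanish on \<open>Z\<close> by minimality of m, and
      comparing leading coefficients contradicts the choice of \<open>p\<close> and
      \<open>r\<close>.\<close>
    have "e = 0"
    proof (rule ccontr)
      assume "e \<noteq> 0"
      from pseudo_division[of r i p e "Suc m"] p(1) r(2) obtain N w r' where
        d: "\<forall>j. w j \<in> indep_funs i" "\<forall>j. r' j \<in> indep_funs i"
        "\<forall>x. r e x ^ N * poly_in i p (Suc m) x = poly_in i w (Suc m - e) x * poly_in i r (Suc e) x + poly_in i r' e x"
        by blast
      have w_poly: "poly_in i w (Suc m - e) \<in> poly_funs" using d(1) by (intro poly_in_poly_funs) blast
      have r_poly: "poly_in i r (Suc e) \<in> poly_funs" using r(2) by (intro poly_in_poly_funs) blast
      have r'_van: "van (r' j)" if "j < e" for j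
      proof (rule ccontr)
        assume "\<not> van (r' j)"
        have V: "van (\<lambda>x. poly_in i r' e x + (- (poly_in i w (Suc m - e) x * s x)) * \<beta> x)"
          unfolding van_def
        proof
          fix z assume z: "z \<in> Z"
          have "poly_in i r (Suc e) z = - (s z * \<beta> z)"
            using r(4) z by (auto simp: van_def eq_neg_iff_add_eq_0)
          moreover have "poly_in i w (Suc m - e) z * poly_in i r (Suc e) z + poly_in i r' e z = 0"
            using d(3)[rule_format, of z] p(2) z by (simp add: van_def)
          ultimately show "poly_in i r' e z + (- (poly_in i w (Suc m - e) z * s z)) * \<beta> z = 0"
            by (simp add: algebra_simps)
        qed
        have "\<exists>j<e. \<not> van (r' j)" using that \<open>\<not> van (r' j)\<close> by blast
        from top[OF V this] obtain e' where "e' < e" "\<not> van (r' e')"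
          "van (\<lambda>x. poly_in i r' (Suc e') x + (- (poly_in i w (Suc m - e) x * s x)) * \<beta> x)"
          by blast
        moreover have "(\<lambda>x. - (poly_in i w (Suc m - e) x * s x)) \<in> poly_funs"
          using poly_funs_diff[OF poly_funs.const[of 0] poly_funs.mult[OF w_poly r(3)]] by simp
        ultimately have "?R e'" using r(1) d(2)
          by (intro conjI exI[of _ r'] exI[of _ "\<lambda>x. - (poly_in i w (Suc m - e) x * s x)"]) auto
        then have "e \<le> e'" unfolding e_def by (rule Least_le)
        then show False using \<open>e' < e\<close> by simp
      qed
      have "van (\<lambda>x. poly_in i w (Suc m - e) x * poly_in i r (Suc e) x)"
        unfolding van_def
      proof
        fix z assume z: "z \<in> Z"
        have "poly_in i r' e z = 0" using r'_van z by (auto simp: poly_in_def van_def intro!: sum.neutral)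
        then show "poly_in i w (Suc m - e) z * poly_in i r (Suc e) z = 0"
          using d(3)[rule_format, of z] p(2) z by (simp add: van_def)
      qed
      then have "van (poly_in i w (Suc m - e)) \<or> van (poly_in i r (Suc e))" by (rule van_mult[OF w_poly r_poly])
      moreover have "\<not> van (poly_in i r (Suc e))"
      proof
        assume "van (poly_in i r (Suc e))"
        then have "van (r e)" using minimal[of r "Suc e" e] r(1,2) by simp
        then show False using r(5) by blast
      qed
      ultimately have w_van: "van (w j)" if "j < Suc m - e" for j
        using minimal[OF d(1), of "Suc m - e" j] that \<open>e \<noteq> 0\<close> by simp
      have "van (\<lambda>x. r e x ^ N * p m x)"
        unfolding van_def
      proof
        fix z assume z: "z \<in> Z"
        have "(\<Sum>j\<le>m. (r e z ^ N * p j z) * t ^ j) = 0" for t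
        proof -
          have "poly_in i w (Suc m - e) (z(i := t)) = 0" "poly_in i r' e (z(i := t)) = 0"
            using d(1,2) w_van r'_van z by (auto simp: poly_in_upd van_def simp del: fun_upd_apply intro!: sum.neutral)
          then have "r e z ^ N * poly_in i p (Suc m) (z(i := t)) = 0"
            using d(3)[rule_format, of "z(i := t)"] r(2) by (simp add: indep_funs_upd del: fun_upd_apply)
          then show ?thesis
            using p(1) by (simp add: poly_in_upd lessThan_Suc_atMost sum_distrib_left mult.assoc
                del: fun_upd_apply sum.lessThan_Suc mult_eq_0_iff)
        qed
        then show "r e z ^ N * p m z = 0"
          using polyfun_eq_0[of "\<lambda>j. r e z ^ N * p j z" m] by blast
      qed
      then have "van (\<lambda>x. r e x ^ N) \<or> van (p m)"
        by (intro van_mult poly_funs_power indep_funs_poly[OF p(1)] indep_funs_poly[OF r(2)])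
      then show False using van_power[OF indep_funs_poly[OF r(2)]] r(5) p(3) by blast
    qed
    then have \<gamma>: "r 0 z = - (s z * \<beta> z)" if "z \<in> Z" for z
      using r(4) that by (auto simp: van_def poly_in_def eq_neg_iff_add_eq_0)
    \<comment> \<open>The factor \<open>p m\<close> keeps the degree positive, so that a root
      exists; the factor \<open>r 0\<close> forces \<beta> to be nonzero at the point over this
      root.\<close>
    define \<alpha> where "\<alpha> x = p m x * r 0 x" for x
    have \<alpha>: "\<alpha> \<in> indep_funs i" unfolding \<alpha>_def by (intro indep_funs_mult p(1) r(2))
    have "\<not> van \<alpha>"
      using van_mult[OF indep_funs_poly[OF p(1)] indep_funs_poly[OF r(2)], of m 0] p(3) r(5) \<open>e = 0\<close>
      unfolding \<alpha>_def by blast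
    moreover have "\<exists>t. x(i := t) \<in> Z \<and> \<beta> (x(i := t)) \<noteq> 0" if x: "\<alpha> x \<noteq> 0" "x \<in> W" for x
    proof -
      have pm: "p m x \<noteq> 0" "r 0 x \<noteq> 0" using x by (auto simp: \<alpha>_def)
      define \<pi> where "\<pi> = (\<Sum>j\<le>m. monom (p j x) j)"
      have "coeff \<pi> m = p m x" by (simp add: \<pi>_def coeff_sum)
      then have "degree \<pi> \<noteq> 0" using pm m le_degree[of \<pi> m] by auto
      then obtain t where "poly \<pi> t = 0"
        using fundamental_theorem_of_algebra[of \<pi>] constant_degree[of \<pi>] by auto
      then have "(\<Sum>j\<le>m. p j x * t ^ j) = 0" by (simp add: \<pi>_def poly_sum poly_monom)
      then have Z: "x(i := t) \<in> Z" using root x(2) pm(1) by blast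
      then have "r 0 x = - (s (x(i := t)) * \<beta> (x(i := t)))"
        using \<gamma>[OF Z] r(2)[of 0] by (simp add: indep_funs_upd del: fun_upd_apply)
      then show ?thesis using Z pm(2) by auto
    qed
    ultimately show ?thesis using \<alpha> by (intro bexI[of _ \<alpha>]) (auto simp: van_def W_def)
  qed
qed

text \<open>Coordinates are eliminated one at a time, each from the closure of the previous
  projection, which stays irreducible. Projecting means setting coordinates to 0, so that source and
  target have the same type.\<close>

lemma lift_coordinates:
  fixes Z :: "('i \<Rightarrow> complex) set"
  assumes "finite J"
    and irr: "\<And>p q. p \<in> poly_funs \<Longrightarrow> q \<in> poly_funs \<Longrightarrow> (\<forall>x\<in>Z. p x * q x = 0) \<Longrightarrow>
      (\<forall>x\<in>Z. p x = 0) \<or> (\<forall>x\<in>Z. q x = 0)"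
    and closed: "\<And>x. (\<forall>q\<in>poly_funs. (\<forall>z\<in>Z. q z = 0) \<longrightarrow> q x = 0) \<Longrightarrow> x \<in> Z"
    and \<beta>: "\<beta> \<in> poly_funs" "\<exists>z\<in>Z. \<beta> z \<noteq> 0"
  shows "\<exists>\<alpha>\<in>poly_funs. (\<exists>z\<in>(\<lambda>z i. if i \<in> J then 0 else z i) ` Z. \<alpha> z \<noteq> 0) \<and>
    (\<forall>x\<in>zariski closure_of ((\<lambda>z i. if i \<in> J then 0 else z i) ` Z). \<alpha> x \<noteq> 0 \<longrightarrow>
      (\<exists>x'\<in>Z. (\<forall>i. i \<notin> J \<longrightarrow> x' i = x i) \<and> \<beta> x' \<noteq> 0))"
  using assms(1)
proof (induction J rule: finite_induct)
  case empty
  have "x \<in> Z" if "x \<in> zariski closure_of Z" for x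
    using that closed closure_of_zariski by blast
  then show ?case using \<beta> by (intro bexI[of _ \<beta>]) auto
next
  case (insert i J)
  let ?\<pi> = "\<lambda>J z i. if i \<in> J then 0 else z i :: complex"
  let ?Z = "zariski closure_of (?\<pi> J ` Z)"
  obtain \<alpha> where \<alpha>: "\<alpha> \<in> poly_funs" "\<exists>z\<in>?\<pi> J ` Z. \<alpha> z \<noteq> 0"
    "\<And>x. x \<in> ?Z \<Longrightarrow> \<alpha> x \<noteq> 0 \<Longrightarrow> \<exists>x'\<in>Z. (\<forall>i. i \<notin> J \<longrightarrow> x' i = x i) \<and> \<beta> x' \<noteq> 0"
    using insert.IH by blast
  have sub: "?\<pi> J ` Z \<subseteq> ?Z" by (simp add: closure_of_subset)
  have \<pi>_poly: "(\<lambda>z. p (?\<pi> K z)) \<in> poly_funs" if "p \<in> poly_funs" for p K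
    by (rule poly_funs_compose[OF that]) (intro poly_funs_if poly_funs.const poly_funs.coord)
  have "\<exists>\<alpha>'\<in>indep_funs i. \<not> (\<forall>z\<in>?Z. \<alpha>' z = 0) \<and>
    (\<forall>x. \<alpha>' x \<noteq> 0 \<longrightarrow> (\<forall>q\<in>indep_funs i. (\<forall>z\<in>?Z. q z = 0) \<longrightarrow> q x = 0) \<longrightarrow>
      (\<exists>t. x(i := t) \<in> ?Z \<and> \<alpha> (x(i := t)) \<noteq> 0))"
  proof (rule lift_one_coordinate)
    fix p q :: "('i \<Rightarrow> complex) \<Rightarrow> complex"
    assume pq: "p \<in> poly_funs" "q \<in> poly_funs" "\<forall>x\<in>?Z. p x * q x = 0"
    have "(\<forall>z\<in>Z. p (?\<pi> J z) = 0) \<or> (\<forall>z\<in>Z. q (?\<pi> J z) = 0)"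
    proof (rule irr[OF \<pi>_poly[OF pq(1)] \<pi>_poly[OF pq(2)]])
      show "\<forall>z\<in>Z. p (?\<pi> J z) * q (?\<pi> J z) = 0" using pq(3) sub by auto
    qed
    then show "(\<forall>x\<in>?Z. p x = 0) \<or> (\<forall>x\<in>?Z. q x = 0)"
    proof
      assume "\<forall>z\<in>Z. p (?\<pi> J z) = 0"
      then have "p x = 0" if "x \<in> ?Z" for x by (intro closure_of_zariskiD[OF that pq(1)]) auto
      then show ?thesis by blast
    next
      assume "\<forall>z\<in>Z. q (?\<pi> J z) = 0"
      then have "q x = 0" if "x \<in> ?Z" for x by (intro closure_of_zariskiD[OF that pq(2)]) auto
      then show ?thesis by blast
    qed
  next
    fix x assume *: "\<forall>q\<in>poly_funs. (\<forall>z\<in>?Z. q z = 0) \<longrightarrow> q x = 0"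
    show "x \<in> ?Z"
      unfolding closure_of_zariski
    proof (intro ballI impI)
      fix q assume q: "q \<in> poly_funs" "\<forall>z\<in>?\<pi> J ` Z. q z = 0"
      have "q z = 0" if "z \<in> ?Z" for z by (rule closure_of_zariskiD[OF that q(1)]) (use q(2) in blast)
      then show "q x = 0" using * q(1) by blast
    qed
  next
    show "\<alpha> \<in> poly_funs" by (rule \<alpha>(1))
    show "\<not> (\<forall>z\<in>?Z. \<alpha> z = 0)" using \<alpha>(2) sub by blast
  qed
  then obtain \<alpha>' where \<alpha>': "\<alpha>' \<in> indep_funs i" "\<not> (\<forall>z\<in>?Z. \<alpha>' z = 0)"
    "\<And>x. \<alpha>' x \<noteq> 0 \<Longrightarrow> (\<forall>q\<in>indep_funs i. (\<forall>z\<in>?Z. q z = 0) \<longrightarrow> q x = 0) \<Longrightarrow>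
      (\<exists>t. x(i := t) \<in> ?Z \<and> \<alpha> (x(i := t)) \<noteq> 0)" by blast
  have \<pi>_insert: "?\<pi> (insert i J) z = (?\<pi> J z)(i := 0)" for z by (auto simp: fun_eq_iff)
  have ex: "\<exists>z\<in>?\<pi> (insert i J) ` Z. \<alpha>' z \<noteq> 0"
  proof (rule ccontr)
    assume "\<not> ?thesis"
    then have "\<alpha>' (?\<pi> (insert i J) z) = 0" if "z \<in> Z" for z using that by blast
    then have "\<alpha>' ((?\<pi> J z)(i := 0)) = 0" if "z \<in> Z" for z using that by (simp only: \<pi>_insert)
    then have 0: "\<alpha>' z = 0" if "z \<in> ?\<pi> J ` Z" for z
      using that by (auto simp only: indep_funs_upd[OF \<alpha>'(1)])
    have "\<alpha>' z = 0" if "z \<in> ?Z" for z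
      by (rule closure_of_zariskiD[OF that indep_funs_poly[OF \<alpha>'(1)]]) (rule 0)
    then show False using \<alpha>'(2) by blast
  qed
  have "\<exists>x'\<in>Z. (\<forall>k. k \<notin> insert i J \<longrightarrow> x' k = x k) \<and> \<beta> x' \<noteq> 0"
    if x: "x \<in> zariski closure_of (?\<pi> (insert i J) ` Z)" "\<alpha>' x \<noteq> 0" for x
  proof -
    have "\<forall>q\<in>indep_funs i. (\<forall>z\<in>?Z. q z = 0) \<longrightarrow> q x = 0"
    proof (intro ballI impI)
      fix q assume q: "q \<in> indep_funs i" "\<forall>z\<in>?Z. q z = 0"
      show "q x = 0"
      proof (rule closure_of_zariskiD[OF x(1) indep_funs_poly[OF q(1)]])
        fix s assume "s \<in> ?\<pi> (insert i J) ` Z"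
        then obtain z where "z \<in> Z" "s = (?\<pi> J z)(i := 0)" unfolding \<pi>_insert by blast
        then show "q s = 0" using q sub by (auto simp: indep_funs_upd simp del: fun_upd_apply)
      qed
    qed
    then obtain t where t: "x(i := t) \<in> ?Z" "\<alpha> (x(i := t)) \<noteq> 0" using \<alpha>'(3)[OF x(2)] by blast
    then obtain x' where "x' \<in> Z" "\<forall>k. k \<notin> J \<longrightarrow> x' k = (x(i := t)) k" "\<beta> x' \<noteq> 0" using \<alpha>(3) by blast
    then show ?thesis by (intro bexI[of _ x']) auto
  qed
  then show ?case using ex indep_funs_poly[OF \<alpha>'(1)] by (intro bexI[of _ \<alpha>']) auto
qed

text \<open>A form of Chevalley's theorem. The graph of \<open>f\<close>, indexed by the sum of both
  index types, is closed and irreducible, and the finitely many source coordinates are eliminated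
  from it. The condition \<beta> is carried along so that the preimage point can be chosen
  generic.\<close>

theorem image_contains_open:
  fixes f :: "'b \<Rightarrow> ('i \<Rightarrow> complex) \<Rightarrow> complex"
  assumes f: "\<And>b. f b \<in> poly_funs" and "finite I"
    and \<beta>: "\<beta> \<in> poly_funs" "x0 \<in> coord_space I" "\<beta> x0 \<noteq> 0"
  shows "\<exists>\<alpha>\<in>poly_funs. (\<exists>x\<in>coord_space I. \<alpha> (\<lambda>b. f b x) \<noteq> 0) \<and>
    (\<forall>y\<in>zariski closure_of ((\<lambda>x b. f b x) ` coord_space I). \<alpha> y \<noteq> 0 \<longrightarrow>
      (\<exists>x\<in>coord_space I. (\<lambda>b. f b x) = y \<and> \<beta> x \<noteq> 0))"
proof -
  define G where "G x = case_sum x (\<lambda>b. f b x)" for x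
  let ?Z = "G ` coord_space I"
  let ?J = "Inl ` I :: ('i + 'b) set"
  let ?\<pi> = "\<lambda>z i. if i \<in> ?J then 0 else z i :: complex"
  let ?E = "\<lambda>y. case_sum (\<lambda>_. 0) y :: 'i + 'b \<Rightarrow> complex"
  have G_poly: "(\<lambda>x. G x u) \<in> poly_funs" for u
    by (cases u) (simp_all add: G_def f poly_funs.coord)
  have \<pi>G: "?\<pi> (G x) = ?E (\<lambda>b. f b x)" if "x \<in> coord_space I" for x
    using that by (auto simp: G_def coord_space_def fun_eq_iff split: sum.splits)
  have "\<exists>\<alpha>\<in>poly_funs. (\<exists>z\<in>?\<pi> ` ?Z. \<alpha> z \<noteq> 0) \<and>
    (\<forall>x\<in>zariski closure_of (?\<pi> ` ?Z). \<alpha> x \<noteq> 0 \<longrightarrow>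
      (\<exists>x'\<in>?Z. (\<forall>i. i \<notin> ?J \<longrightarrow> x' i = x i) \<and> \<beta> (\<lambda>i. x' (Inl i)) \<noteq> 0))"
  proof (rule lift_coordinates)
    show "finite ?J" using assms(2) by simp
    fix p q :: "('i + 'b \<Rightarrow> complex) \<Rightarrow> complex"
    assume pq: "p \<in> poly_funs" "q \<in> poly_funs" "\<forall>z\<in>?Z. p z * q z = 0"
    have "(\<forall>x\<in>coord_space I. p (G x) = 0) \<or> (\<forall>x\<in>coord_space I. q (G x) = 0)"
    proof (rule poly_funs_no_zero_divisors)
      show "(\<lambda>x. p (G x)) \<in> poly_funs" by (rule poly_funs_compose[OF pq(1) G_poly])
      show "(\<lambda>x. q (G x)) \<in> poly_funs" by (rule poly_funs_compose[OF pq(2) G_poly])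
    qed (use pq(3) in \<open>auto simp: coord_space_def\<close>)
    then show "(\<forall>z\<in>?Z. p z = 0) \<or> (\<forall>z\<in>?Z. q z = 0)" by blast
  next
    fix z :: "'i + 'b \<Rightarrow> complex"
    assume *: "\<forall>q\<in>poly_funs. (\<forall>z\<in>?Z. q z = 0) \<longrightarrow> q z = 0"
    let ?x = "\<lambda>i. z (Inl i)"
    have "z (Inl i) = 0" if "i \<notin> I" for i
    proof -
      have "\<forall>z\<in>?Z. z (Inl i) = 0" using that by (auto simp: G_def coord_space_def)
      then show ?thesis using *[THEN bspec, OF poly_funs.coord[of "Inl i"]] by blast
    qed
    then have x: "?x \<in> coord_space I" by (simp add: coord_space_def)
    have "z (Inr b) = f b ?x" for b
    proof -
      have "(\<lambda>z. z (Inr b) - f b (\<lambda>i. z (Inl i))) \<in> poly_funs"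
        by (intro poly_funs_diff poly_funs.coord poly_funs_compose[of "f b", OF f])
      moreover have "\<forall>z\<in>?Z. z (Inr b) - f b (\<lambda>i. z (Inl i)) = 0" by (auto simp: G_def)
      ultimately have "z (Inr b) - f b (\<lambda>i. z (Inl i)) = 0" by (rule *[THEN bspec, THEN mp])
      then show ?thesis by simp
    qed
    then have "z = G ?x" by (auto simp: G_def fun_eq_iff split: sum.splits)
    then show "z \<in> ?Z" using x by blast
  next
    show "(\<lambda>z. \<beta> (\<lambda>i. z (Inl i))) \<in> poly_funs"
      by (rule poly_funs_compose[OF \<beta>(1)]) (rule poly_funs.coord)
    show "\<exists>z\<in>?Z. \<beta> (\<lambda>i. z (Inl i)) \<noteq> 0" using \<beta> by (intro bexI[of _ "G x0"]) (auto simp: G_def)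
  qed
  then obtain \<alpha> where \<alpha>: "\<alpha> \<in> poly_funs" "\<exists>z\<in>?\<pi> ` ?Z. \<alpha> z \<noteq> 0"
    "\<And>x. x \<in> zariski closure_of (?\<pi> ` ?Z) \<Longrightarrow> \<alpha> x \<noteq> 0 \<Longrightarrow>
      (\<exists>x'\<in>?Z. (\<forall>i. i \<notin> ?J \<longrightarrow> x' i = x i) \<and> \<beta> (\<lambda>i. x' (Inl i)) \<noteq> 0)" by blast
  have E_poly: "(\<lambda>y. p (?E y)) \<in> poly_funs" if "p \<in> poly_funs" for p
  proof (rule poly_funs_compose[OF that])
    show "(\<lambda>y. ?E y u) \<in> poly_funs" for u by (cases u) (simp_all add: poly_funs.intros)
  qed
  show ?thesis
  proof (intro bexI[of _ "\<lambda>y. \<alpha> (?E y)"] conjI ballI impI)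
    show "\<exists>x\<in>coord_space I. \<alpha> (?E (\<lambda>b. f b x)) \<noteq> 0" using \<alpha>(2) \<pi>G by force
    fix y assume y: "y \<in> zariski closure_of ((\<lambda>x b. f b x) ` coord_space I)" "\<alpha> (?E y) \<noteq> 0"
    have "?E y \<in> zariski closure_of (?\<pi> ` ?Z)"
      unfolding closure_of_zariski
    proof (intro ballI impI)
      fix p assume p: "p \<in> poly_funs" "\<forall>s\<in>?\<pi> ` ?Z. p s = 0"
      show "p (?E y) = 0"
        by (rule closure_of_zariskiD[OF y(1) E_poly[OF p(1)]]) (use p(2) \<pi>G in force)
    qed
    from \<alpha>(3)[OF this y(2)] obtain x where x: "x \<in> coord_space I"
      "\<forall>i. i \<notin> ?J \<longrightarrow> G x i = ?E y i" "\<beta> (\<lambda>i. G x (Inl i)) \<noteq> 0" by blast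
    have "f b x = y b" for b using x(2)[rule_format, of "Inr b"] by (auto simp: G_def)
    then show "\<exists>x\<in>coord_space I. (\<lambda>b. f b x) = y \<and> \<beta> x \<noteq> 0"
      using x by (intro bexI[of _ x]) (auto simp: G_def)
  qed (rule E_poly[OF \<alpha>(1)])
qed

section \<open>State sums\<close>

definition local_config :: "'v set set \<Rightarrow> 'v \<Rightarrow> ('v set \<Rightarrow> nat) \<Rightarrow> 'v set \<Rightarrow> nat" where
  "local_config E v k = restrict k {e \<in> E. v \<in> e}"

text \<open>The contraction of the network, with \<open>x (v, r, \<kappa>)\<close> the entry of the
  matrix at \<open>v\<close> in row \<open>r\<close> and column \<open>\<kappa>\<close>. The set
  \<open>K\<close> of bond configurations is a parameter because a diagonal pencil kills the
  configurations in which the two bonds at vertex 0 differ.\<close>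

definition state_sum ::
  "'v set \<Rightarrow> 'v set set \<Rightarrow> ('v \<Rightarrow> nat) \<Rightarrow> ('v set \<Rightarrow> nat) set \<Rightarrow> ('v \<Rightarrow> nat)
    \<Rightarrow> ('v \<times> nat \<times> ('v set \<Rightarrow> nat) \<Rightarrow> complex) \<Rightarrow> complex" where
  "state_sum V E n K b x = (if b \<in> Pi\<^sub>E V (phys_indices n)
     then \<Sum>k\<in>K. \<Prod>v\<in>V. x (v, b v, local_config E v k) else 0)"

definition state_diff ::
  "'v set \<Rightarrow> 'v set set \<Rightarrow> ('v \<Rightarrow> nat) \<Rightarrow> ('v set \<Rightarrow> nat) set \<Rightarrow> ('v \<Rightarrow> nat)
    \<Rightarrow> ('v \<times> nat \<times> ('v set \<Rightarrow> nat) \<Rightarrow> complex) \<Rightarrow> ('v \<times> nat \<times> ('v set \<Rightarrow> nat) \<Rightarrow> complex) \<Rightarrow> complex" where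
  "state_diff V E n K b x \<xi> = (if b \<in> Pi\<^sub>E V (phys_indices n)
     then \<Sum>k\<in>K. \<Sum>v\<in>V. \<xi> (v, b v, local_config E v k) * (\<Prod>u\<in>V - {v}. x (u, b u, local_config E u k)) else 0)"

lemma state_sum_poly: "state_sum V E n K b \<in> poly_funs"
proof -
  have "(\<lambda>x. state_sum V E n K b x) \<in> poly_funs"
    unfolding state_sum_def
    by (intro poly_funs_if poly_funs_sum poly_funs_prod poly_funs.coord poly_funs.const)
  then show ?thesis by simp
qed

lemma DERIV_prod_family:
  fixes g :: "'v \<Rightarrow> complex \<Rightarrow> complex"
  assumes "finite V" "\<And>v. v \<in> V \<Longrightarrow> (g v has_field_derivative g' v) (at t)"
  shows "((\<lambda>s. \<Prod>v\<in>V. g v s) has_field_derivative (\<Sum>v\<in>V. g' v * (\<Prod>u\<in>V - {v}. g u t))) (at t)"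
  using assms
proof (induction V rule: finite_induct)
  case (insert a V)
  have "((\<lambda>s. g a s * (\<Prod>v\<in>V. g v s)) has_field_derivative
      g' a * (\<Prod>v\<in>V. g v t) + (\<Sum>v\<in>V. g' v * (\<Prod>u\<in>V - {v}. g u t)) * g a t) (at t)"
    by (intro DERIV_mult insert.IH insert.prems) auto
  moreover have "(\<Sum>v\<in>V. g' v * (\<Prod>u\<in>insert a V - {v}. g u t)) = (\<Sum>v\<in>V. g' v * (\<Prod>u\<in>V - {v}. g u t)) * g a t"
    unfolding sum_distrib_right
  proof (intro sum.cong refl)
    fix v assume "v \<in> V"
    then have "insert a V - {v} = insert a (V - {v})" using insert.hyps by auto
    then show "g' v * (\<Prod>u\<in>insert a V - {v}. g u t) = g' v * (\<Prod>u\<in>V - {v}. g u t) * g a t"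
      using insert.hyps by simp
  qed
  moreover have "insert a V - {a} = V" using insert.hyps by auto
  ultimately show ?case using insert.hyps by simp
qed simp

lemma state_sum_deriv:
  assumes "finite V"
  shows "((\<lambda>t. state_sum V E n K b (\<lambda>i. x i + t * \<xi> i)) has_field_derivative state_diff V E n K b x \<xi>) (at 0)"
proof (cases "b \<in> Pi\<^sub>E V (phys_indices n)")
  case True
  have "((\<lambda>t. \<Sum>k\<in>K. \<Prod>v\<in>V. x (v, b v, local_config E v k) + t * \<xi> (v, b v, local_config E v k))
    has_field_derivative (\<Sum>k\<in>K. \<Sum>v\<in>V. \<xi> (v, b v, local_config E v k) *
      (\<Prod>u\<in>V - {v}. x (u, b u, local_config E u k) + 0 * \<xi> (u, b u, local_config E u k)))) (at 0)"
    by (intro DERIV_sum DERIV_prod_family assms) (auto intro!: derivative_eq_intros)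
  then show ?thesis using True by (simp add: state_sum_def state_diff_def)
qed (simp add: state_sum_def state_diff_def)

lemma state_diff_add:
  "state_diff V E n K b x (\<lambda>i. \<xi> i + \<eta> i) = state_diff V E n K b x \<xi> + state_diff V E n K b x \<eta>"
  by (simp add: state_diff_def distrib_right sum.distrib)

lemma state_diff_scale: "state_diff V E n K b x (\<lambda>i. c * \<xi> i) = c * state_diff V E n K b x \<xi>"
  by (simp add: state_diff_def sum_distrib_left mult.assoc)

lemma state_diff_zero: "state_diff V E n K b x (\<lambda>i. 0) = 0"
  by (simp add: state_diff_def)

lemma state_diff_sum:
  "state_diff V E n K b x (\<lambda>i. \<Sum>a\<in>A. \<xi> a i) = (\<Sum>a\<in>A. state_diff V E n K b x (\<xi> a))"
  by (induction A rule: infinite_finite_induct) (simp_all add: state_diff_zero state_diff_add)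

text \<open>The tangent direction of rescaling column \<open>\<kappa>\<close> at \<open>v\<close>
  with weight \<open>\<tau> v \<kappa>\<close>: each configuration is multiplied by its total
  weight, which is 0.\<close>

lemma state_diff_scaling:
  assumes "finite V" "\<And>k. k \<in> K \<Longrightarrow> (\<Sum>v\<in>V. \<tau> v (local_config E v k)) = 0"
  shows "state_diff V E n K b x (\<lambda>(v, r, \<kappa>). \<tau> v \<kappa> * x (v, r, \<kappa>)) = 0"
proof -
  have "(\<Sum>v\<in>V. \<tau> v (local_config E v k) * x (v, b v, local_config E v k) * (\<Prod>u\<in>V - {v}. x (u, b u, local_config E u k))) = 0"
    if "k \<in> K" for k
  proof -
    have "(\<Sum>v\<in>V. \<tau> v (local_config E v k) * x (v, b v, local_config E v k) * (\<Prod>u\<in>V - {v}. x (u, b u, local_config E u k)))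
      = (\<Sum>v\<in>V. \<tau> v (local_config E v k) * (\<Prod>u\<in>V. x (u, b u, local_config E u k)))"
      by (intro sum.cong refl) (simp add: prod.remove[OF assms(1)] mult.assoc)
    also have "\<dots> = 0" using assms(2)[OF that] by (simp flip: sum_distrib_right)
    finally show ?thesis .
  qed
  then show ?thesis by (simp add: state_diff_def)
qed

text \<open>Infinitesimal gauge transformation: A acts on the bond \<open>{u, v}\<close> at
  \<open>u\<close>, and minus its transpose at \<open>v\<close>. Unlike in the gauge group of the
  network, A may depend on the other bonds at the vertex, through \<open>\<kappa>\<close>.\<close>

definition gauge_field ::
  "'v \<Rightarrow> 'v \<Rightarrow> nat \<Rightarrow> ('v \<Rightarrow> ('v set \<Rightarrow> nat) \<Rightarrow> nat \<Rightarrow> nat \<Rightarrow> complex)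
    \<Rightarrow> ('v \<times> nat \<times> ('v set \<Rightarrow> nat) \<Rightarrow> complex) \<Rightarrow> 'v \<times> nat \<times> ('v set \<Rightarrow> nat) \<Rightarrow> complex" where
  "gauge_field u v M A x = (\<lambda>(w, r, \<kappa>).
     if w = u then \<Sum>c<M. x (u, r, \<kappa>({u, v} := c)) * A u \<kappa> c (\<kappa> {u, v})
     else if w = v then - (\<Sum>c<M. x (v, r, \<kappa>({u, v} := c)) * A v \<kappa> (\<kappa> {u, v}) c) else 0)"

lemma gauge_field_poly: "(\<lambda>x. gauge_field u v M A x i) \<in> poly_funs"
proof (cases i)
  case (fields w r \<kappa>)
  have "(\<lambda>x. \<Sum>c<M. x (v, r, \<kappa>({u, v} := c)) * A v \<kappa> (\<kappa> {u, v}) c) \<in> poly_funs"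
    by (intro poly_funs_sum poly_funs.mult poly_funs.coord poly_funs.const)
  from poly_funs_diff[OF poly_funs.const[of 0] this]
  have "(\<lambda>x. - (\<Sum>c<M. x (v, r, \<kappa>({u, v} := c)) * A v \<kappa> (\<kappa> {u, v}) c)) \<in> poly_funs" by simp
  then show ?thesis unfolding gauge_field_def fields prod.case
    by (intro poly_funs_if poly_funs_sum poly_funs.mult poly_funs.coord poly_funs.const) auto
qed

text \<open>Moving the matrix \<open>A\<close> across the edge exchanges the old and the new value on the edge.\<close>

lemma state_diff_gauge:
  assumes V: "finite V" "u \<in> V" "v \<in> V" "u \<noteq> v" "{u, v} \<in> E"
    and K: "finite K" "\<And>k. k \<in> K \<Longrightarrow> k {u, v} < M" "\<And>k c. k \<in> K \<Longrightarrow> c < M \<Longrightarrow> k({u, v} := c) \<in> K"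
    and A: "\<And>k. k \<in> K \<Longrightarrow> A u (local_config E u k) = B k" "\<And>k. k \<in> K \<Longrightarrow> A v (local_config E v k) = B k"
      "\<And>k c. k \<in> K \<Longrightarrow> c < M \<Longrightarrow> B (k({u, v} := c)) = B k"
  shows "state_diff V E n K b x (gauge_field u v M A x) = 0"
proof -
  let ?e = "{u, v}"
  let ?x = "\<lambda>w k. x (w, b w, local_config E w k)"
  let ?rest = "\<lambda>k. \<Prod>w\<in>V - {u, v}. ?x w k"
  have upd: "(local_config E w k)(?e := c) = local_config E w (k(?e := c))" if "w = u \<or> w = v" for w k c
    using V(5) that by (auto simp: local_config_def fun_eq_iff restrict_def)
  have other: "local_config E w (k(?e := c)) = local_config E w k" if "w \<noteq> u" "w \<noteq> v" for w k c
    using that by (auto simp: local_config_def fun_eq_iff restrict_def)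
  have at_e: "local_config E w k ?e = k ?e" if "w = u \<or> w = v" for w k
    using V(5) that by (auto simp: local_config_def)
  have rest: "?rest (k(?e := c)) = ?rest k" for k c
    by (intro prod.cong refl) (simp add: other)
  have summand: "(\<Sum>w\<in>V. gauge_field u v M A x (w, b w, local_config E w k) * (\<Prod>w'\<in>V - {w}. ?x w' k)) =
    (\<Sum>c<M. ?x u (k(?e := c)) * ?x v k * B k c (k ?e) * ?rest k) -
    (\<Sum>c<M. ?x u k * ?x v (k(?e := c)) * B k (k ?e) c * ?rest k)" if "k \<in> K" for k
  proof -
    have "(\<Sum>w\<in>V. gauge_field u v M A x (w, b w, local_config E w k) * (\<Prod>w'\<in>V - {w}. ?x w' k)) =
      (\<Sum>w\<in>{u, v}. gauge_field u v M A x (w, b w, local_config E w k) * (\<Prod>w'\<in>V - {w}. ?x w' k))"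
      by (rule sum.mono_neutral_right) (use V in \<open>auto simp: gauge_field_def\<close>)
    also have "\<dots> = gauge_field u v M A x (u, b u, local_config E u k) * (\<Prod>w'\<in>V - {u}. ?x w' k) +
       gauge_field u v M A x (v, b v, local_config E v k) * (\<Prod>w'\<in>V - {v}. ?x w' k)"
      using V(4) by simp
    also have "(\<Prod>w'\<in>V - {u}. ?x w' k) = ?x v k * ?rest k"
    proof -
      have "V - {u} = insert v (V - {u, v})" using V(2-4) by blast
      then have "(\<Prod>w'\<in>V - {u}. ?x w' k) = (\<Prod>w'\<in>insert v (V - {u, v}). ?x w' k)" by (rule arg_cong)
      also have "\<dots> = ?x v k * ?rest k" by (rule prod.insert) (use V(1) in auto)
      finally show ?thesis .
    qed
    also have "(\<Prod>w'\<in>V - {v}. ?x w' k) = ?x u k * ?rest k"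
    proof -
      have "V - {v} = insert u (V - {u, v})" using V(2-4) by blast
      then have "(\<Prod>w'\<in>V - {v}. ?x w' k) = (\<Prod>w'\<in>insert u (V - {u, v}). ?x w' k)" by (rule arg_cong)
      also have "\<dots> = ?x u k * ?rest k" by (rule prod.insert) (use V(1) in auto)
      finally show ?thesis .
    qed
    also have "gauge_field u v M A x (u, b u, local_config E u k) = (\<Sum>c<M. ?x u (k(?e := c)) * B k c (k ?e))"
      by (simp add: gauge_field_def upd at_e A(1)[OF that] del: fun_upd_apply)
    also have "gauge_field u v M A x (v, b v, local_config E v k) = - (\<Sum>c<M. ?x v (k(?e := c)) * B k (k ?e) c)"
      using V(4) by (simp add: gauge_field_def upd at_e A(2)[OF that] del: fun_upd_apply)
    finally show ?thesis by (simp add: sum_distrib_left sum_distrib_right mult_ac del: fun_upd_apply)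
  qed
  have swap: "(\<Sum>k\<in>K. \<Sum>c<M. ?x u (k(?e := c)) * ?x v k * B k c (k ?e) * ?rest k) =
    (\<Sum>k\<in>K. \<Sum>c<M. ?x u k * ?x v (k(?e := c)) * B k (k ?e) c * ?rest k)"
    unfolding sum.cartesian_product
  proof (rule sum.reindex_bij_witness[where i = "\<lambda>(k, c). (k(?e := c), k ?e)" and j = "\<lambda>(k, c). (k(?e := c), k ?e)"])
  qed (use K A(3) rest in \<open>auto simp: fun_eq_iff\<close>)
  have "(\<Sum>k\<in>K. \<Sum>w\<in>V. gauge_field u v M A x (w, b w, local_config E w k) * (\<Prod>w'\<in>V - {w}. ?x w' k)) = 0"
    using swap by (simp add: summand sum_subtractf cong: sum.cong)
  then show ?thesis by (simp add: state_diff_def)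
qed

text \<open>The graph tensor is the indicator of the families of local configurations that agree on
  every edge, and these are the restrictions of global configurations. The value on an edge is read
  off at an arbitrarily chosen end.\<close>

lemma graph_tensor_sum:
  assumes "finite V" "finite E" "\<And>e. e \<in> E \<Longrightarrow> e \<subseteq> V \<and> e \<noteq> {}"
  shows "(\<Sum>a\<in>Pi\<^sub>E V (bond_indices E m). F a * graph_tensor V E m a) =
    (\<Sum>k\<in>Pi\<^sub>E E (\<lambda>e. {..<m e}). F (\<lambda>v\<in>V. local_config E v k))"
proof -
  define c where "c a e \<longleftrightarrow> (\<forall>u\<in>e. \<forall>v\<in>e. a u e = a v e)" for a :: "'a \<Rightarrow> 'a set \<Rightarrow> nat" and e
  let ?C = "\<lambda>a. \<forall>e\<in>E. c a e"
  let ?A = "{a \<in> Pi\<^sub>E V (bond_indices E m). ?C a}"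
  have fin: "finite (Pi\<^sub>E V (bond_indices E m))"
    using assms(1,2) by (auto simp: bond_indices_def intro!: finite_PiE)
  have gt: "graph_tensor V E m a = of_bool (?C a)" if "a \<in> Pi\<^sub>E V (bond_indices E m)" for a
  proof (cases "?C a")
    case True
    then have "(\<Prod>e\<in>E. of_bool (c a e)) = (1 :: complex)"
      by (intro prod.neutral) auto
    then show ?thesis using True that by (simp add: graph_tensor_def c_def[symmetric])
  next
    case False
    then have "(\<Prod>e\<in>E. of_bool (c a e)) = (0 :: complex)"
      using assms(2) by (subst prod_zero_iff) auto
    then show ?thesis using False that by (simp add: graph_tensor_def c_def[symmetric])
  qed
  have "(\<Sum>a\<in>Pi\<^sub>E V (bond_indices E m). F a * graph_tensor V E m a) = (\<Sum>a\<in>?A. F a)"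
    by (rule sum.mono_neutral_cong_right) (use fin gt in auto)
  also have "\<dots> = (\<Sum>k\<in>Pi\<^sub>E E (\<lambda>e. {..<m e}). F (\<lambda>v\<in>V. local_config E v k))"
  proof (rule sum.reindex_bij_witness[where i = "\<lambda>k. \<lambda>v\<in>V. local_config E v k"
        and j = "\<lambda>a. \<lambda>e\<in>E. a (SOME v. v \<in> e) e"])
    fix a assume a: "a \<in> ?A"
    have some: "(SOME v. v \<in> e) \<in> e" "(SOME v. v \<in> e) \<in> V" if "e \<in> E" for e
      using assms(3)[OF that] someI_ex[of "\<lambda>v. v \<in> e"] by auto
    have "local_config E v (\<lambda>e\<in>E. a (SOME v. v \<in> e) e) = a v" if "v \<in> V" for v
    proof
      fix e
      have "a v \<in> Pi\<^sub>E {e \<in> E. v \<in> e} (\<lambda>e. {..<m e})" using a that by (auto simp: bond_indices_def PiE_iff)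
      moreover have "a (SOME v. v \<in> e) e = a v e" if "e \<in> E" "v \<in> e"
        using a some[OF that(1)] that unfolding c_def by blast
      ultimately show "local_config E v (\<lambda>e\<in>E. a (SOME v. v \<in> e) e) e = a v e"
        by (auto simp: local_config_def restrict_def PiE_def extensional_def)
    qed
    then show "(\<lambda>v\<in>V. local_config E v (\<lambda>e\<in>E. a (SOME v. v \<in> e) e)) = a"
      using a by (auto simp: fun_eq_iff PiE_def extensional_def restrict_def)
    then show "F (\<lambda>v\<in>V. local_config E v (\<lambda>e\<in>E. a (SOME v. v \<in> e) e)) = F a" by simp
    have "a (SOME v. v \<in> e) e < m e" if "e \<in> E" for e
    proof -
      have "a (SOME v. v \<in> e) \<in> bond_indices E m (SOME v. v \<in> e)" using a some[OF that] by (auto simp: PiE_iff)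
      then show ?thesis using some[OF that] that by (auto simp: bond_indices_def PiE_iff)
    qed
    then show "(\<lambda>e\<in>E. a (SOME v. v \<in> e) e) \<in> Pi\<^sub>E E (\<lambda>e. {..<m e})" by auto
  next
    fix k assume k: "k \<in> Pi\<^sub>E E (\<lambda>e. {..<m e})"
    have some: "(SOME v. v \<in> e) \<in> e" "(SOME v. v \<in> e) \<in> V" if "e \<in> E" for e
      using assms(3)[OF that] someI_ex[of "\<lambda>v. v \<in> e"] by auto
    show "(\<lambda>e\<in>E. (\<lambda>v\<in>V. local_config E v k) (SOME v. v \<in> e) e) = k"
      using k some by (auto simp: fun_eq_iff local_config_def PiE_def extensional_def restrict_def)
    have "local_config E v k \<in> bond_indices E m v" for v
      using k by (auto simp: local_config_def bond_indices_def PiE_iff)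
    moreover have "?C (\<lambda>v\<in>V. local_config E v k)"
      using assms(3) by (auto simp: local_config_def c_def)
    ultimately show "(\<lambda>v\<in>V. local_config E v k) \<in> ?A" by auto
  qed
  finally show ?thesis .
qed

lemma tensor_map_graph_tensor:
  assumes "finite V" "finite E" "\<And>e. e \<in> E \<Longrightarrow> e \<subseteq> V \<and> e \<noteq> {}"
  shows "tensor_map V (bond_indices E m) (phys_indices n) X (graph_tensor V E m) =
    (\<lambda>b. state_sum V E n (Pi\<^sub>E E (\<lambda>e. {..<m e})) b (\<lambda>(v, r, \<kappa>). X v r \<kappa>))"
  unfolding tensor_map_def state_sum_def
  by (intro ext if_cong refl) (simp add: graph_tensor_sum[OF assms])

lemma TNS_state_sum:
  assumes "finite V" "finite E" "\<And>e. e \<in> E \<Longrightarrow> e \<subseteq> V \<and> e \<noteq> {}"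
  shows "TNS V E m n = zariski closure_of (range (\<lambda>x b. state_sum V E n (Pi\<^sub>E E (\<lambda>e. {..<m e})) b x))"
proof -
  have "range (\<lambda>X b. state_sum V E n (Pi\<^sub>E E (\<lambda>e. {..<m e})) b (\<lambda>(v, r, \<kappa>). X v r \<kappa>)) =
    range (\<lambda>x b. state_sum V E n (Pi\<^sub>E E (\<lambda>e. {..<m e})) b x)" (is "range ?f = range ?g")
  proof
    show "range ?f \<subseteq> range ?g" by blast
    show "range ?g \<subseteq> range ?f"
    proof (rule image_subsetI)
      fix x
      show "?g x \<in> range ?f" by (rule range_eqI[of _ _ "\<lambda>v r \<kappa>. x (v, r, \<kappa>)"]) simp
    qed
  qed
  then show ?thesis unfolding TNS_def by (simp add: tensor_map_graph_tensor[OF assms])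
qed

section \<open>The augmented network\<close>

locale augmentation =
  fixes d m :: nat and E' E :: "nat set set" and bond :: "nat set \<Rightarrow> nat" and n :: "nat \<Rightarrow> nat"
  assumes d: "2 \<le> d"
    and network: "network {1..d} E'"
    and bond_pos': "\<forall>e\<in>E'. 0 < bond e"
    and m: "0 < m"
    and E: "E = E' \<union> {{0, 1}, {0, 2}}"
    and bond_01: "bond {0, 1} = m" and bond_02: "bond {0, 2} = m"
    and n_0: "n 0 = 2"
    and n_critical: "\<forall>j\<in>{1..d}. n j = (\<Prod>e\<in>{e \<in> E. j \<in> e}. bond e)"
begin

abbreviation "e1 \<equiv> {0, 1 :: nat}"
abbreviation "e2 \<equiv> {0, 2 :: nat}"
abbreviation "V \<equiv> {0..d}"
abbreviation "lc \<equiv> local_config E"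
abbreviation "L \<equiv> bond_indices E bond"

definition "K = Pi\<^sub>E E (\<lambda>e. {..<bond e})"
text \<open>The configurations that survive when the pencil at vertex 0 is diagonal; their common
  value at \<open>e1\<close> and \<open>e2\<close> is the index of the summand.\<close>

definition "K2 = {k \<in> K. k e1 = k e2}"

text \<open>Orientation by the order of the vertices; gauge entries will be fixed at the source.
  With this order, among the edges in \<open>E'\<close>, vertex 1 is never a target and vertex 2 is
  one for \<open>{1, 2}\<close> only, which \<open>X_target\<close> relies on.\<close>

definition source :: "nat set \<Rightarrow> nat" where "source e = Min e"
definition target :: "nat set \<Rightarrow> nat" where "target e = Max e"

lemma edge_E': "e \<in> E' \<Longrightarrow> e \<subseteq> {1..d} \<and> card e = 2"
  using network by (auto simp: network_def)

lemma source_target: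
  assumes "e \<in> E'"
  shows "e = {source e, target e}" "source e < target e" "1 \<le> source e" "target e \<le> d"
proof -
  obtain u v where uv: "e = {u, v}" "u \<noteq> v" using edge_E'[OF assms] card_2_iff by metis
  then show e: "e = {source e, target e}" by (auto simp: source_def target_def min_def max_def)
  show "source e < target e" using uv by (auto simp: source_def target_def)
  have "source e \<in> e" "target e \<in> e" using e by auto
  then show "1 \<le> source e" "target e \<le> d" using edge_E'[OF assms] by auto
qed

lemma zero_not_in_E': "e \<in> E' \<Longrightarrow> 0 \<notin> e"
  using edge_E' by fastforce

lemma e12_notin [simp]: "e1 \<notin> E'" "e2 \<notin> E'" "{Suc 0, 0} \<notin> E'" "{2, 0} \<notin> E'" "{0, Suc 0} \<notin> E'"
  using zero_not_in_E' by blast+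

lemma e1_ne_e2 [simp]: "e1 \<noteq> e2" "e2 \<noteq> e1" "{0, Suc 0} \<noteq> e2" "e2 \<noteq> {0, Suc 0}"
  by (auto simp: doubleton_eq_iff)

lemma E'_ne: "e \<in> E' \<Longrightarrow> e \<noteq> e1" "e \<in> E' \<Longrightarrow> e \<noteq> e2"
  by auto

lemma E_simps [simp]: "e1 \<in> E" "e2 \<in> E" "{0, Suc 0} \<in> E" "e \<in> E' \<Longrightarrow> e \<in> E"
  by (auto simp: E)

lemma E_cases: "e \<in> E \<Longrightarrow> (e \<in> E' \<Longrightarrow> P) \<Longrightarrow> (e = e1 \<Longrightarrow> P) \<Longrightarrow> (e = e2 \<Longrightarrow> P) \<Longrightarrow> P"
  by (auto simp: E)

lemma finite_E': "finite E'"
proof (rule finite_subset)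
  show "E' \<subseteq> Pow {1..d}" using edge_E' by blast
qed simp

lemma finite_E: "finite E"
  by (simp add: E finite_E')

lemma edge_E: "e \<in> E \<Longrightarrow> e \<subseteq> V \<and> e \<noteq> {}"
  using edge_E' d by (auto simp: E) fastforce+

lemma bond_pos: "e \<in> E \<Longrightarrow> 0 < bond e"
  using bond_pos' m bond_01 bond_02 by (auto simp: E)

lemma bond_simps [simp]: "bond e1 = m" "bond e2 = m" "bond {0, Suc 0} = m"
  using bond_01 bond_02 by simp_all

lemma finite_K: "finite K"
  unfolding K_def using finite_E by (intro finite_PiE) auto

lemma finite_K2: "finite K2"
  using finite_K by (simp add: K2_def)

lemma K_lt: "k \<in> K \<Longrightarrow> e \<in> E \<Longrightarrow> k e < bond e"
  by (auto simp: K_def)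

lemma K_upd: "k \<in> K \<Longrightarrow> e \<in> E \<Longrightarrow> c < bond e \<Longrightarrow> k(e := c) \<in> K"
  by (auto simp: K_def PiE_iff extensional_def)

lemma K2_upd: "k \<in> K2 \<Longrightarrow> e \<in> E' \<Longrightarrow> c < bond e \<Longrightarrow> k(e := c) \<in> K2"
  using K_upd[of k e c] E'_ne[of e] by (auto simp: K2_def)

lemma K2_K: "k \<in> K2 \<Longrightarrow> k \<in> K"
  by (simp add: K2_def)

lemma K2_eq: "k \<in> K2 \<Longrightarrow> k e2 = k e1"
  by (simp add: K2_def)

lemma K2_m: "k \<in> K2 \<Longrightarrow> k e1 < m"
  using K_lt[of k e1] by (simp add: K2_def)

lemma lc_apply: "lc v k e = (if e \<in> E \<and> v \<in> e then k e else undefined)"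
  by (simp add: local_config_def restrict_def)

lemma lc_in_L: "k \<in> K \<Longrightarrow> lc v k \<in> L v"
  by (auto simp: local_config_def bond_indices_def K_def)

lemma L_lt: "\<kappa> \<in> L v \<Longrightarrow> e \<in> E \<Longrightarrow> v \<in> e \<Longrightarrow> \<kappa> e < bond e"
  by (auto simp: bond_indices_def)

lemma L_upd: "\<kappa> \<in> L v \<Longrightarrow> e \<in> E \<Longrightarrow> v \<in> e \<Longrightarrow> c < bond e \<Longrightarrow> \<kappa>(e := c) \<in> L v"
  by (auto simp: bond_indices_def PiE_iff extensional_def)

lemma L_ext: "\<kappa> \<in> L v \<Longrightarrow> \<mu> \<in> L v \<Longrightarrow> (\<And>e. e \<in> E \<Longrightarrow> v \<in> e \<Longrightarrow> \<kappa> e = \<mu> e) \<Longrightarrow> \<kappa> = \<mu>"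
  unfolding bond_indices_def by (rule PiE_ext) auto

lemma lc_upd: "e \<in> E \<Longrightarrow> lc v (k(e := c)) = (if v \<in> e then (lc v k)(e := c) else lc v k)"
  by (auto simp: fun_eq_iff lc_apply)

lemma finite_L: "finite (L v)"
  unfolding bond_indices_def using finite_E by (intro finite_PiE) auto

lemma card_L: "j \<in> {1..d} \<Longrightarrow> card (L j) = n j"
  unfolding bond_indices_def using finite_E n_critical by (subst card_PiE) auto

text \<open>An identification of the basis of W_j with that of V_j, possible because the physical
  dimension is critical. With respect to it the matrix at \<open>j\<close> of the base point is the
  identity.\<close>

definition \<beta> :: "nat \<Rightarrow> (nat set \<Rightarrow> nat) \<Rightarrow> nat" where
  "\<beta> j = (SOME f. bij_betw f (L j) {..<n j})"

lemma \<beta>_bij: "j \<in> {1..d} \<Longrightarrow> bij_betw (\<beta> j) (L j) {..<n j}"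
proof -
  assume "j \<in> {1..d}"
  then have "\<exists>f. bij_betw f (L j) {..<n j}"
    using finite_same_card_bij[OF finite_L[of j], of "{..<n j}"] card_L by simp
  then show ?thesis unfolding \<beta>_def by (rule someI_ex)
qed

lemma \<beta>_eq: "j \<in> {1..d} \<Longrightarrow> \<kappa> \<in> L j \<Longrightarrow> \<mu> \<in> L j \<Longrightarrow> \<beta> j \<kappa> = \<beta> j \<mu> \<longleftrightarrow> \<kappa> = \<mu>"
  using \<beta>_bij by (auto simp: bij_betw_def inj_on_def)

lemma \<beta>_lt: "j \<in> {1..d} \<Longrightarrow> \<kappa> \<in> L j \<Longrightarrow> \<beta> j \<kappa> < n j"
  using \<beta>_bij by (auto simp: bij_betw_def)

text \<open>The diagonal entries \<open>(1, i)\<close> of the pencil at \<open>base\<close> are pairwise independent in \<open>\<complex>\<^sup>2\<close>.\<close>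

definition z :: "nat \<Rightarrow> nat \<Rightarrow> complex" where
  "z i s = (if s = 0 then 1 else of_nat i)"

definition base :: "nat \<times> nat \<times> (nat set \<Rightarrow> nat) \<Rightarrow> complex" where
  "base = (\<lambda>(v, r, \<kappa>). if v = 0 then (if \<kappa> e1 = \<kappa> e2 then z (\<kappa> e1) r else 0) else of_bool (r = \<beta> v \<kappa>))"

lemma base_0: "base (0, r, \<kappa>) = (if \<kappa> e1 = \<kappa> e2 then z (\<kappa> e1) r else 0)"
  by (simp add: base_def)

lemma base_pos: "v \<noteq> 0 \<Longrightarrow> base (v, r, \<kappa>) = of_bool (r = \<beta> v \<kappa>)"
  by (simp add: base_def)

abbreviation "F A b x \<equiv> state_sum V E n A b x"
abbreviation "dF A b x \<xi> \<equiv> state_diff V E n A b x \<xi>"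

lemma F_deriv_0: "dF A b x \<xi> = 0 \<Longrightarrow> ((\<lambda>t. F A b (\<lambda>i. x i + t * \<xi> i)) has_field_derivative 0) (at 0)"
  using state_sum_deriv[of V E n A b x \<xi>] by simp

subsection \<open>Diagonalizing the pencil\<close>

definition "off_diagonal = {(0 :: nat, s, \<kappa>) | s \<kappa>. s < (2 :: nat) \<and> \<kappa> \<in> L 0 \<and> \<kappa> e1 \<noteq> \<kappa> e2}"

lemma L_0: "\<kappa> \<in> L 0 \<Longrightarrow> \<kappa> = restrict (\<lambda>e. if e = e1 then \<kappa> e1 else \<kappa> e2) {e1, e2}"
proof -
  assume "\<kappa> \<in> L 0"
  moreover have "{e \<in> E. 0 \<in> e} = {e1, e2}" using zero_not_in_E' by (auto simp: E)
  ultimately have "\<kappa> \<in> extensional {e1, e2}" by (simp add: bond_indices_def PiE_def)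
  then show ?thesis by (auto simp: fun_eq_iff extensional_def restrict_def)
qed

lemma F_diagonal:
  assumes "\<And>i. i \<in> off_diagonal \<Longrightarrow> x i = 0"
  shows "F K b x = F K2 b x"
proof (cases "b \<in> Pi\<^sub>E V (phys_indices n)")
  case True
  then have "b 0 \<in> phys_indices n 0" by (auto simp: PiE_iff)
  then have b: "b 0 < 2" using n_0 by (simp add: phys_indices_def)
  have "(\<Prod>v\<in>V. x (v, b v, lc v k)) = 0" if "k \<in> K" "k \<notin> K2" for k
  proof (rule prod_zero)
    have "(0, b 0, lc 0 k) \<in> off_diagonal"
      using that b lc_in_L[of k 0] by (auto simp: off_diagonal_def K2_def lc_apply)
    then show "\<exists>v\<in>V. x (v, b v, lc v k) = 0" using assms by (intro bexI[of _ 0]) auto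
  qed simp
  then have "(\<Sum>k\<in>K. \<Prod>v\<in>V. x (v, b v, lc v k)) = (\<Sum>k\<in>K2. \<Prod>v\<in>V. x (v, b v, lc v k))"
    by (intro sum.mono_neutral_right finite_K) (auto simp: K2_def)
  then show ?thesis by (simp add: state_sum_def)
qed (simp add: state_sum_def)

lemma F_K2_cong:
  assumes "\<And>v k r. v \<in> V \<Longrightarrow> k \<in> K2 \<Longrightarrow> r < n v \<Longrightarrow> x (v, r, lc v k) = y (v, r, lc v k)"
  shows "F K2 b x = F K2 b y"
  unfolding state_sum_def
  by (intro if_cong refl sum.cong prod.cong) (use assms in \<open>auto simp: PiE_iff phys_indices_def\<close>)

text \<open>At the off-diagonal position (i, j) the gauge fields of the two new bonds contribute a
  multiple of \<open>z j\<close> and a multiple of \<open>z i\<close>, a basis of C^2, so any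
  tangent vector there can be prescribed.\<close>

lemma pencil_fields:
  "\<exists>v. (\<forall>i\<in>off_diagonal. v base i = y i) \<and> (\<forall>i. (\<lambda>x. v x i) \<in> poly_funs) \<and>
    (\<forall>x b. ((\<lambda>t. F K b (\<lambda>i. x i + t * v x i)) has_field_derivative 0) (at 0))"
proof -
  define c where "c i j = restrict (\<lambda>e. if e = e1 then i else j :: nat) {e1, e2}" for i j
  \<comment> \<open>Cramer's rule for A z_j + B z_i = y with z_i = (1, i) and z_j = (1, j).\<close>
  define B where "B i j = (y (0, 1, c i j) - of_nat j * y (0, 0, c i j)) / (of_nat i - of_nat j)" for i j
  define A where "A j i = y (0, 0, c i j) - B i j" for i j
  define v :: "(nat \<times> nat \<times> (nat set \<Rightarrow> nat) \<Rightarrow> complex) \<Rightarrow> nat \<times> nat \<times> (nat set \<Rightarrow> nat) \<Rightarrow> complex"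
    where "v x i = gauge_field 0 1 m (\<lambda>_ _. A) x i + gauge_field 0 2 m (\<lambda>_ _. B) x i" for x i
  have "v base i = y i" if off: "i \<in> off_diagonal" for i
  proof -
    obtain s \<kappa> where i: "i = (0, s, \<kappa>)" "s < 2" "\<kappa> \<in> L 0" "\<kappa> e1 \<noteq> \<kappa> e2"
      using off by (auto simp: off_diagonal_def)
    have lt: "\<kappa> e1 < m" "\<kappa> e2 < m" using L_lt[OF i(3), of e1] L_lt[OF i(3), of e2] by auto
    have "(\<Sum>k<m. base (0, s, \<kappa>(e1 := k)) * A k (\<kappa> e1)) = (\<Sum>k<m. if k = \<kappa> e2 then z k s * A k (\<kappa> e1) else 0)"
      by (intro sum.cong refl) (auto simp: base_0)
    then have 1: "(\<Sum>k<m. base (0, s, \<kappa>(e1 := k)) * A k (\<kappa> e1)) = z (\<kappa> e2) s * A (\<kappa> e2) (\<kappa> e1)"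
      using lt by simp
    have "(\<Sum>k<m. base (0, s, \<kappa>(e2 := k)) * B k (\<kappa> e2)) = (\<Sum>k<m. if k = \<kappa> e1 then z k s * B k (\<kappa> e2) else 0)"
      by (intro sum.cong refl) (auto simp: base_0)
    then have 2: "(\<Sum>k<m. base (0, s, \<kappa>(e2 := k)) * B k (\<kappa> e2)) = z (\<kappa> e1) s * B (\<kappa> e1) (\<kappa> e2)"
      using lt by simp
    have "v base i = z (\<kappa> e2) s * A (\<kappa> e2) (\<kappa> e1) + z (\<kappa> e1) s * B (\<kappa> e1) (\<kappa> e2)"
      using 1 2 by (simp add: v_def i(1) gauge_field_def)
    also have "\<dots> = y (0, s, c (\<kappa> e1) (\<kappa> e2))"
    proof -
      have "(of_nat (\<kappa> e1) - of_nat (\<kappa> e2) :: complex) \<noteq> 0" using i(4) by simp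
      then have "(of_nat (\<kappa> e1) - of_nat (\<kappa> e2)) * B (\<kappa> e1) (\<kappa> e2) =
          y (0, 1, c (\<kappa> e1) (\<kappa> e2)) - of_nat (\<kappa> e2) * y (0, 0, c (\<kappa> e1) (\<kappa> e2))"
        by (simp add: B_def)
      moreover have "s = 0 \<or> s = 1" using i(2) by auto
      ultimately show ?thesis by (auto simp: A_def z_def algebra_simps)
    qed
    also have "c (\<kappa> e1) (\<kappa> e2) = \<kappa>" unfolding c_def using L_0[OF i(3)] by simp
    finally show ?thesis by (simp add: i(1))
  qed
  moreover have "(\<lambda>x. v x i) \<in> poly_funs" for i
    unfolding v_def by (intro poly_funs.add gauge_field_poly)
  moreover have "((\<lambda>t. F K b (\<lambda>i. x i + t * v x i)) has_field_derivative 0) (at 0)" for x b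
  proof (rule F_deriv_0)
    have "dF K b x (gauge_field 0 1 m (\<lambda>_ _. A) x) = 0"
      by (rule state_diff_gauge[where B = "\<lambda>_. A"])
        (use d finite_K K_lt[of _ e1] K_upd[of _ e1] in auto)
    moreover have "dF K b x (gauge_field 0 2 m (\<lambda>_ _. B) x) = 0"
      by (rule state_diff_gauge[where B = "\<lambda>_. B"])
        (use d finite_K K_lt[of _ e2] K_upd[of _ e2] in auto)
    ultimately show "dF K b x (v x) = 0" unfolding v_def by (simp add: state_diff_add)
  qed
  ultimately show ?thesis by (intro exI[of _ v]) blast
qed

lemma TNS_diagonal: "TNS V E bond n = zariski closure_of (range (\<lambda>x b. F K2 b x))"
proof -
  have "TNS V E bond n = zariski closure_of (range (\<lambda>x b. F K b x))"
    unfolding K_def by (rule TNS_state_sum) (use finite_E edge_E in auto)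
  also have "\<dots> = zariski closure_of ((\<lambda>x b. F K b x) ` {x. \<forall>i\<in>off_diagonal. x i = base i})"
    by (rule closure_of_image_slice[symmetric, OF state_sum_poly pencil_fields])
  also have "(\<lambda>x b. F K b x) ` {x. \<forall>i\<in>off_diagonal. x i = base i} = range (\<lambda>x b. F K2 b x)"
  proof -
    have base: "base i = 0" if "i \<in> off_diagonal" for i
      using that by (auto simp: off_diagonal_def base_0)
    show ?thesis
    proof (intro equalityI subsetI)
      fix T assume "T \<in> (\<lambda>x b. F K b x) ` {x. \<forall>i\<in>off_diagonal. x i = base i}"
      then show "T \<in> range (\<lambda>x b. F K2 b x)" using F_diagonal base by auto
    next
      fix T assume "T \<in> range (\<lambda>x b. F K2 b x)"
      then obtain x where x: "T = (\<lambda>b. F K2 b x)" by blast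
      let ?x = "\<lambda>i. if i \<in> off_diagonal then 0 else x i"
      have "F K2 b x = F K2 b ?x" for b
        by (rule F_K2_cong) (auto simp: off_diagonal_def K2_def lc_apply)
      also have "F K2 b ?x = F K b ?x" for b by (rule F_diagonal[symmetric]) simp
      finally show "T \<in> (\<lambda>x b. F K b x) ` {x. \<forall>i\<in>off_diagonal. x i = base i}"
        using base x by (intro image_eqI[of _ _ ?x]) auto
    qed
  qed
  finally show ?thesis .
qed

subsection \<open>Gauge fixing\<close>

text \<open>The reference configuration of summand i, with all old bonds at 0.\<close>

definition zero_config :: "nat \<Rightarrow> nat set \<Rightarrow> nat" where
  "zero_config i = restrict (\<lambda>e. if e = e1 \<or> e = e2 then i else 0) E"

definition zero_local :: "nat \<Rightarrow> nat \<Rightarrow> nat set \<Rightarrow> nat" where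
  "zero_local j i = lc j (zero_config i)"

text \<open>The possible summands of the diagonal pencil on which a gauge matrix, or a scalar at a vertex, may
  depend.\<close>

definition "edge_labels e = (if e = {1, 2 :: nat} then {..<m} else {0})"
definition "vertex_labels j = (if j = 1 \<or> j = (2 :: nat) then {..<m} else {0})"

text \<open>The summand index as seen from \<open>j\<close>. Vertices other than 1 and 2 see none,
  and 0 stands in for it.\<close>

definition label :: "nat \<Rightarrow> (nat set \<Rightarrow> nat) \<Rightarrow> nat" where
  "label j \<kappa> = (if j = 1 then \<kappa> e1 else if j = 2 then \<kappa> e2 else 0)"

text \<open>The entry of the matrix at the source that the entry (a, b) of the gauge matrix on
  \<open>e\<close> in summand i moves at the base point, all other old bonds being at 0.\<close>

definition edge_coord :: "nat set \<times> nat \<times> nat \<times> nat \<Rightarrow> nat \<times> nat \<times> (nat set \<Rightarrow> nat)" where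
  "edge_coord = (\<lambda>(e, i, a, b). (source e, \<beta> (source e) ((zero_local (source e) i)(e := a)),
     (zero_local (source e) i)(e := b)))"

definition vertex_coord :: "nat \<times> nat \<Rightarrow> nat \<times> nat \<times> (nat set \<Rightarrow> nat)" where
  "vertex_coord = (\<lambda>(j, i). (j, \<beta> j (zero_local j i), zero_local j i))"

text \<open>The pair (0, 0) is left out because its entry coincides with the one in
  \<open>vertex_coord\<close>; so an edge fixes m_e^2 - 1 entries per summand, and scalars are fixed
  at the vertices.\<close>

definition "edge_params = (SIGMA e:E'. edge_labels e \<times> ({..<bond e} \<times> {..<bond e} - {(0, 0)}))"
definition "vertex_params = (SIGMA j:{1..d}. vertex_labels j)"

text \<open>The gauge group acts on the tuples of matrices; to first order at \<open>base\<close>, prescribing the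
  entries in \<open>fixed\<close> is a slice for this action. Along the edge \<open>{1, 2}\<close> the gauge
  matrix may depend on the summand of the diagonal pencil.\<close>

definition "fixed = edge_coord ` edge_params \<union> vertex_coord ` vertex_params"

lemma zero_config_K2: "i < m \<Longrightarrow> zero_config i \<in> K2"
  using bond_pos by (auto simp: K2_def K_def zero_config_def)

lemma zero_local_L: "i < m \<Longrightarrow> zero_local j i \<in> L j"
  unfolding zero_local_def by (intro lc_in_L K2_K zero_config_K2)

lemma zero_local_E': "e \<in> E' \<Longrightarrow> j \<in> e \<Longrightarrow> zero_local j i e = 0"
  using E'_ne[of e] by (auto simp: zero_local_def lc_apply zero_config_def)

lemma zero_local_e1: "zero_local (Suc 0) i {0, Suc 0} = i" "zero_local 1 i e1 = i"
  by (auto simp: zero_local_def lc_apply zero_config_def)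

lemma zero_local_e2: "zero_local 2 i e2 = i"
  by (auto simp: zero_local_def lc_apply zero_config_def)

lemma label_zero_local: "label j (zero_local j i) = (if j = 1 \<or> j = 2 then i else 0)"
  by (simp add: label_def zero_local_e1 zero_local_e2)

lemma label_upd: "e \<in> E' \<Longrightarrow> label j (\<kappa>(e := c)) = label j \<kappa>"
  using E'_ne[of e] by (auto simp: label_def)

lemma label_lc: "k \<in> K2 \<Longrightarrow> label j (lc j k) = (if j = 1 \<or> j = 2 then k e1 else 0)"
  by (auto simp: label_def lc_apply K2_eq)

lemma edge_labels_lt: "i \<in> edge_labels e \<Longrightarrow> i < m"
  using m by (auto simp: edge_labels_def split: if_splits)

lemma vertex_labels_lt: "i \<in> vertex_labels j \<Longrightarrow> i < m"
  using m by (auto simp: vertex_labels_def split: if_splits)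

lemma source_in: "e \<in> E' \<Longrightarrow> source e \<in> e \<and> source e \<in> {1..d}"
  using source_target[of e] by auto

lemma target_in: "e \<in> E' \<Longrightarrow> target e \<in> e \<and> target e \<in> {1..d}"
  using source_target[of e] by auto

lemma source_12: "source {1, 2} = 1" "target {1, 2} = 2"
  by (auto simp: source_def target_def)

text \<open>The base matrices are identities up to the identification \<open>\<beta>\<close>, so
  each sum over the new bond value c has at most the term c = \<open>h e\<close>.\<close>

lemma gauge_field_base:
  assumes e: "e \<in> E'" and w: "w \<in> {1..d}" and h: "h \<in> L w" and \<kappa>: "\<kappa> \<in> L w"
  shows "gauge_field (source e) (target e) (bond e) A base (w, \<beta> w h, \<kappa>) =
    (if w = source e \<and> (\<forall>e'. e' \<noteq> e \<longrightarrow> h e' = \<kappa> e') then A w \<kappa> (h e) (\<kappa> e)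
     else if w = target e \<and> (\<forall>e'. e' \<noteq> e \<longrightarrow> h e' = \<kappa> e') then - A w \<kappa> (\<kappa> e) (h e) else 0)"
proof -
  have st: "{source e, target e} = e" "source e \<noteq> target e" using source_target[OF e] by auto
  have sum: "(\<Sum>c<bond e. base (w, \<beta> w h, \<kappa>(e := c)) * g c) =
    (if \<forall>e'. e' \<noteq> e \<longrightarrow> h e' = \<kappa> e' then g (h e) else 0)" if "w \<in> e" for g
  proof -
    have "base (w, \<beta> w h, \<kappa>(e := c)) * g c =
      (if c = h e then if \<forall>e'. e' \<noteq> e \<longrightarrow> h e' = \<kappa> e' then g (h e) else 0 else 0)" if c: "c < bond e" for c
    proof -
      have "\<kappa>(e := c) \<in> L w" using L_upd[OF \<kappa> _ \<open>w \<in> e\<close> c] e by simp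
      then have "base (w, \<beta> w h, \<kappa>(e := c)) = of_bool (h = \<kappa>(e := c))"
        using w h by (simp add: base_pos \<beta>_eq del: fun_upd_apply)
      moreover have "h = \<kappa>(e := c) \<longleftrightarrow> c = h e \<and> (\<forall>e'. e' \<noteq> e \<longrightarrow> h e' = \<kappa> e')"
        by (auto simp: fun_eq_iff)
      ultimately show ?thesis by auto
    qed
    then have "(\<Sum>c<bond e. base (w, \<beta> w h, \<kappa>(e := c)) * g c) =
      (\<Sum>c<bond e. if c = h e then if \<forall>e'. e' \<noteq> e \<longrightarrow> h e' = \<kappa> e' then g (h e) else 0 else 0)"
      by (intro sum.cong) auto
    also have "\<dots> = (if \<forall>e'. e' \<noteq> e \<longrightarrow> h e' = \<kappa> e' then g (h e) else 0)"
      using L_lt[OF h _ that] e by simp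
    finally show ?thesis .
  qed
  show ?thesis
  proof (cases "w = source e \<or> w = target e")
    case True
    then have "w \<in> e" using st(1) by auto
    show ?thesis
    proof (cases "w = source e")
      case T: True
      then show ?thesis
        using sum[OF \<open>w \<in> e\<close>, of "\<lambda>c. A w \<kappa> c (\<kappa> e)"] st by (auto simp add: gauge_field_def simp del: fun_upd_apply)
    next
      case F: False
      then have "w = target e" using True by simp
      then show ?thesis
        using sum[OF \<open>w \<in> e\<close>, of "\<lambda>c. A w \<kappa> (\<kappa> e) c"] st F by (auto simp add: gauge_field_def simp del: fun_upd_apply)
    qed
  qed (auto simp: gauge_field_def)
qed

lemma gauge_fields:
  "\<exists>v. (\<forall>i\<in>fixed. v base i = y i) \<and> (\<forall>i. (\<lambda>x. v x i) \<in> poly_funs) \<and>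
    (\<forall>x b. ((\<lambda>t. F K2 b (\<lambda>i. x i + t * v x i)) has_field_derivative 0) (at 0))"
proof -
  define t where "t j i = y (vertex_coord (j, i))" for j i
  \<comment> \<open>Prescribed scalings at the vertices 1, ..., d; vertex 0, which knows the
    summand, compensates so that the weights of each configuration add up to 0.\<close>
  define \<tau> where "\<tau> w \<kappa> = (if w = 0 then - (\<Sum>j\<in>{1..d}. t j (if j = 1 \<or> j = 2 then \<kappa> e1 else 0))
    else t w (label w \<kappa>))" for w \<kappa>
  define l where "l e w \<kappa> = (if e = {1, 2} then label w \<kappa> else 0)" for e :: "nat set" and w \<kappa>
  \<comment> \<open>Read off from the prescribed edge entry, minus what the scaling at the source
    already contributes on the diagonal. The entry (0, 0) is 0, so that edges do not disturb the
    vertex coordinates.\<close>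
  define A where "A e w \<kappa> a b = (if a = 0 \<and> b = 0 then 0 else y (edge_coord (e, l e w \<kappa>, a, b)) -
    of_bool (a = b) * t (source e) (l e w \<kappa>))" for e w \<kappa> and a b :: nat
  define v :: "(nat \<times> nat \<times> (nat set \<Rightarrow> nat) \<Rightarrow> complex) \<Rightarrow> nat \<times> nat \<times> (nat set \<Rightarrow> nat) \<Rightarrow> complex"
    where "v x i = (\<Sum>e\<in>E'. gauge_field (source e) (target e) (bond e) (A e) x i) +
    (case i of (w, r, \<kappa>) \<Rightarrow> \<tau> w \<kappa> * x (w, r, \<kappa>))" for x i
  have A_00: "A e w \<kappa> 0 0 = 0" for e w \<kappa> by (simp add: A_def)
  have "v base i = y i" if "i \<in> fixed" for i
    using that unfolding fixed_def
  proof
    assume "i \<in> vertex_coord ` vertex_params"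
    then obtain j c where jc: "j \<in> {1..d}" "c \<in> vertex_labels j" "i = vertex_coord (j, c)"
      by (auto simp: vertex_params_def)
    have L: "zero_local j c \<in> L j" by (rule zero_local_L[OF vertex_labels_lt[OF jc(2)]])
    have "gauge_field (source e) (target e) (bond e) (A e) base i = 0" if e: "e \<in> E'" for e
      using gauge_field_base[OF e jc(1) L L, of "A e"] zero_local_E'[OF e, of j c] source_in[OF e] target_in[OF e]
      by (auto simp: jc(3) vertex_coord_def A_00)
    moreover have "label j (zero_local j c) = c" using jc(2) by (auto simp: label_zero_local vertex_labels_def)
    ultimately show ?thesis using jc(1) by (simp add: v_def jc(3) vertex_coord_def base_pos \<tau>_def t_def)
  next
    assume "i \<in> edge_coord ` edge_params"
    then obtain q where q: "q \<in> edge_params" "i = edge_coord q" by blast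
    obtain e0 c a b where "q = (e0, c, a, b)" by (cases q) auto
    with q have par: "e0 \<in> E'" "c \<in> edge_labels e0" "a < bond e0" "b < bond e0"
      "(a, b) \<noteq> (0, 0)" "i = edge_coord (e0, c, a, b)" by (auto simp: edge_params_def)
    define w where "w = source e0"
    define h where "h = (zero_local w c)(e0 := a)"
    define \<kappa> where "\<kappa> = (zero_local w c)(e0 := b)"
    have w: "w \<in> {1..d}" "w \<in> e0" using source_in[OF par(1)] by (auto simp: w_def)
    have L: "zero_local w c \<in> L w" by (rule zero_local_L[OF edge_labels_lt[OF par(2)]])
    have hL: "h \<in> L w" "\<kappa> \<in> L w" using L_upd[OF L _ w(2)] par by (auto simp: h_def \<kappa>_def simp del: fun_upd_apply)
    have i: "i = (w, \<beta> w h, \<kappa>)" by (simp add: par(6) edge_coord_def w_def h_def \<kappa>_def del: fun_upd_apply)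
    have off: "\<forall>e'. e' \<noteq> e0 \<longrightarrow> h e' = \<kappa> e'" by (simp add: h_def \<kappa>_def)
    have he: "h e0 = a" "\<kappa> e0 = b" by (simp_all add: h_def \<kappa>_def)
    have lab: "label w \<kappa> = c" unfolding \<kappa>_def label_upd[OF par(1)] label_zero_local
    proof (cases "w = 1 \<or> w = 2")
      case False
      then have "e0 \<noteq> {1, 2}" using source_12 by (auto simp: w_def)
      then show "(if w = 1 \<or> w = 2 then c else 0) = c" using par(2) by (simp add: edge_labels_def)
    qed simp
    then have lab': "l e0 w \<kappa> = c" using par(2) by (auto simp: l_def edge_labels_def split: if_splits)
    \<comment> \<open>A different edge contributes nothing: for a = b its value is 0 in row and
      column, where its matrix has entry 0, and for a different from b the row and column already
      disagree at \<open>e0\<close>.\<close>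
    have "gauge_field (source e) (target e) (bond e) (A e) base i = 0" if e: "e \<in> E'" "e \<noteq> e0" for e
    proof (cases "a = b")
      case True
      then have "h = \<kappa>" by (simp add: h_def \<kappa>_def)
      have "\<kappa> e = 0" if "w \<in> e" using zero_local_E'[OF e(1) that] e(2) by (simp add: \<kappa>_def)
      then show ?thesis
        using gauge_field_base[OF e(1) w(1) hL, of "A e"] source_in[OF e(1)] target_in[OF e(1)] \<open>h = \<kappa>\<close>
        by (auto simp: i A_00)
    next
      case False
      then have "h e0 \<noteq> \<kappa> e0" by (simp add: he)
      then have "\<not> (\<forall>e'. e' \<noteq> e \<longrightarrow> h e' = \<kappa> e')" using e(2) by blast
      then show ?thesis unfolding i gauge_field_base[OF e(1) w(1) hL] by (simp only: simp_thms if_False)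
    qed
    then have "(\<Sum>e\<in>E'. gauge_field (source e) (target e) (bond e) (A e) base i) =
      gauge_field (source e0) (target e0) (bond e0) (A e0) base i"
      by (subst sum.remove[OF finite_E' par(1)]) (auto intro!: sum.neutral)
    also have "\<dots> = A e0 w \<kappa> a b"
      unfolding i gauge_field_base[OF par(1) w(1) hL] using off he by (simp add: w_def)
    finally have "v base i = A e0 w \<kappa> a b + \<tau> w \<kappa> * of_bool (\<beta> w h = \<beta> w \<kappa>)"
      using w(1) by (simp add: v_def i base_pos)
    moreover have "\<beta> w h = \<beta> w \<kappa> \<longleftrightarrow> a = b"
      using \<beta>_eq[OF w(1) hL] he off by (auto simp: fun_eq_iff)
    moreover have "\<tau> w \<kappa> = t w c" using w(1) lab by (simp add: \<tau>_def)
    ultimately show ?thesis using par(5) lab' by (auto simp: A_def w_def par(6))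
  qed
  moreover have "(\<lambda>x. v x i) \<in> poly_funs" for i
    unfolding v_def
    by (cases i) (auto intro!: poly_funs.add poly_funs_sum gauge_field_poly poly_funs.mult poly_funs.const poly_funs.coord)
  moreover have "((\<lambda>t. F K2 b (\<lambda>i. x i + t * v x i)) has_field_derivative 0) (at 0)" for x b
  proof (rule F_deriv_0)
    have "dF K2 b x (gauge_field (source e) (target e) (bond e) (A e) x) = 0" if e: "e \<in> E'" for e
    proof (rule state_diff_gauge[where B = "\<lambda>k a b. A e (source e) (lc (source e) k) a b"])
      have st: "{source e, target e} = e" using source_target[OF e] by auto
      show "{source e, target e} \<in> E" using e st by simp
      show "source e \<noteq> target e" using source_target[OF e] by auto
      show "k {source e, target e} < bond e" if "k \<in> K2" for k
        using K_lt[OF K2_K[OF that]] e st by simp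
      show "k({source e, target e} := c) \<in> K2" if "k \<in> K2" "c < bond e" for k c
        using K2_upd[OF that(1) e that(2)] st by simp
      show "source e \<in> V" "target e \<in> V" using source_target[OF e] by auto
      have l: "l e w (lc w k) = (if e = {1, 2} then k e1 else 0)" if "k \<in> K2" "w \<in> e" for w k
        using that by (auto simp: l_def label_lc)
      show "A e (target e) (lc (target e) k) = (\<lambda>a b. A e (source e) (lc (source e) k) a b)" if "k \<in> K2" for k
        using l[OF that] source_in[OF e] target_in[OF e] by (simp add: A_def fun_eq_iff)
      show "(\<lambda>a b. A e (source e) (lc (source e) (k({source e, target e} := c))) a b) =
        (\<lambda>a b. A e (source e) (lc (source e) k) a b)" if "k \<in> K2" "c < bond e" for k c
      proof -
        have "(k(e := c)) e1 = k e1" using E'_ne(1)[OF e] by auto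
        then have "l e (source e) (lc (source e) (k(e := c))) = l e (source e) (lc (source e) k)"
          using source_in[OF e] by (simp only: l[OF that(1)] l[OF K2_upd[OF that(1) e that(2)]])
        then show ?thesis unfolding A_def st by (simp only:)
      qed
    qed (use finite_K2 in auto)
    moreover have "dF K2 b x (\<lambda>(w, r, \<kappa>). \<tau> w \<kappa> * x (w, r, \<kappa>)) = 0"
    proof (rule state_diff_scaling)
      fix k assume k: "k \<in> K2"
      have "(\<Sum>w\<in>V. \<tau> w (lc w k)) = \<tau> 0 (lc 0 k) + (\<Sum>w\<in>{1..d}. \<tau> w (lc w k))"
        by (subst sum.atLeast_Suc_atMost) auto
      also have "(\<Sum>w\<in>{1..d}. \<tau> w (lc w k)) = (\<Sum>j\<in>{1..d}. t j (if j = 1 \<or> j = 2 then k e1 else 0))"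
        by (intro sum.cong refl) (auto simp: \<tau>_def label_lc[OF k])
      also have "\<tau> 0 (lc 0 k) = - \<dots>"
      proof -
        have "lc 0 k e1 = k e1" by (simp add: lc_apply)
        then show ?thesis by (simp only: \<tau>_def refl if_True)
      qed
      finally show "(\<Sum>w\<in>V. \<tau> w (lc w k)) = 0" by simp
    qed simp
    ultimately show "dF K2 b x (v x) = 0"
      unfolding v_def by (simp add: state_diff_add state_diff_sum split_def)
  qed
  ultimately show ?thesis by (intro exI[of _ v]) blast
qed

subsection \<open>Independence of the remaining tangent directions\<close>

text \<open>At the tensor index given by local configurations \<open>H\<close>, only those vertices contribute to the
  derivative at \<open>base\<close> that are incident to all the edges on which \<open>H\<close> is inconsistent. The kernel is
  determined by choosing \<open>H\<close> inconsistent on two edges, on one edge or on none.\<close>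

definition test_index :: "(nat \<Rightarrow> nat set \<Rightarrow> nat) \<Rightarrow> nat \<Rightarrow> nat \<Rightarrow> nat" where
  "test_index H s = (\<lambda>v\<in>V. if v = 0 then s else \<beta> v (H v))"

text \<open>The configurations for which all other factors at the vertices 1, ..., d are 1 when the
  factor at \<open>v\<close> is differentiated. For v = 0 no vertex is exempt.\<close>

definition matching :: "nat \<Rightarrow> (nat \<Rightarrow> nat set \<Rightarrow> nat) \<Rightarrow> (nat set \<Rightarrow> nat) set" where
  "matching v H = {k \<in> K2. \<forall>w\<in>{1..d} - {v}. lc w k = H w}"

lemma prod_of_bool:
  "finite A \<Longrightarrow> (\<Prod>u\<in>A. of_bool (P u)) = (of_bool (\<forall>u\<in>A. P u) :: complex)"
  by (induction A rule: finite_induct) auto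

text \<open>At \<open>base\<close> the factor of a vertex other than 0 is the indicator that the
  configuration restricts to \<open>H\<close>, so the product rule leaves sums over matching
  configurations, with a diagonal pencil entry \<open>z\<close> unless vertex 0 itself is
  differentiated.\<close>

lemma diff_base:
  assumes H: "\<And>w. w \<in> {1..d} \<Longrightarrow> H w \<in> L w" and s: "s < 2"
  shows "dF K2 (test_index H s) base \<xi> = (\<Sum>k\<in>matching 0 H. \<xi> (0, s, lc 0 k)) +
    (\<Sum>v\<in>{1..d}. \<Sum>k\<in>matching v H. \<xi> (v, \<beta> v (H v), lc v k) * z (k e1) s)"
proof -
  let ?b = "test_index H s"
  have b: "?b \<in> Pi\<^sub>E V (phys_indices n)"
  proof (rule PiE_I)
    fix v assume v: "v \<in> V"
    show "?b v \<in> phys_indices n v"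
    proof (cases "v = 0")
      case True
      then show ?thesis using s n_0 by (simp add: test_index_def phys_indices_def)
    next
      case False
      then show ?thesis using v H \<beta>_lt[of v "H v"] by (simp add: test_index_def phys_indices_def)
    qed
  qed (simp add: test_index_def)
  have V: "V = insert 0 {1..d}" by auto
  have b0: "?b 0 = s" by (simp add: test_index_def)
  have bv: "?b v = \<beta> v (H v)" if "v \<in> {1..d}" for v using that by (simp add: test_index_def)
  have delta: "(\<Prod>u\<in>{1..d} - {v}. base (u, ?b u, lc u k)) = of_bool (k \<in> matching v H)" if k: "k \<in> K2" for v k
  proof -
    have "(\<Prod>u\<in>{1..d} - {v}. base (u, ?b u, lc u k)) = (\<Prod>u\<in>{1..d} - {v}. of_bool (lc u k = H u))"
    proof (intro prod.cong refl)
      fix u assume u: "u \<in> {1..d} - {v}"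
      then show "base (u, ?b u, lc u k) = of_bool (lc u k = H u)"
        using \<beta>_eq[of u "H u" "lc u k"] H lc_in_L[OF K2_K[OF k], of u] bv[of u]
        by (auto simp: base_pos)
    qed
    also have "\<dots> = of_bool (k \<in> matching v H)" using k by (simp add: prod_of_bool matching_def)
    finally show ?thesis .
  qed
  have restrict: "(\<Sum>k\<in>K2. g k * of_bool (k \<in> matching v H)) = (\<Sum>k\<in>matching v H. g k)" for g :: "_ \<Rightarrow> complex" and v
    by (rule sum.mono_neutral_cong_right) (use finite_K2 in \<open>auto simp: matching_def\<close>)
  have "dF K2 ?b base \<xi> = (\<Sum>v\<in>V. \<Sum>k\<in>K2. \<xi> (v, ?b v, lc v k) * (\<Prod>u\<in>V - {v}. base (u, ?b u, lc u k)))"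
    using b by (simp add: state_diff_def sum.swap[of _ K2])
  also have "\<dots> = (\<Sum>k\<in>K2. \<xi> (0, s, lc 0 k) * (\<Prod>u\<in>V - {0}. base (u, ?b u, lc u k))) +
    (\<Sum>v\<in>{1..d}. \<Sum>k\<in>K2. \<xi> (v, ?b v, lc v k) * (\<Prod>u\<in>V - {v}. base (u, ?b u, lc u k)))"
    unfolding V by (subst sum.insert) (use b0 in auto)
  also have "V - {0} = {1..d} - {0}" by auto
  also have "(\<Sum>k\<in>K2. \<xi> (0, s, lc 0 k) * (\<Prod>u\<in>{1..d} - {0}. base (u, ?b u, lc u k))) = (\<Sum>k\<in>matching 0 H. \<xi> (0, s, lc 0 k))"
    unfolding restrict[symmetric] by (intro sum.cong refl) (simp only: delta)
  also have "(\<Sum>v\<in>{1..d}. \<Sum>k\<in>K2. \<xi> (v, ?b v, lc v k) * (\<Prod>u\<in>V - {v}. base (u, ?b u, lc u k))) =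
    (\<Sum>v\<in>{1..d}. \<Sum>k\<in>matching v H. \<xi> (v, \<beta> v (H v), lc v k) * z (k e1) s)"
  proof (rule sum.cong[OF refl])
    fix v assume v: "v \<in> {1..d}"
    have "(\<Prod>u\<in>V - {v}. base (u, ?b u, lc u k)) = z (k e1) s * of_bool (k \<in> matching v H)" if k: "k \<in> K2" for k
    proof -
      have "V - {v} = insert 0 ({1..d} - {v})" using v by auto
      then have "(\<Prod>u\<in>V - {v}. base (u, ?b u, lc u k)) = base (0, s, lc 0 k) * (\<Prod>u\<in>{1..d} - {v}. base (u, ?b u, lc u k))"
        using b0 by simp
      moreover have "base (0, s, lc 0 k) = z (k e1) s"
        using K2_eq[OF k] by (simp add: base_0 lc_apply)
      ultimately show ?thesis by (simp only: delta[OF k])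
    qed
    then show "(\<Sum>k\<in>K2. \<xi> (v, ?b v, lc v k) * (\<Prod>u\<in>V - {v}. base (u, ?b u, lc u k))) =
      (\<Sum>k\<in>matching v H. \<xi> (v, \<beta> v (H v), lc v k) * z (k e1) s)"
      unfolding restrict[symmetric] bv[OF v] by (intro sum.cong refl) (simp add: mult.assoc)
  qed
  finally show ?thesis .
qed

lemma K2_eqI:
  assumes "k \<in> K2" "k' \<in> K2" "\<And>e. e \<in> E' \<Longrightarrow> k e = k' e" "k e1 = k' e1"
  shows "k = k'"
proof (rule PiE_ext)
  show "k \<in> Pi\<^sub>E E (\<lambda>e. {..<bond e})" "k' \<in> Pi\<^sub>E E (\<lambda>e. {..<bond e})"
    using assms(1,2) by (simp_all add: K2_def K_def)
  show "k e = k' e" if "e \<in> E" for e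
    using that by (rule E_cases) (use assms K2_eq[of k] K2_eq[of k'] in auto)
qed

lemma lc_eq_apply: "lc w k = lc w k' \<Longrightarrow> e \<in> E \<Longrightarrow> w \<in> e \<Longrightarrow> k e = k' e"
  by (metis lc_apply)

lemma other_end:
  assumes "e \<in> E'" "u \<in> e"
  obtains w where "e = {u, w}" "u \<noteq> w" "w \<in> {1..d}" "u \<in> {1..d}"
proof -
  have "e = {source e, target e}" "source e \<noteq> target e" using source_target[OF assms(1)] by auto
  moreover have "u = source e \<or> u = target e" using assms(2) calculation(1) by blast
  ultimately show ?thesis
    using that[of "source e"] that[of "target e"] source_in[OF assms(1)] target_in[OF assms(1)]
    by (metis insert_commute)
qed

text \<open>Leaving out one vertex loses no information: every old edge has another end, and the
  summand index is still seen at 1 or at 2.\<close>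

lemma matching_self:
  assumes "u \<in> {1..d}" "k \<in> K2" "\<And>w. w \<in> {1..d} \<Longrightarrow> w \<noteq> u \<Longrightarrow> H w = lc w k"
  shows "matching u H = {k}"
proof (intro equalityI subsetI)
  fix k' assume "k' \<in> matching u H"
  then have k': "k' \<in> K2" "\<And>w. w \<in> {1..d} \<Longrightarrow> w \<noteq> u \<Longrightarrow> lc w k' = lc w k"
    using assms(3) by (auto simp: matching_def)
  have "k' = k"
  proof (rule K2_eqI[OF k'(1) assms(2)])
    fix e assume e: "e \<in> E'"
    obtain w where "w \<in> e" "w \<noteq> u" "w \<in> {1..d}"
      using source_in[OF e] target_in[OF e] source_target(2)[OF e] by (metis less_irrefl)
    then show "k' e = k e" using lc_eq_apply[OF k'(2)] e by simp
  next
    show "k' e1 = k e1"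
    proof (cases "u = 1")
      case True
      then have "lc 2 k' = lc 2 k" using d by (intro k'(2)) auto
      then have "k' e2 = k e2" by (rule lc_eq_apply) auto
      then show ?thesis using K2_eq[OF k'(1)] K2_eq[OF assms(2)] by simp
    next
      case False
      then have "lc 1 k' = lc 1 k" using d by (intro k'(2)) auto
      then show ?thesis by (rule lc_eq_apply) auto
    qed
  qed
  then show "k' \<in> {k}" by simp
qed (use assms in \<open>auto simp: matching_def\<close>)

text \<open>When \<open>v\<close> is not on \<open>e\<close>, both ends of \<open>e\<close> are
  tested. Read contrapositively, a mismatch on \<open>e\<close> leaves only the ends of
  \<open>e\<close> as contributing vertices.\<close>

lemma matching_edge:
  assumes "e \<in> E'" "u \<in> e" "v \<notin> e" "k' \<in> matching v H"
    and "\<And>w. w \<in> {1..d} \<Longrightarrow> w \<noteq> u \<Longrightarrow> H w = lc w k"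
  shows "H u e = k e"
proof -
  obtain w where w: "e = {u, w}" "u \<noteq> w" "w \<in> {1..d}" "u \<in> {1..d}" by (rule other_end[OF assms(1,2)])
  have "lc u k' = H u" "lc w k' = lc w k" using assms w by (auto simp: matching_def)
  moreover have "lc u k' e = k' e" "lc w k' e = k' e" "lc w k e = k e"
    using assms(1) w(1) by (simp_all add: lc_apply)
  ultimately show ?thesis by metis
qed

text \<open>The summand index is compared between the vertices 1 and 2 as if along an edge;
  \<open>3 - u\<close> is the other one of the two.\<close>

lemma matching_label:
  assumes "u = 1 \<or> u = 2" "v \<noteq> 1" "v \<noteq> 2" "k \<in> K2" "k' \<in> matching v H"
    and "\<And>w. w \<in> {1..d} \<Longrightarrow> w \<noteq> u \<Longrightarrow> H w = lc w k"
  shows "label u (H u) = k e1"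
proof -
  have k': "k' \<in> K2" "lc u k' = H u" using assms d by (auto simp: matching_def)
  have "label u (H u) = k' e1" using label_lc[OF k'(1), of u] assms(1) k'(2) by auto
  moreover have "lc (3 - u) k' = lc (3 - u) k" using assms d by (auto simp: matching_def)
  then have "k' e1 = k e1" using label_lc[OF k'(1), of "3 - u"] label_lc[OF assms(4), of "3 - u"] assms(1) by auto
  ultimately show ?thesis by simp
qed

text \<open>Extends \<open>\<kappa>\<close> from \<open>u\<close> to a global configuration with
  consistent summand index that is 0 on all old edges away from \<open>u\<close>. At any other
  vertex only the edge shared with \<open>u\<close> can then be nonzero among the old ones.\<close>

definition extension :: "nat \<Rightarrow> (nat set \<Rightarrow> nat) \<Rightarrow> nat set \<Rightarrow> nat" where
  "extension u \<kappa> = restrict (\<lambda>e. if u \<in> e then \<kappa> e else if e = e1 \<or> e = e2 then label u \<kappa> else 0) E"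

lemma label_lt: "u \<in> {1..d} \<Longrightarrow> \<kappa> \<in> L u \<Longrightarrow> label u \<kappa> < m"
  using L_lt[of \<kappa> u e1] L_lt[of \<kappa> u e2] m by (auto simp: label_def)

lemma extension_e12:
  assumes "u \<in> {1..d}"
  shows "extension u \<kappa> e1 = label u \<kappa>" "extension u \<kappa> e2 = label u \<kappa>"
  using assms by (auto simp: extension_def label_def)

lemma extension_K2: "u \<in> {1..d} \<Longrightarrow> \<kappa> \<in> L u \<Longrightarrow> extension u \<kappa> \<in> K2"
  using extension_e12[of u \<kappa>] label_lt[of u \<kappa>] L_lt[of \<kappa> u] bond_pos
  by (auto simp: K2_def K_def extension_def)

lemma lc_extension_self: "u \<in> {1..d} \<Longrightarrow> \<kappa> \<in> L u \<Longrightarrow> lc u (extension u \<kappa>) = \<kappa>"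
  by (rule L_ext[of _ u]) (auto intro!: lc_in_L K2_K extension_K2 simp: lc_apply, simp add: extension_def)

lemma lc_extension_other:
  assumes "u \<in> {1..d}" "w \<in> {1..d}" "w \<noteq> u"
  shows "lc w (extension u \<kappa>) = (if {u, w} \<in> E' then (zero_local w (label u \<kappa>))({u, w} := \<kappa> {u, w})
    else zero_local w (label u \<kappa>))"
proof
  fix e
  have e: "e = {u, w} \<and> e \<in> E'" if "e \<in> E" "u \<in> e" "w \<in> e"
    using that(1)
  proof (rule E_cases)
    assume "e \<in> E'"
    then show ?thesis using other_end[OF _ that(2)] that(3) assms(3) by (metis insertE singletonD)
  qed (use that assms in auto)
  show "lc w (extension u \<kappa>) e = (if {u, w} \<in> E' then (zero_local w (label u \<kappa>))({u, w} := \<kappa> {u, w})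
    else zero_local w (label u \<kappa>)) e"
  proof (cases "e \<in> E \<and> w \<in> e")
    case True
    then show ?thesis
    proof (cases "u \<in> e")
      case T: True
      then show ?thesis using e True by (auto simp: lc_apply extension_def)
    next
      case F: False
      then have "e \<noteq> {u, w}" by auto
      then show ?thesis using F True by (auto simp: lc_apply extension_def zero_local_def zero_config_def)
    qed
  next
    case False
    then show ?thesis using E_simps(4) by (auto simp: lc_apply zero_local_def)
  qed
qed

lemma zero_local_indep: "j \<noteq> 1 \<Longrightarrow> j \<noteq> 2 \<Longrightarrow> j \<in> {1..d} \<Longrightarrow> zero_local j i = zero_local j 0"
  by (auto simp: zero_local_def lc_apply zero_config_def fun_eq_iff)

lemma lc_zero_config_upd: "e \<in> E' \<Longrightarrow> lc w ((zero_config i)(e := a)) = (if w \<in> e then (zero_local w i)(e := a) else zero_local w i)"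
  by (simp add: lc_upd zero_local_def)

section \<open>Vanishing of a kernel vector that is zero on the fixed coordinates\<close>

context
  fixes \<xi> :: "nat \<times> nat \<times> (nat set \<Rightarrow> nat) \<Rightarrow> complex"
  assumes kernel: "\<And>b. dF K2 b base \<xi> = 0" and fixed_0: "\<And>i. i \<in> fixed \<Longrightarrow> \<xi> i = 0"
begin

abbreviation "X u h \<kappa> \<equiv> \<xi> (u, \<beta> u h, \<kappa>)"

text \<open>The index \<open>H\<close> has conflicting summands at 1 and 2, so only these two
  vertices can contribute, with factors \<open>z (k e1)\<close> and \<open>z (label u h)\<close>.
  These are independent vectors in C^2, so the equations for s = 0 and s = 1 make both contributions
  vanish.\<close>

lemma X_label:
  assumes u: "u = 1 \<or> u = 2" and k: "k \<in> K2" and h: "h \<in> L u" "label u h \<noteq> k e1"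
  shows "X u h (lc u k) = 0"
proof -
  define H where "H w = (if w = u then h else lc w k)" for w
  have H: "H w \<in> L w" for w using h(1) lc_in_L[OF K2_K[OF k]] by (simp add: H_def)
  have Hw: "H w = lc w k" if "w \<noteq> u" for w using that by (simp add: H_def)
  have Hu: "H u = h" by (simp add: H_def)
  have empty: "matching v H = {}" if "v \<noteq> 1" "v \<noteq> 2" for v
    using matching_label[OF u that k _ Hw] h(2) by (auto simp: Hu)
  define u' where "u' = 3 - u"
  have u': "u' \<in> {1..d}" "u \<in> {1..d}" "u \<noteq> u'" "{1, 2} = {u, u'}" using u d by (auto simp: u'_def)
  have self: "matching u H = {k}" by (rule matching_self[OF u'(2) k]) (rule Hw)
  define C where "C = (\<Sum>k'\<in>matching u' H. \<xi> (u', \<beta> u' (H u'), lc u' k'))"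
  have "X u h (lc u k) * z (k e1) s + C * z (label u h) s = 0" if s: "s < 2" for s
  proof -
    have k': "k' e1 = label u h" if "k' \<in> matching u' H" for k'
    proof -
      have "k' \<in> K2" "lc u k' = h" using that u' by (auto simp: matching_def H_def)
      then show ?thesis using label_lc[of k' u] u by auto
    qed
    have "(\<Sum>v\<in>{1..d}. \<Sum>k'\<in>matching v H. \<xi> (v, \<beta> v (H v), lc v k') * z (k' e1) s) =
      (\<Sum>v\<in>{u, u'}. \<Sum>k'\<in>matching v H. \<xi> (v, \<beta> v (H v), lc v k') * z (k' e1) s)"
    proof (rule sum.mono_neutral_right)
      show "\<forall>v\<in>{1..d} - {u, u'}. (\<Sum>k'\<in>matching v H. \<xi> (v, \<beta> v (H v), lc v k') * z (k' e1) s) = 0"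
      proof
        fix v assume "v \<in> {1..d} - {u, u'}"
        then have "v \<noteq> 1" "v \<noteq> 2" using u'(4) by auto
        then show "(\<Sum>k'\<in>matching v H. \<xi> (v, \<beta> v (H v), lc v k') * z (k' e1) s) = 0" by (simp add: empty)
      qed
    qed (use u' in auto)
    also have "\<dots> = X u h (lc u k) * z (k e1) s + C * z (label u h) s"
      using u'(3) k' by (simp add: self H_def[of u] C_def sum_distrib_right)
    finally show ?thesis
      using diff_base[OF H s, of \<xi>] kernel[of "test_index H s"] empty[of 0] by simp
  qed
  from this[of 0] this[of 1] have "X u h (lc u k) + C = 0"
    "X u h (lc u k) * of_nat (k e1) + C * of_nat (label u h) = 0" by (simp_all add: z_def)
  then have "X u h (lc u k) * (of_nat (k e1) - of_nat (label u h)) = 0"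
    by (simp add: algebra_simps add_eq_0_iff)
  then show ?thesis using h(2) by simp
qed

text \<open>Two distinct edges share only \<open>u\<close>, so a mismatch on both leaves
  \<open>u\<close> as the only contributing vertex.\<close>

lemma X_two_edges:
  assumes u: "u \<in> {1..d}" and k: "k \<in> K2" and h: "h \<in> L u"
    and e: "e \<in> E'" "u \<in> e" "h e \<noteq> k e" and e': "e' \<in> E'" "u \<in> e'" "h e' \<noteq> k e'" "e \<noteq> e'"
  shows "X u h (lc u k) = 0"
proof -
  define H where "H w = (if w = u then h else lc w k)" for w
  have H: "H w \<in> L w" for w using h lc_in_L[OF K2_K[OF k]] by (simp add: H_def)
  have Hw: "H w = lc w k" if "w \<noteq> u" for w using that by (simp add: H_def)
  have Hu: "H u = h" by (simp add: H_def)
  have empty: "matching v H = {}" if "v \<noteq> u" for v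
  proof -
    obtain w where w: "e = {u, w}" by (rule other_end[OF e(1,2)])
    obtain w' where w': "e' = {u, w'}" by (rule other_end[OF e'(1,2)])
    have "v \<notin> e \<or> v \<notin> e'" using that w w' e'(4) by auto
    then show ?thesis
    proof
      assume "v \<notin> e"
      then show ?thesis using matching_edge[OF e(1,2) _ _ Hw] e(3) by (auto simp: Hu)
    next
      assume "v \<notin> e'"
      then show ?thesis using matching_edge[OF e'(1,2) _ _ Hw] e'(3) by (auto simp: Hu)
    qed
  qed
  have self: "matching u H = {k}" by (rule matching_self[OF u k]) (rule Hw)
  have "(\<Sum>v\<in>{1..d}. \<Sum>k'\<in>matching v H. \<xi> (v, \<beta> v (H v), lc v k') * z (k' e1) 0) = X u h (lc u k)"
    by (subst sum.remove[OF _ u]) (auto simp: self empty z_def H_def)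
  then show ?thesis using diff_base[OF H, of 0 \<xi>] kernel[of "test_index H 0"] empty[of 0] u by simp
qed

text \<open>With one mismatched edge exactly its two ends contribute, the far end with the
  configuration changed on \<open>e\<close>. The equation used is the one for s = 0, where every
  \<open>z\<close> equals 1.\<close>

lemma X_one_edge:
  assumes e: "e \<in> E'" "e = {u, v}" "u \<noteq> v" and k: "k \<in> K2" and a: "a < bond e" "a \<noteq> k e"
  shows "X u ((lc u k)(e := a)) (lc u k) + X v (lc v k) (lc v (k(e := a))) = 0"
proof -
  have u: "u \<in> {1..d}" "v \<in> {1..d}" using edge_E'[OF e(1)] e(2) by auto
  define h where "h = (lc u k)(e := a)"
  have hL: "h \<in> L u" using L_upd[OF lc_in_L[OF K2_K[OF k]] _ _ a(1)] e by (simp add: h_def del: fun_upd_apply)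
  define H where "H w = (if w = u then h else lc w k)" for w
  have H: "H w \<in> L w" for w using hL lc_in_L[OF K2_K[OF k]] by (simp add: H_def)
  have Hw: "H w = lc w k" if "w \<noteq> u" for w using that by (simp add: H_def)
  have Hu: "H u = h" by (simp add: H_def)
  have empty: "matching w H = {}" if "w \<noteq> u" "w \<noteq> v" for w
  proof -
    have we: "w \<notin> e" and ue: "u \<in> e" using that e(2) by simp_all
    have "H u e = k e" if "k' \<in> matching w H" for k'
      by (rule matching_edge[OF e(1) ue we that Hw])
    moreover have "H u e \<noteq> k e" using a(2) by (simp add: Hu h_def)
    ultimately show ?thesis by blast
  qed
  have self: "matching u H = {k}" by (rule matching_self[OF u(1) k]) (rule Hw)
  have other: "matching v H = {k(e := a)}"
  proof (rule matching_self[OF u(2) K2_upd[OF k e(1) a(1)]])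
    show "H w = lc w (k(e := a))" if "w \<noteq> v" for w
    proof (cases "w = u")
      case True
      then show ?thesis using e by (simp add: H_def h_def lc_upd del: fun_upd_apply)
    next
      case False
      then have "w \<notin> e" using that e(2) by simp
      then show ?thesis using False e(1) by (simp add: H_def lc_upd del: fun_upd_apply)
    qed
  qed
  have "(\<Sum>w\<in>{1..d}. \<Sum>k'\<in>matching w H. \<xi> (w, \<beta> w (H w), lc w k') * z (k' e1) 0) =
    (\<Sum>w\<in>{u, v}. \<Sum>k'\<in>matching w H. \<xi> (w, \<beta> w (H w), lc w k') * z (k' e1) 0)"
    by (rule sum.mono_neutral_right) (use u empty in auto)
  also have "\<dots> = X u h (lc u k) + X v (lc v k) (lc v (k(e := a)))"
    using e(3) by (simp add: self other z_def H_def)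
  finally show ?thesis
    using diff_base[OF H, of 0 \<xi>] kernel[of "test_index H 0"] empty[of 0] u by (simp add: h_def)
qed

lemma X_diagonal:
  assumes k: "k \<in> K2" and s: "s < 2"
  shows "\<xi> (0, s, lc 0 k) + (\<Sum>v\<in>{1..d}. X v (lc v k) (lc v k)) * z (k e1) s = 0"
proof -
  let ?H = "\<lambda>w. lc w k"
  have self: "matching v ?H = {k}" if "v \<in> {1..d}" for v
    by (rule matching_self[OF that k]) (rule refl)
  have "matching 0 ?H \<subseteq> matching 1 ?H" by (auto simp: matching_def)
  moreover have "k \<in> matching 0 ?H" using k by (simp add: matching_def)
  moreover have "1 \<in> {1..d}" using d by simp
  ultimately have self0: "matching 0 ?H = {k}" using self[of 1] by blast
  have "0 = (\<Sum>k'\<in>matching 0 ?H. \<xi> (0, s, lc 0 k')) +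
    (\<Sum>v\<in>{1..d}. \<Sum>k'\<in>matching v ?H. X v (lc v k) (lc v k') * z (k' e1) s)"
    unfolding kernel[of "test_index ?H s", symmetric]
    by (rule diff_base[OF _ s]) (rule lc_in_L[OF K2_K[OF k]])
  also have "\<dots> = \<xi> (0, s, lc 0 k) + (\<Sum>v\<in>{1..d}. X v (lc v k) (lc v k)) * z (k e1) s"
    unfolding self0 sum_distrib_right by (simp add: self)
  finally show ?thesis by simp
qed

text \<open>The relation of \<open>X_one_edge\<close> carries the claim to the source, where the
  extension of \<open>\<kappa>\<close> by 0 makes the corresponding entry one of the fixed
  coordinates.\<close>

lemma X_target:
  assumes e: "e \<in> E'" and v: "v = target e" and \<kappa>: "\<kappa> \<in> L v" and a: "a < bond e" "a \<noteq> \<kappa> e"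
  shows "X v \<kappa> (\<kappa>(e := a)) = 0"
proof -
  define u where "u = source e"
  have st: "e = {u, v}" "u \<noteq> v" "u < v" using source_target[OF e] by (auto simp: u_def v)
  have uv: "u \<in> {1..d}" "v \<in> {1..d}" using source_in[OF e] target_in[OF e] by (auto simp: u_def v)
  define k where "k = extension v \<kappa>"
  define i where "i = label v \<kappa>"
  have k: "k \<in> K2" "lc v k = \<kappa>" using extension_K2[OF uv(2) \<kappa>] lc_extension_self[OF uv(2) \<kappa>] by (auto simp: k_def)
  have ke: "k e = \<kappa> e" using e st by (simp add: k_def extension_def)
  have "{v, u} = e" using st by auto
  then have lu: "lc u k = (zero_local u i)(e := \<kappa> e)"
    using lc_extension_other[OF uv(2,1) st(2), of \<kappa>] e by (simp add: k_def i_def)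
  \<comment> \<open>On an edge other than \<open>{1, 2}\<close> the target is neither 1 nor 2, by
    the choice of orientation, so its label is 0.\<close>
  have "i \<in> edge_labels e"
  proof (cases "e = {1, 2}")
    case True
    then show ?thesis using label_lt[OF uv(2) \<kappa>] by (simp add: i_def edge_labels_def)
  next
    case False
    then have "v \<noteq> 1" "v \<noteq> 2" using st uv by (auto simp: doubleton_eq_iff)
    then show ?thesis using False by (simp add: i_def edge_labels_def label_def)
  qed
  then have "(e, i, a, \<kappa> e) \<in> edge_params"
    using e a L_lt[OF \<kappa>, of e] st by (auto simp: edge_params_def)
  then have "edge_coord (e, i, a, \<kappa> e) \<in> fixed" by (simp add: fixed_def)
  then have "\<xi> (edge_coord (e, i, a, \<kappa> e)) = 0" by (rule fixed_0)
  then have "X u ((lc u k)(e := a)) (lc u k) = 0" unfolding lu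
    by (simp add: edge_coord_def u_def)
  moreover have "lc v (k(e := a)) = \<kappa>(e := a)" using e st k(2) by (simp add: lc_upd del: fun_upd_apply)
  ultimately show ?thesis using X_one_edge[OF e st(1,2) k(1) a(1)] a(2) ke k(2) by simp
qed

text \<open>The entry at the target vanishes for every local configuration by
  \<open>X_target\<close>, and the same relation returns this to arbitrary configurations at the
  source, beyond the fixed ones.\<close>

lemma X_source:
  assumes e: "e \<in> E'" and u: "u = source e" and \<kappa>: "\<kappa> \<in> L u" and a: "a < bond e" "a \<noteq> \<kappa> e"
  shows "X u (\<kappa>(e := a)) \<kappa> = 0"
proof -
  define v where "v = target e"
  have st: "e = {u, v}" "u \<noteq> v" using source_target[OF e] by (auto simp: v_def u)
  have uv: "u \<in> {1..d}" "v \<in> {1..d}" using source_in[OF e] target_in[OF e] by (auto simp: v_def u)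
  define k where "k = extension u \<kappa>"
  have k: "k \<in> K2" "lc u k = \<kappa>" using extension_K2[OF uv(1) \<kappa>] lc_extension_self[OF uv(1) \<kappa>] by (auto simp: k_def)
  have ke: "k e = \<kappa> e" using e st by (simp add: k_def extension_def)
  have "lc v k e = k e" using e st by (simp add: lc_apply)
  then have "X v (lc v k) ((lc v k)(e := a)) = 0"
    using X_target[OF e v_def lc_in_L[OF K2_K[OF k(1)]] a(1)] a(2) ke by simp
  moreover have "lc v (k(e := a)) = (lc v k)(e := a)" using e st by (simp add: lc_upd del: fun_upd_apply)
  ultimately show ?thesis using X_one_edge[OF e st k(1) a(1)] a(2) ke k(2) by simp
qed

text \<open>Distinct \<open>h\<close> and \<open>\<kappa>\<close> differ in the label, on two old
  edges, or on exactly one old edge; the last case depends on which end of that edge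
  \<open>u\<close> is.\<close>

lemma X_off_diagonal:
  assumes u: "u \<in> {1..d}" and h: "h \<in> L u" and \<kappa>: "\<kappa> \<in> L u" and ne: "h \<noteq> \<kappa>"
  shows "X u h \<kappa> = 0"
proof -
  define k where "k = extension u \<kappa>"
  have k: "k \<in> K2" "lc u k = \<kappa>" using extension_K2[OF u \<kappa>] lc_extension_self[OF u \<kappa>] by (auto simp: k_def)
  show ?thesis
  proof (cases "label u h = label u \<kappa>")
    case False
    then have "u = 1 \<or> u = 2" by (auto simp: label_def split: if_splits)
    moreover have "k e1 = label u \<kappa>" using extension_e12[OF u] by (simp add: k_def)
    ultimately show ?thesis using X_label[OF _ k(1) h] False k(2) by simp
  next
    case True
    obtain e where e: "e \<in> E" "u \<in> e" "h e \<noteq> \<kappa> e" using L_ext[OF h \<kappa>] ne by blast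
    have "e \<in> E'"
      using e(1) by (rule E_cases) (use e True u in \<open>auto simp: label_def\<close>)
    have ke: "k e' = \<kappa> e'" if "e' \<in> E'" "u \<in> e'" for e'
      using that by (simp add: k_def extension_def)
    show ?thesis
    proof (cases "\<exists>e'\<in>E'. u \<in> e' \<and> h e' \<noteq> \<kappa> e' \<and> e \<noteq> e'")
      case True
      then obtain e' where "e' \<in> E'" "u \<in> e'" "h e' \<noteq> \<kappa> e'" "e \<noteq> e'" by blast
      then show ?thesis
        using X_two_edges[OF u k(1) h \<open>e \<in> E'\<close> e(2), of e'] e(3) ke[of e'] ke[OF \<open>e \<in> E'\<close> e(2)] k(2) by simp
    next
      case False
      have h_eq: "h = \<kappa>(e := h e)"
      proof (rule L_ext[OF h])
        show "\<kappa>(e := h e) \<in> L u" by (rule L_upd[OF \<kappa> e(1,2) L_lt[OF h e(1,2)]])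
        fix e' assume e': "e' \<in> E" "u \<in> e'"
        show "h e' = (\<kappa>(e := h e)) e'"
          using e'(1)
        proof (rule E_cases)
          assume "e' \<in> E'"
          then show ?thesis using False e' by auto
        next
          assume "e' = e1"
          then show ?thesis using \<open>label u h = label u \<kappa>\<close> e'(2) u E'_ne[OF \<open>e \<in> E'\<close>] by (auto simp: label_def)
        next
          assume "e' = e2"
          then show ?thesis using \<open>label u h = label u \<kappa>\<close> e'(2) u E'_ne[OF \<open>e \<in> E'\<close>] by (auto simp: label_def)
        qed
      qed
      have "u = source e \<or> u = target e" using source_target(1)[OF \<open>e \<in> E'\<close>] e(2) by blast
      then show ?thesis
      proof
        assume "u = source e"
        then have "X u (\<kappa>(e := h e)) \<kappa> = 0" by (intro X_source[OF \<open>e \<in> E'\<close> _ \<kappa> L_lt[OF h e(1,2)] e(3)])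
        then show ?thesis by (simp only: h_eq[symmetric])
      next
        assume "u = target e"
        then have "X u h (h(e := \<kappa> e)) = 0"
          by (intro X_target[OF \<open>e \<in> E'\<close> _ h L_lt[OF \<kappa> e(1,2)]]) (use e(3) in auto)
        moreover have "h(e := \<kappa> e) = \<kappa>" by (subst h_eq) simp
        ultimately show ?thesis by simp
      qed
    qed
  qed
qed

lemma X_zero_local:
  assumes "u \<in> {1..d}" "i < m"
  shows "X u (zero_local u i) (zero_local u i) = 0"
proof -
  have *: "X u (zero_local u i) (zero_local u i) = 0" if "i \<in> vertex_labels u" for i
  proof -
    have "vertex_coord (u, i) \<in> fixed" using assms that by (auto simp: fixed_def vertex_params_def)
    then show ?thesis using fixed_0 by (simp add: vertex_coord_def)
  qed
  show ?thesis
  proof (cases "u = 1 \<or> u = 2")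
    case True
    then show ?thesis using assms by (intro *) (auto simp: vertex_labels_def)
  next
    case False
    then have "zero_local u i = zero_local u 0" using zero_local_indep assms by blast
    then show ?thesis using False *[of 0] by (simp add: vertex_labels_def)
  qed
qed

text \<open>Away from vertex 0 the configuration can be replaced by the reference configuration of
  the same summand, at which all diagonal entries are 0 by the vertex coordinates.\<close>

lemma pencil_0:
  assumes k: "k \<in> K2" and s: "s < 2"
  shows "\<xi> (0, s, lc 0 k) = 0"
proof -
  let ?k = "zero_config (k e1)"
  have k0: "?k \<in> K2" by (rule zero_config_K2[OF K2_m[OF k]])
  have "lc 0 k = lc 0 ?k"
  proof
    fix e
    show "lc 0 k e = lc 0 ?k e"
    proof (cases "e \<in> E \<and> 0 \<in> e")
      case True
      then have "e = e1 \<or> e = e2" using zero_not_in_E' by (auto simp: E)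
      then show ?thesis using K2_eq[OF k] by (auto simp: lc_apply zero_config_def)
    next
      case False
      then show ?thesis by (auto simp: lc_apply)
    qed
  qed
  moreover have "(\<Sum>v\<in>{1..d}. X v (lc v ?k) (lc v ?k)) = 0"
    using X_zero_local[OF _ K2_m[OF k]] by (intro sum.neutral) (simp add: zero_local_def)
  ultimately show ?thesis using X_diagonal[OF k0 s] by simp
qed

lemma X_diagonal_sum:
  assumes "k \<in> K2"
  shows "(\<Sum>v\<in>{1..d}. X v (lc v k) (lc v k)) = 0"
  using X_diagonal[OF assms, of 0] pencil_0[OF assms, of 0] by (simp add: z_def)

text \<open>Take the diagonal relation for the configuration whose only nonzero old bond is
  \<open>e\<close>: vertices off \<open>e\<close> drop out and the source entry is fixed, so the
  target entry vanishes.\<close>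

lemma X_edge_local:
  assumes e: "e \<in> E'" "w \<in> e" and i: "i \<in> edge_labels e" and a: "a < bond e"
  shows "X w ((zero_local w i)(e := a)) ((zero_local w i)(e := a)) = 0"
proof (cases "a = 0")
  case True
  then have "(zero_local w i)(e := a) = zero_local w i" using zero_local_E'[OF e] by auto
  moreover have "w \<in> {1..d}" using edge_E'[OF e(1)] e(2) by auto
  ultimately show ?thesis using X_zero_local edge_labels_lt[OF i] by metis
next
  case False
  define k where "k = (zero_config i)(e := a)"
  define u v where "u = source e" and "v = target e"
  have st: "e = {u, v}" "u \<noteq> v" "u \<in> {1..d}" "v \<in> {1..d}"
    using source_target[OF e(1)] source_in[OF e(1)] target_in[OF e(1)] by (auto simp: u_def v_def)
  have i_m: "i < m" by (rule edge_labels_lt[OF i])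
  have k: "k \<in> K2" unfolding k_def by (rule K2_upd[OF zero_config_K2[OF i_m] e(1) a])
  have lck: "lc w k = (if w \<in> e then (zero_local w i)(e := a) else zero_local w i)" for w
    unfolding k_def by (rule lc_zero_config_upd[OF e(1)])
  have "0 = (\<Sum>w\<in>{1..d}. X w (lc w k) (lc w k))" by (rule X_diagonal_sum[OF k, symmetric])
  also have "\<dots> = (\<Sum>w\<in>{u, v}. X w (lc w k) (lc w k))"
  proof (rule sum.mono_neutral_right)
    show "\<forall>w\<in>{1..d} - {u, v}. X w (lc w k) (lc w k) = 0"
      using X_zero_local[OF _ i_m] st(1) by (simp add: lck)
  qed (use st in auto)
  also have "\<dots> = X u (lc u k) (lc u k) + X v (lc v k) (lc v k)" using st(2) by simp
  also have "X u (lc u k) (lc u k) = 0"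
  proof -
    have "edge_coord (e, i, a, a) \<in> fixed" using e i a False by (auto simp: fixed_def edge_params_def)
    then have "\<xi> (edge_coord (e, i, a, a)) = 0" by (rule fixed_0)
    moreover have "u \<in> e" using st by simp
    ultimately show ?thesis by (simp add: edge_coord_def lck u_def)
  qed
  finally have "X v (lc v k) (lc v k) = 0" by simp
  moreover have "w = u \<or> w = v" using e(2) st(1) by simp
  ultimately have "X w (lc w k) (lc w k) = 0" using \<open>X u (lc u k) (lc u k) = 0\<close> by blast
  then show ?thesis using e(2) by (simp add: lck)
qed

text \<open>In the diagonal relation for the extension of \<open>\<kappa>\<close>, every other
  vertex has at most one nonzero old bond. The label is 0 here because on edges other than
  \<open>{1, 2}\<close> the fixed coordinates have summand 0.\<close>

lemma X_diagonal_entry_label_0: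
  assumes u: "u \<in> {1..d}" and \<kappa>: "\<kappa> \<in> L u" and 0: "label u \<kappa> = 0"
  shows "X u \<kappa> \<kappa> = 0"
proof -
  define k where "k = extension u \<kappa>"
  have k: "k \<in> K2" "lc u k = \<kappa>" using extension_K2[OF u \<kappa>] lc_extension_self[OF u \<kappa>] by (auto simp: k_def)
  have "X w (lc w k) (lc w k) = 0" if w: "w \<in> {1..d} - {u}" for w
  proof (cases "{u, w} \<in> E'")
    case True
    have "0 \<in> edge_labels {u, w}" using m by (simp add: edge_labels_def)
    then show ?thesis
      using X_edge_local[OF True, of w 0 "\<kappa> {u, w}"] lc_extension_other[OF u, of w \<kappa>] w True 0 L_lt[OF \<kappa>, of "{u, w}"]
      by (simp add: k_def)
  next
    case False
    then show ?thesis
      using X_zero_local[OF _ m, of w] lc_extension_other[OF u, of w \<kappa>] w 0 by (simp add: k_def)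
  qed
  then have "(\<Sum>w\<in>{1..d}. X w (lc w k) (lc w k)) = X u \<kappa> \<kappa>"
    by (subst sum.remove[OF _ u]) (auto simp: k(2) intro!: sum.neutral)
  then show ?thesis using X_diagonal_sum[OF k(1)] by simp
qed

text \<open>For \<open>u\<close> equal to 1 or 2, the vertices from 3 on have label 0 and are
  settled for every local configuration. The remaining one of 1 and 2 can share only the edge
  \<open>{1, 2}\<close> with \<open>u\<close>, on which all summands are fixed.\<close>

lemma X_diagonal_entry:
  assumes u: "u \<in> {1..d}" and \<kappa>: "\<kappa> \<in> L u"
  shows "X u \<kappa> \<kappa> = 0"
proof (cases "u = 1 \<or> u = 2")
  case False
  then show ?thesis using X_diagonal_entry_label_0[OF u \<kappa>] by (simp add: label_def)
next
  case True
  define k where "k = extension u \<kappa>"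
  define i where "i = label u \<kappa>"
  have i: "i < m" using label_lt[OF u \<kappa>] by (simp add: i_def)
  have k: "k \<in> K2" "lc u k = \<kappa>" using extension_K2[OF u \<kappa>] lc_extension_self[OF u \<kappa>] by (auto simp: k_def)
  have "X w (lc w k) (lc w k) = 0" if w: "w \<in> {1..d} - {u}" for w
  proof (cases "w = 1 \<or> w = 2")
    case False
    then show ?thesis
      using X_diagonal_entry_label_0[of w "lc w k"] w lc_in_L[OF K2_K[OF k(1)], of w] by (simp add: label_def)
  next
    case w12: True
    then have uw: "{u, w} = {1, 2}" using True w by auto
    show ?thesis
    proof (cases "{u, w} \<in> E'")
      case E': True
      have "i \<in> edge_labels {u, w}" unfolding uw using i by (simp add: edge_labels_def)
      then show ?thesis
        using X_edge_local[OF E', of w i "\<kappa> {u, w}"] lc_extension_other[OF u, of w \<kappa>] w E' L_lt[OF \<kappa>, of "{u, w}"]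
        by (simp add: k_def i_def)
    next
      case False
      then show ?thesis
        using X_zero_local[OF _ i, of w] lc_extension_other[OF u, of w \<kappa>] w by (simp add: k_def i_def)
    qed
  qed
  then have "(\<Sum>w\<in>{1..d}. X w (lc w k) (lc w k)) = X u \<kappa> \<kappa>"
    by (subst sum.remove[OF _ u]) (auto simp: k(2) intro!: sum.neutral)
  then show ?thesis using X_diagonal_sum[OF k(1)] by simp
qed

lemma kernel_trivial:
  assumes v: "v \<in> V" and k: "k \<in> K2" and r: "r < n v"
  shows "\<xi> (v, r, lc v k) = 0"
proof (cases "v = 0")
  case True
  then show ?thesis using pencil_0[OF k] r n_0 by simp
next
  case False
  then have v1: "v \<in> {1..d}" using v by simp
  have L: "lc v k \<in> L v" by (rule lc_in_L[OF K2_K[OF k]])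
  obtain h where "h \<in> L v" "r = \<beta> v h" using \<beta>_bij[OF v1] r by (auto simp: bij_betw_def)
  then show ?thesis
    using X_off_diagonal[OF v1 _ L, of h] X_diagonal_entry[OF v1 L] by (cases "h = lc v k") auto
qed

end

subsection \<open>The dimension\<close>

text \<open>The entries on which the diagonal state sum depends; at vertex 0 the columns are the m
  diagonal positions.\<close>

definition "coords = (SIGMA v:V. {..<n v} \<times> lc v ` K2)"

lemma finite_coords: "finite coords"
  unfolding coords_def using finite_K2 by auto

lemma lc_K2: "v \<in> {1..d} \<Longrightarrow> lc v ` K2 = L v"
proof (intro equalityI subsetI)
  fix \<kappa> assume "v \<in> {1..d}" "\<kappa> \<in> L v"
  then show "\<kappa> \<in> lc v ` K2"
    by (metis extension_K2 imageI lc_extension_self)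
qed (use lc_in_L K2_K in auto)

lemma lc_0_eq_iff: "k \<in> K2 \<Longrightarrow> k' \<in> K2 \<Longrightarrow> lc 0 k = lc 0 k' \<longleftrightarrow> k e1 = k' e1"
proof
  assume k: "k \<in> K2" "k' \<in> K2" "k e1 = k' e1"
  show "lc 0 k = lc 0 k'"
  proof
    fix e
    show "lc 0 k e = lc 0 k' e"
    proof (cases "e \<in> E \<and> 0 \<in> e")
      case True
      then have "e = e1 \<or> e = e2" using zero_not_in_E' by (auto simp: E)
      then show ?thesis using K2_eq[OF k(1)] K2_eq[OF k(2)] k(3) by (auto simp: lc_apply)
    qed (auto simp: lc_apply)
  qed
qed (rule lc_eq_apply, auto)

lemma card_lc_0: "card (lc 0 ` K2) = m"
proof -
  have "lc 0 ` K2 = (\<lambda>i. lc 0 (zero_config i)) ` {..<m}"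
  proof (intro equalityI subsetI)
    fix \<kappa> assume "\<kappa> \<in> lc 0 ` K2"
    then obtain k where k: "k \<in> K2" "\<kappa> = lc 0 k" by blast
    then have "\<kappa> = lc 0 (zero_config (k e1))"
      using lc_0_eq_iff[OF k(1) zero_config_K2[OF K2_m[OF k(1)]]] by (simp add: zero_config_def)
    then show "\<kappa> \<in> (\<lambda>i. lc 0 (zero_config i)) ` {..<m}" using K2_m[OF k(1)] by blast
  qed (use zero_config_K2 in auto)
  moreover have "inj_on (\<lambda>i. lc 0 (zero_config i)) {..<m}"
    using lc_0_eq_iff zero_config_K2 by (auto simp: inj_on_def zero_config_def)
  ultimately show ?thesis by (simp add: card_image)
qed

lemma card_coords: "card coords = 2 * m + (\<Sum>j\<in>{1..d}. n j * n j)"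
proof -
  have "card coords = (\<Sum>v\<in>V. n v * card (lc v ` K2))"
    unfolding coords_def using finite_K2 by (subst card_SigmaI) (auto simp: card_cartesian_product)
  also have "\<dots> = n 0 * card (lc 0 ` K2) + (\<Sum>j\<in>{1..d}. n j * card (lc j ` K2))"
    by (subst sum.atLeast_Suc_atMost) auto
  also have "(\<Sum>j\<in>{1..d}. n j * card (lc j ` K2)) = (\<Sum>j\<in>{1..d}. n j * n j)"
    by (intro sum.cong refl) (simp add: lc_K2 card_L)
  finally show ?thesis by (simp add: n_0 card_lc_0)
qed

section \<open>The number of fixed coordinates\<close>

lemma zero_local_upd_L:
  "e \<in> E' \<Longrightarrow> w \<in> e \<Longrightarrow> i < m \<Longrightarrow> a < bond e \<Longrightarrow> (zero_local w i)(e := a) \<in> L w"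
  using L_upd[OF zero_local_L] by simp

lemma edge_coord_cases:
  assumes "q \<in> edge_params"
  obtains e i a b where "q = (e, i, a, b)" "e \<in> E'" "i \<in> edge_labels e" "a < bond e" "b < bond e" "(a, b) \<noteq> (0, 0)"
proof -
  obtain e i a b where "q = (e, i, a, b)" by (cases q) auto
  with assms show ?thesis by (intro that[of e i a b]) (auto simp: edge_params_def)
qed

lemma fixed_coords: "fixed \<subseteq> coords"
proof
  fix x assume "x \<in> fixed"
  then show "x \<in> coords"
    unfolding fixed_def
  proof
    assume "x \<in> edge_coord ` edge_params"
    then obtain q where q: "q \<in> edge_params" "x = edge_coord q" by blast
    obtain e i a b where par: "q = (e, i, a, b)" "e \<in> E'" "i \<in> edge_labels e" "a < bond e" "b < bond e"
      using edge_coord_cases[OF q(1)] by metis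
    have i: "i < m" by (rule edge_labels_lt[OF par(3)])
    have s: "source e \<in> e" "source e \<in> {1..d}" using source_in[OF par(2)] by auto
    then show ?thesis
      using \<beta>_lt[OF s(2) zero_local_upd_L[OF par(2) s(1) i par(4)]] zero_local_upd_L[OF par(2) s(1) i par(5)]
      by (simp add: q(2) par(1) edge_coord_def coords_def lc_K2)
  next
    assume "x \<in> vertex_coord ` vertex_params"
    then obtain j i where ji: "j \<in> {1..d}" "i \<in> vertex_labels j" "x = vertex_coord (j, i)"
      by (auto simp: vertex_params_def)
    then show ?thesis
      using \<beta>_lt[OF ji(1) zero_local_L[OF vertex_labels_lt[OF ji(2)]]] zero_local_L[OF vertex_labels_lt[OF ji(2)], of j]
      by (simp add: vertex_coord_def coords_def lc_K2)
  qed
qed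

lemma label_edge_coord: "e \<in> E' \<Longrightarrow> i \<in> edge_labels e \<Longrightarrow> label (source e) ((zero_local (source e) i)(e := b)) = i"
  using source_12 by (auto simp: label_upd label_zero_local edge_labels_def split: if_splits)

text \<open>The edge is recovered as the place where row or column is nonzero, by the exclusion of
  (0, 0), and the summand is recovered from the label.\<close>

lemma inj_edge_coord: "inj_on edge_coord edge_params"
proof (rule inj_onI)
  fix q q' assume q: "q \<in> edge_params" "q' \<in> edge_params" and eq: "edge_coord q = edge_coord q'"
  obtain e i a b where par: "q = (e, i, a, b)" "e \<in> E'" "i \<in> edge_labels e" "a < bond e" "b < bond e" "(a, b) \<noteq> (0, 0)"
    by (rule edge_coord_cases[OF q(1)])
  obtain e' i' a' b' where par': "q' = (e', i', a', b')" "e' \<in> E'" "i' \<in> edge_labels e'" "a' < bond e'"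
    "b' < bond e'" "(a', b') \<noteq> (0, 0)" by (rule edge_coord_cases[OF q(2)])
  define w where "w = source e"
  have w: "w \<in> e" "w \<in> {1..d}" "w = source e'" "w \<in> e'"
    using eq source_in[OF par(2)] source_in[OF par'(2)] by (auto simp: w_def par(1) par'(1) edge_coord_def)
  have \<kappa>: "(zero_local w i)(e := b) = (zero_local w i')(e' := b')"
    using eq by (simp add: par(1) par'(1) edge_coord_def flip: w_def w(3))
  have "\<beta> w ((zero_local w i)(e := a)) = \<beta> w ((zero_local w i')(e' := a'))"
    using eq by (simp add: par(1) par'(1) edge_coord_def flip: w_def w(3))
  then have h: "(zero_local w i)(e := a) = (zero_local w i')(e' := a')"
    using \<beta>_eq[OF w(2) zero_local_upd_L[OF par(2) w(1) edge_labels_lt[OF par(3)] par(4)]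
        zero_local_upd_L[OF par'(2) w(4) edge_labels_lt[OF par'(3)] par'(4)]] by simp
  have e: "e = e'"
  proof (rule ccontr)
    assume "e \<noteq> e'"
    then have "a = 0" "b = 0"
      using fun_cong[OF h, of e] fun_cong[OF \<kappa>, of e] zero_local_E'[OF par(2) w(1)] by simp_all
    then show False using par(6) by simp
  qed
  have "a = a'" "b = b'" using fun_cong[OF h, of e] fun_cong[OF \<kappa>, of e] e by simp_all
  moreover have "i = i'"
    using label_edge_coord[OF par(2,3), of b] label_edge_coord[OF par'(2,3), of b'] \<kappa> e by (simp add: w_def)
  ultimately show "q = q'" using e by (simp add: par(1) par'(1))
qed

lemma inj_vertex_coord: "inj_on vertex_coord vertex_params"
proof (rule inj_onI)
  fix q q' assume "q \<in> vertex_params" "q' \<in> vertex_params" and eq: "vertex_coord q = vertex_coord q'"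
  then obtain j i i' where par: "q = (j, i)" "i \<in> vertex_labels j" "q' = (j, i')" "i' \<in> vertex_labels j"
    by (auto simp: vertex_params_def vertex_coord_def)
  have "zero_local j i = zero_local j i'" using eq by (simp add: par vertex_coord_def)
  then have "label j (zero_local j i) = label j (zero_local j i')" by simp
  then show "q = q'" using par by (auto simp: label_zero_local vertex_labels_def split: if_splits)
qed

lemma disjoint_coords: "edge_coord ` edge_params \<inter> vertex_coord ` vertex_params = {}"
proof (rule ccontr)
  assume "\<not> ?thesis"
  then obtain q r where q: "q \<in> edge_params" "r \<in> vertex_params" "edge_coord q = vertex_coord r" by blast
  obtain e i a b where par: "q = (e, i, a, b)" "e \<in> E'" "i \<in> edge_labels e" "a < bond e" "b < bond e" "(a, b) \<noteq> (0, 0)"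
    by (rule edge_coord_cases[OF q(1)])
  obtain j i' where ji: "r = (j, i')" "j \<in> {1..d}" "i' \<in> vertex_labels j"
    using q(2) by (auto simp: vertex_params_def)
  have j: "j = source e" "j \<in> e" using q(3) source_in[OF par(2)] by (auto simp: par(1) ji(1) edge_coord_def vertex_coord_def)
  have \<kappa>: "(zero_local j i)(e := b) = zero_local j i'"
    using q(3) j by (simp add: par(1) ji(1) edge_coord_def vertex_coord_def)
  have "\<beta> j ((zero_local j i)(e := a)) = \<beta> j (zero_local j i')"
    using q(3) j by (simp add: par(1) ji(1) edge_coord_def vertex_coord_def)
  then have h: "(zero_local j i)(e := a) = zero_local j i'"
    using \<beta>_eq[OF ji(2) zero_local_upd_L[OF par(2) j(2) edge_labels_lt[OF par(3)] par(4)]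
        zero_local_L[OF vertex_labels_lt[OF ji(3)]]] by simp
  have "a = 0" "b = 0"
    using fun_cong[OF h, of e] fun_cong[OF \<kappa>, of e] zero_local_E'[OF par(2) j(2)] by simp_all
  then show False using par(6) by simp
qed

lemma finite_params: "finite edge_params" "finite vertex_params"
  using finite_E' by (auto simp: edge_params_def vertex_params_def edge_labels_def vertex_labels_def)

lemma sum_vertices_12: "(\<Sum>j\<in>{1..d}. if j = 1 \<or> j = 2 then f else g) = 2 * f + (int d - 2) * (g :: int)"
proof -
  have "{1..d} = insert 1 (insert 2 {3..d})" using d by auto
  then have "(\<Sum>j\<in>{1..d}. if j = 1 \<or> j = 2 then f else g) = f + (f + (\<Sum>j\<in>{3..d}. if j = 1 \<or> j = 2 then f else g))"
    by simp
  also have "(\<Sum>j\<in>{3..d}. if j = 1 \<or> j = 2 then f else g) = (\<Sum>j\<in>{3..d}. g)" by (intro sum.cong) auto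
  finally show ?thesis using d by (simp add: of_nat_diff algebra_simps)
qed

text \<open>A missing edge behaves like one of bond dimension 1, on which there is no gauge freedom
  modulo scalars.\<close>

definition m12 :: nat where "m12 = (if {1, 2} \<in> E' then bond {1, 2} else 1)"

text \<open>Each edge fixes m_e^2 - 1 entries, the edge \<open>{1, 2}\<close> m times as many; the
  vertices 1 and 2 fix m scalars each, and the other d - 2 vertices one each.\<close>

lemma card_fixed:
  "int (card fixed) = (\<Sum>e\<in>E'. (int (bond e))\<^sup>2 - 1) + (int m - 1) * ((int m12)\<^sup>2 - 1) + 2 * int m + int d - 2"
proof -
  have fin: "finite (edge_labels e)" for e by (simp add: edge_labels_def)
  have "card fixed = card edge_params + card vertex_params"
    unfolding fixed_def using finite_params disjoint_coords
    by (simp add: card_Un_disjoint card_image[OF inj_edge_coord] card_image[OF inj_vertex_coord])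
  moreover have "int (card edge_params) = (\<Sum>e\<in>E'. (int (bond e))\<^sup>2 - 1) + (int m - 1) * ((int m12)\<^sup>2 - 1)"
  proof -
    have one: "int (card (edge_labels e \<times> ({..<bond e} \<times> {..<bond e} - {(0, 0)}))) =
      ((int (bond e))\<^sup>2 - 1) + (if e = {1, 2} then (int m - 1) * ((int (bond e))\<^sup>2 - 1) else 0)" if e: "e \<in> E'" for e
    proof -
      have pos: "0 < bond e" using e bond_pos by simp
      define A where "A = {..<bond e} \<times> {..<bond e} - {(0 :: nat, 0 :: nat)}"
      have "card A = bond e * bond e - 1"
        unfolding A_def using pos by (subst card_Diff_subset) (auto simp: card_cartesian_product)
      then have A: "int (card A) = (int (bond e))\<^sup>2 - 1"
        using pos by (simp add: of_nat_diff power2_eq_square)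
      have "int (card (edge_labels e \<times> A)) = int (card (edge_labels e)) * ((int (bond e))\<^sup>2 - 1)"
        by (simp only: card_cartesian_product of_nat_mult A)
      moreover have "int (card (edge_labels e)) = 1 + (if e = {1, 2} then int m - 1 else 0)"
        by (simp add: edge_labels_def)
      ultimately show ?thesis unfolding A_def[symmetric] by (cases "e = {1, 2}") (simp_all only: if_True if_False, simp_all add: algebra_simps)
    qed
    have "int (card edge_params) = (\<Sum>e\<in>E'. int (card (edge_labels e \<times> ({..<bond e} \<times> {..<bond e} - {(0, 0)}))))"
      unfolding edge_params_def using finite_E' fin by (subst card_SigmaI) auto
    also have "\<dots> = (\<Sum>e\<in>E'. ((int (bond e))\<^sup>2 - 1) + (if e = {1, 2} then (int m - 1) * ((int (bond e))\<^sup>2 - 1) else 0))"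
      by (intro sum.cong refl one)
    also have "\<dots> = (\<Sum>e\<in>E'. (int (bond e))\<^sup>2 - 1) + (int m - 1) * ((int m12)\<^sup>2 - 1)"
      using finite_E' by (simp add: sum.distrib m12_def)
    finally show ?thesis .
  qed
  moreover have "int (card vertex_params) = 2 * int m + int d - 2"
  proof -
    have "int (card vertex_params) = (\<Sum>j\<in>{1..d}. int (card (vertex_labels j)))"
      unfolding vertex_params_def by (subst card_SigmaI) (auto simp: vertex_labels_def)
    also have "\<dots> = (\<Sum>j\<in>{1..d}. if j = 1 \<or> j = 2 then int m else 1)"
      by (intro sum.cong) (auto simp: vertex_labels_def)
    finally show ?thesis by (simp only: sum_vertices_12) simp
  qed
  ultimately show ?thesis by simp
qed

lemma F_K2_coords: "(\<And>i. i \<in> coords \<Longrightarrow> x i = y i) \<Longrightarrow> F K2 b x = F K2 b y"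
  by (rule F_K2_cong) (auto simp: coords_def)

lemma variety_dim_TNS: "variety_dim (TNS V E bond n) = card (coords - fixed)"
proof -
  let ?S = "coords - fixed"
  let ?w = "\<lambda>\<rho> b. dF K2 b base (\<lambda>i. of_bool (i = \<rho>))"
  have fin: "finite ?S" using finite_coords by simp
  have dF_sum: "dF K2 b base y = (\<Sum>\<rho>\<in>?S. y \<rho> * ?w \<rho> b)" if "\<And>i. i \<notin> ?S \<Longrightarrow> y i = 0" for y b
  proof -
    have "y = (\<lambda>i. \<Sum>\<rho>\<in>?S. y \<rho> * of_bool (i = \<rho>))"
    proof
      fix i
      have "(\<Sum>\<rho>\<in>?S. y \<rho> * of_bool (i = \<rho>)) = (\<Sum>\<rho>\<in>?S. if \<rho> = i then y i else 0)"
        by (intro sum.cong) auto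
      then show "y i = (\<Sum>\<rho>\<in>?S. y \<rho> * of_bool (i = \<rho>))" using fin that[of i] by simp
    qed
    then have "dF K2 b base y = dF K2 b base (\<lambda>i. \<Sum>\<rho>\<in>?S. y \<rho> * of_bool (i = \<rho>))" by (rule arg_cong)
    then show ?thesis by (simp only: state_diff_sum state_diff_scale)
  qed
  have "variety_dim (zariski closure_of ((\<lambda>x b. F K2 b x) ` {x. \<forall>i. i \<notin> ?S \<longrightarrow> x i = base i})) = card ?S"
  proof (rule variety_dim_parametrized[where f = "F K2" and w = ?w])
    show "((\<lambda>t. F K2 b (\<lambda>i. base i + t * y i)) has_field_derivative (\<Sum>\<rho>\<in>?S. y \<rho> * ?w \<rho> b)) (at 0)"
      if "\<And>i. i \<notin> ?S \<Longrightarrow> y i = 0" for y b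
    proof -
      have "dF K2 b base y = (\<Sum>\<rho>\<in>?S. y \<rho> * ?w \<rho> b)" by (rule dF_sum) (rule that)
      then show ?thesis using state_sum_deriv[of V E n K2 b base y] by simp
    qed
    show "\<forall>\<rho>\<in>?S. c \<rho> = 0" if c: "\<And>b. (\<Sum>\<rho>\<in>?S. c \<rho> * ?w \<rho> b) = 0" for c
    proof
      fix \<rho> assume \<rho>: "\<rho> \<in> ?S"
      define \<xi> where "\<xi> i = (if i \<in> ?S then c i else 0)" for i
      have "dF K2 b base \<xi> = 0" for b
      proof -
        have "dF K2 b base \<xi> = (\<Sum>\<rho>\<in>?S. \<xi> \<rho> * ?w \<rho> b)" by (rule dF_sum) (simp only: \<xi>_def if_False)
        also have "\<dots> = (\<Sum>\<rho>\<in>?S. c \<rho> * ?w \<rho> b)" by (rule sum.cong) (simp_all add: \<xi>_def)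
        finally show ?thesis using c by simp
      qed
      moreover have "\<xi> i = 0" if "i \<in> fixed" for i using that by (simp add: \<xi>_def)
      moreover obtain v r k where "\<rho> = (v, r, lc v k)" "v \<in> V" "k \<in> K2" "r < n v"
        using \<rho> by (auto simp: coords_def)
      ultimately have "\<xi> \<rho> = 0" using kernel_trivial[of \<xi>] by simp
      then show "c \<rho> = 0" using \<rho> by (simp only: \<xi>_def if_True)
    qed
  qed (rule state_sum_poly, rule fin)
  also have "(\<lambda>x b. F K2 b x) ` {x. \<forall>i. i \<notin> ?S \<longrightarrow> x i = base i} = (\<lambda>x b. F K2 b x) ` {x. \<forall>i\<in>fixed. x i = base i}"
  proof (intro equalityI subsetI)
    fix T assume "T \<in> (\<lambda>x b. F K2 b x) ` {x. \<forall>i\<in>fixed. x i = base i}"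
    then obtain x where x: "\<forall>i\<in>fixed. x i = base i" "T = (\<lambda>b. F K2 b x)" by blast
    let ?x = "\<lambda>i. if i \<in> ?S then x i else base i"
    have "F K2 b x = F K2 b ?x" for b by (rule F_K2_coords) (use x(1) in auto)
    then show "T \<in> (\<lambda>x b. F K2 b x) ` {x. \<forall>i. i \<notin> ?S \<longrightarrow> x i = base i}"
      using x(2) by (intro image_eqI[of _ _ ?x]) auto
  qed auto
  also have "zariski closure_of \<dots> = zariski closure_of (range (\<lambda>x b. F K2 b x))"
    by (rule closure_of_image_slice[OF state_sum_poly gauge_fields])
  finally show ?thesis by (simp add: TNS_diagonal)
qed

section \<open>Parameter count and expected dimension\<close>

lemma n_square: "j \<in> {1..d} \<Longrightarrow> n j * (\<Prod>e\<in>{e \<in> E. j \<in> e}. bond e) = n j * n j"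
  using n_critical by simp

lemma sum_E: "(\<Sum>e\<in>E. f e) = f e1 + f e2 + (\<Sum>e\<in>E'. f e)" for f :: "nat set \<Rightarrow> int"
proof -
  have "E = insert e1 (insert e2 E')" by (auto simp: E)
  then show ?thesis using finite_E' by (simp add: doubleton_eq_iff)
qed

text \<open>The constant 2 is what vertex 0, its two bonds and the final 1 leave: (2 m^2 - 1) - 2
  (m^2 - 1) + 1.\<close>

lemma param_count_eq:
  "param_count V E bond n = (\<Sum>j\<in>{1..d}. int (n j * n j)) - int d + 2 - (\<Sum>e\<in>E'. (int (bond e))\<^sup>2 - 1)"
proof -
  have "{e \<in> E. 0 \<in> e} = {e1, e2}" using zero_not_in_E' by (auto simp: E)
  then have 0: "(\<Prod>e\<in>{e \<in> E. 0 \<in> e}. bond e) = m * m" by (simp add: doubleton_eq_iff)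
  have "(\<Sum>v\<in>V. int (n v * (\<Prod>e\<in>{e \<in> E. v \<in> e}. bond e)) - 1) =
    int (n 0 * (m * m)) - 1 + (\<Sum>j\<in>{1..d}. int (n j * (\<Prod>e\<in>{e \<in> E. j \<in> e}. bond e)) - 1)"
    by (subst sum.atLeast_Suc_atMost) (auto simp: 0)
  also have "(\<Sum>j\<in>{1..d}. int (n j * (\<Prod>e\<in>{e \<in> E. j \<in> e}. bond e)) - 1) = (\<Sum>j\<in>{1..d}. int (n j * n j)) - int d"
  proof -
    have "(\<Sum>j\<in>{1..d}. int (n j * (\<Prod>e\<in>{e \<in> E. j \<in> e}. bond e)) - 1) = (\<Sum>j\<in>{1..d}. int (n j * n j) - 1)"
      by (intro sum.cong refl) (simp only: n_square)
    then show ?thesis by (simp add: sum_subtractf)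
  qed
  finally show ?thesis
    by (simp add: param_count_def sum_E n_0 power2_eq_square)
qed

lemma fiberdefect_eq: "fiberdefect V E bond n = (int m - 1) * ((int m12)\<^sup>2 - 1)"
proof -
  have "card (coords - fixed) = card coords - card fixed"
    using fixed_coords finite_coords finite_subset by (intro card_Diff_subset) auto
  moreover have "card fixed \<le> card coords" by (rule card_mono[OF finite_coords fixed_coords])
  ultimately have "int (variety_dim (TNS V E bond n)) = int (card coords) - int (card fixed)"
    by (simp add: variety_dim_TNS of_nat_diff)
  then show ?thesis
    by (simp add: fiberdefect_def param_count_eq card_coords card_fixed)
qed

text \<open>Both sides are affine in every squared bond dimension, with the larger slope on the right, and
  agree when all bond dimensions of the smaller network are \<open>1\<close>.\<close>

lemma critical_inequality:
  fixes A :: "nat set \<Rightarrow> int" and M :: int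
  assumes "finite D" "D \<subseteq> E'" "\<And>e. e \<in> D \<Longrightarrow> 1 \<le> A e" "1 \<le> M"
  shows "2 + (\<Sum>j\<in>{1..d}. (if j = 1 \<or> j = 2 then M else 1) * (\<Prod>e\<in>{e \<in> D. j \<in> e}. A e) - 1) - (\<Sum>e\<in>D. A e - 1)
    \<le> 2 * M * (\<Prod>e\<in>D. A e)"
  using assms(1-3)
proof (induction D rule: finite_induct)
  case empty
  have "(\<Sum>j\<in>{1..d}. (if j = 1 \<or> j = 2 then M else 1) * (\<Prod>e\<in>{e \<in> {}. j \<in> e}. A e) - 1) =
    (\<Sum>j\<in>{1..d}. if j = 1 \<or> j = 2 then M - 1 else 0)" by (intro sum.cong) auto
  then show ?case by (simp only: sum_vertices_12) simp
next
  case (insert f D)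
  define P where "P j G = (if j = 1 \<or> j = 2 then M else 1) * (\<Prod>e\<in>{e \<in> G. j \<in> e}. A e)" for j :: nat and G
  obtain u v where uv: "f = {u, v}" "u \<noteq> v" "u \<in> {1..d}" "v \<in> {1..d}"
    using source_target[of f] source_in[of f] target_in[of f] insert.prems(1)
    by (metis insert_subset less_irrefl)
  have Af: "1 \<le> A f" using insert.prems by simp
  have P_f: "P j (insert f D) = (if j \<in> f then A f * P j D else P j D)" for j
  proof -
    have "{e \<in> insert f D. j \<in> e} = (if j \<in> f then insert f {e \<in> D. j \<in> e} else {e \<in> D. j \<in> e})" by auto
    then show ?thesis using insert.hyps by (simp add: P_def)
  qed
  have P_le: "P j D \<le> M * (\<Prod>e\<in>D. A e)" for j
  proof -
    have 1: "1 \<le> (\<Prod>e\<in>G. A e)" if "G \<subseteq> D" for G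
      by (rule prod_ge_1) (use that insert.prems(2) in auto)
    have "(\<Prod>e\<in>D. A e) = (\<Prod>e\<in>{e \<in> D. j \<in> e}. A e) * (\<Prod>e\<in>D - {e \<in> D. j \<in> e}. A e)"
      using insert.hyps(1) by (subst prod.subset_diff[of "{e \<in> D. j \<in> e}"]) (auto simp: mult.commute)
    also have "\<dots> \<ge> (\<Prod>e\<in>{e \<in> D. j \<in> e}. A e) * 1"
      using 1[of "{e \<in> D. j \<in> e}"] 1[of "D - {e \<in> D. j \<in> e}"] by (intro mult_left_mono) auto
    finally have "(\<Prod>e\<in>{e \<in> D. j \<in> e}. A e) \<le> (\<Prod>e\<in>D. A e)" by simp
    then show ?thesis unfolding P_def using assms(4) 1[of "{e \<in> D. j \<in> e}"] by (intro mult_mono) auto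
  qed
  have "(\<Sum>j\<in>{1..d}. P j (insert f D) - 1) = (\<Sum>j\<in>{1..d}. (P j D - 1) + (if j \<in> {u, v} then (A f - 1) * P j D else 0))"
    unfolding uv(1)[symmetric] by (intro sum.cong refl) (simp add: P_f algebra_simps)
  also have "\<dots> = (\<Sum>j\<in>{1..d}. P j D - 1) + (\<Sum>j\<in>{u, v}. (A f - 1) * P j D)"
  proof -
    have "(\<Sum>j\<in>{1..d}. if j \<in> {u, v} then (A f - 1) * P j D else 0) = (\<Sum>j\<in>{u, v}. (A f - 1) * P j D)"
      by (rule sum.mono_neutral_cong_right) (use uv in auto)
    then show ?thesis by (simp only: sum.distrib)
  qed
  also have "\<dots> = (\<Sum>j\<in>{1..d}. P j D - 1) + (A f - 1) * (P u D + P v D)"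
    using uv(2) by (simp add: algebra_simps)
  finally have step: "(\<Sum>j\<in>{1..d}. P j (insert f D) - 1) = (\<Sum>j\<in>{1..d}. P j D - 1) + (A f - 1) * (P u D + P v D)" .
  have "(A f - 1) * (P u D + P v D) \<le> (A f - 1) * (2 * M * (\<Prod>e\<in>D. A e))"
    using P_le[of u] P_le[of v] Af by (intro mult_left_mono) auto
  moreover have "2 + (\<Sum>j\<in>{1..d}. P j D - 1) - (\<Sum>e\<in>D. A e - 1) \<le> 2 * M * (\<Prod>e\<in>D. A e)"
    using insert.IH insert.prems by (simp add: P_def)
  ultimately have "2 + (\<Sum>j\<in>{1..d}. P j (insert f D) - 1) - (\<Sum>e\<in>insert f D. A e - 1) \<le>
    2 * M * (\<Prod>e\<in>insert f D. A e)"
    using step insert.hyps Af by (simp add: algebra_simps)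
  then show ?case by (simp add: P_def)
qed

text \<open>Exchanging vertices and edges, each old edge is counted at both of its ends and each new
  bond at its one end in 1, ..., d; the factor 2 is the physical dimension at 0.\<close>

lemma prod_n: "(\<Prod>v\<in>V. n v) = 2 * (m * m * (\<Prod>e\<in>E'. bond e * bond e))"
proof -
  have "(\<Prod>v\<in>V. n v) = n 0 * (\<Prod>j\<in>{1..d}. n j)"
    by (subst prod.atLeast_Suc_atMost) auto
  also have "(\<Prod>j\<in>{1..d}. n j) = (\<Prod>j\<in>{1..d}. \<Prod>e\<in>{e \<in> E. j \<in> e}. bond e)"
    using n_critical by (intro prod.cong) auto
  also have "\<dots> = (\<Prod>e\<in>E. \<Prod>j\<in>{j \<in> {1..d}. j \<in> e}. bond e)"
    by (rule prod.swap_restrict) (use finite_E in auto)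
  also have "\<dots> = (\<Prod>e\<in>insert e1 (insert e2 E'). \<Prod>j\<in>{j \<in> {1..d}. j \<in> e}. bond e)"
    by (rule prod.cong) (auto simp: E)
  also have "\<dots> = (\<Prod>j\<in>{j \<in> {1..d}. j \<in> e1}. m) * ((\<Prod>j\<in>{j \<in> {1..d}. j \<in> e2}. m) *
      (\<Prod>e\<in>E'. \<Prod>j\<in>{j \<in> {1..d}. j \<in> e}. bond e))"
    using finite_E' by (simp add: doubleton_eq_iff)
  also have "{j \<in> {1..d}. j \<in> e1} = {1}" using d by auto
  also have "{j \<in> {1..d}. j \<in> e2} = {2}" using d by auto
  also have "(\<Prod>e\<in>E'. \<Prod>j\<in>{j \<in> {1..d}. j \<in> e}. bond e) = (\<Prod>e\<in>E'. bond e * bond e)"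
  proof (intro prod.cong refl)
    fix e assume e: "e \<in> E'"
    then have "{j \<in> {1..d}. j \<in> e} = e" using edge_E' by blast
    then show "(\<Prod>j\<in>{j \<in> {1..d}. j \<in> e}. bond e) = bond e * bond e"
      using edge_E'[OF e] by (simp add: power2_eq_square)
  qed
  finally show ?thesis by (simp add: n_0)
qed

lemma n_square_eq:
  assumes j: "j \<in> {1..d}"
  shows "int (n j * n j) = (if j = 1 \<or> j = 2 then int (m * m) else 1) * (\<Prod>e\<in>{e \<in> E'. j \<in> e}. int (bond e * bond e))"
proof -
  define c where "c = (if j = 1 then {e1} else if j = 2 then {e2} else {})"
  have "{e \<in> E. j \<in> e} = c \<union> {e \<in> E'. j \<in> e}" using j by (auto simp: E c_def)
  moreover have "c \<inter> {e \<in> E'. j \<in> e} = {}" "finite c" by (auto simp: c_def)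
  ultimately have "(\<Prod>e\<in>{e \<in> E. j \<in> e}. bond e) = (\<Prod>e\<in>c. bond e) * (\<Prod>e\<in>{e \<in> E'. j \<in> e}. bond e)"
    using finite_E' by (simp add: prod.union_disjoint)
  moreover have "(\<Prod>e\<in>c. bond e) = (if j = 1 \<or> j = 2 then m else 1)" by (simp add: c_def)
  ultimately have "n j = (if j = 1 \<or> j = 2 then m else 1) * (\<Prod>e\<in>{e \<in> E'. j \<in> e}. bond e)"
    using n_critical j by simp
  then show ?thesis by (simp add: prod.distrib)
qed

text \<open>Makes the parameter count the expected dimension, so that defect and fibre defect
  coincide.\<close>

lemma param_count_le: "param_count V E bond n \<le> int (\<Prod>v\<in>V. n v)"
proof -
  let ?A = "\<lambda>e. int (bond e * bond e)"
  have bond1: "1 \<le> ?A e" if "e \<in> E'" for e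
  proof -
    have "0 < bond e * bond e" using bond_pos[of e] that by simp
    then show ?thesis by linarith
  qed
  have "0 < m * m" using m by simp
  then have m1: "1 \<le> int (m * m)" by linarith
  have "2 + (\<Sum>j\<in>{1..d}. (if j = 1 \<or> j = 2 then int (m * m) else 1) * (\<Prod>e\<in>{e \<in> E'. j \<in> e}. ?A e) - 1) - (\<Sum>e\<in>E'. ?A e - 1)
    \<le> 2 * int (m * m) * (\<Prod>e\<in>E'. ?A e)"
    by (rule critical_inequality[OF finite_E' subset_refl bond1 m1])
  moreover have "(\<Sum>j\<in>{1..d}. (if j = 1 \<or> j = 2 then int (m * m) else 1) * (\<Prod>e\<in>{e \<in> E'. j \<in> e}. ?A e) - 1) =
    (\<Sum>j\<in>{1..d}. int (n j * n j) - 1)"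
    by (intro sum.cong refl) (simp only: n_square_eq)
  moreover have "\<dots> = (\<Sum>j\<in>{1..d}. int (n j * n j)) - int d" by (simp add: sum_subtractf)
  moreover have "(\<Sum>e\<in>E'. ?A e - 1) = (\<Sum>e\<in>E'. (int (bond e))\<^sup>2 - 1)"
    by (simp add: power2_eq_square)
  moreover have "int (\<Prod>v\<in>V. n v) = 2 * int (m * m) * (\<Prod>e\<in>E'. ?A e)" by (simp add: prod_n)
  ultimately show ?thesis by (simp only: param_count_eq)
qed

lemma TNS_defect_eq: "TNS_defect V E bond n = (int m - 1) * ((int m12)\<^sup>2 - 1)"
  using fiberdefect_eq param_count_le by (simp add: TNS_defect_def fiberdefect_def expected_dim_def)

lemma defective_TNS: "1 < m \<Longrightarrow> 1 < m12 \<Longrightarrow> defective V E bond n"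
proof -
  assume "1 < m" "1 < m12"
  then have "0 < (int m - 1) * ((int m12)\<^sup>2 - 1)" by (intro mult_pos_pos) (auto simp: power2_eq_square less_1_mult)
  then show ?thesis using TNS_defect_eq by (simp add: TNS_defect_def defective_def)
qed

end

section \<open>The normal form\<close>

lemma tensor_map_reindex:
  assumes V: "finite V" and J: "\<And>v. v \<in> V \<Longrightarrow> finite (J v)"
    and \<phi>: "\<And>v a. v \<in> V \<Longrightarrow> a \<in> I v \<Longrightarrow> \<phi> v a \<in> J v"
  shows "tensor_map V J J' X (reindex V I J \<phi> T) = tensor_map V I J' (\<lambda>v r c. X v r (\<phi> v c)) T"
proof
  fix b
  show "tensor_map V J J' X (reindex V I J \<phi> T) b = tensor_map V I J' (\<lambda>v r c. X v r (\<phi> v c)) T b"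
  proof (cases "b \<in> Pi\<^sub>E V J'")
    case True
    have fin: "finite (Pi\<^sub>E V J)" using V J by (intro finite_PiE) auto
    have "(\<Sum>a\<in>Pi\<^sub>E V J. (\<Prod>v\<in>V. X v (b v) (a v)) * reindex V I J \<phi> T a) =
      (\<Sum>a\<in>Pi\<^sub>E V J. \<Sum>c\<in>Pi\<^sub>E V I. (\<Prod>v\<in>V. X v (b v) (a v)) * ((\<Prod>v\<in>V. of_bool (a v = \<phi> v (c v))) * T c))"
      by (intro sum.cong refl) (simp add: reindex_def tensor_map_def sum_distrib_left)
    also have "\<dots> = (\<Sum>c\<in>Pi\<^sub>E V I. \<Sum>a\<in>Pi\<^sub>E V J. (\<Prod>v\<in>V. X v (b v) (a v)) * ((\<Prod>v\<in>V. of_bool (a v = \<phi> v (c v))) * T c))"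
      by (rule sum.swap)
    also have "\<dots> = (\<Sum>c\<in>Pi\<^sub>E V I. (\<Prod>v\<in>V. X v (b v) (\<phi> v (c v))) * T c)"
    proof (intro sum.cong refl)
      fix c assume c: "c \<in> Pi\<^sub>E V I"
      let ?a = "\<lambda>v\<in>V. \<phi> v (c v)"
      have a0: "?a \<in> Pi\<^sub>E V J" using c \<phi> by auto
      have "(\<Prod>v\<in>V. X v (b v) (a v)) * ((\<Prod>v\<in>V. of_bool (a v = \<phi> v (c v))) * T c) =
        (if a = ?a then (\<Prod>v\<in>V. X v (b v) (\<phi> v (c v))) * T c else 0)" if a: "a \<in> Pi\<^sub>E V J" for a
      proof (cases "a = ?a")
        case True
        then show ?thesis by simp
      next
        case False
        then have "\<exists>v\<in>V. a v \<noteq> \<phi> v (c v)" using PiE_ext[OF a a0] by auto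
        then have "(\<Prod>v\<in>V. of_bool (a v = \<phi> v (c v))) = (0 :: complex)" using V by (subst prod_zero_iff) auto
        then show ?thesis using False by (simp only: mult_zero_left mult_zero_right if_False)
      qed
      then have "(\<Sum>a\<in>Pi\<^sub>E V J. (\<Prod>v\<in>V. X v (b v) (a v)) * ((\<Prod>v\<in>V. of_bool (a v = \<phi> v (c v))) * T c)) =
        (\<Sum>a\<in>Pi\<^sub>E V J. if a = ?a then (\<Prod>v\<in>V. X v (b v) (\<phi> v (c v))) * T c else 0)"
        by (intro sum.cong refl)
      also have "\<dots> = (\<Prod>v\<in>V. X v (b v) (\<phi> v (c v))) * T c" using fin a0 by simp
      finally show "(\<Sum>a\<in>Pi\<^sub>E V J. (\<Prod>v\<in>V. X v (b v) (a v)) * ((\<Prod>v\<in>V. of_bool (a v = \<phi> v (c v))) * T c)) =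
        (\<Prod>v\<in>V. X v (b v) (\<phi> v (c v))) * T c" .
    qed
    finally show ?thesis using True by (simp add: tensor_map_def)
  qed (simp add: tensor_map_def)
qed

lemma sum_kron:
  assumes "finite V"
  shows "(\<Sum>c\<in>Pi\<^sub>E V (\<lambda>v. A v \<times> B v). G c * kron V S T c) =
    (\<Sum>a\<in>Pi\<^sub>E V A. \<Sum>a'\<in>Pi\<^sub>E V B. G (\<lambda>v\<in>V. (a v, a' v)) * (S a * T a'))"
proof -
  have "(\<Sum>c\<in>Pi\<^sub>E V (\<lambda>v. A v \<times> B v). G c * kron V S T c) =
    (\<Sum>(a, a')\<in>Pi\<^sub>E V A \<times> Pi\<^sub>E V B. G (\<lambda>v\<in>V. (a v, a' v)) * (S a * T a'))"
  proof (rule sum.reindex_bij_witness[where j = "\<lambda>c. (\<lambda>v\<in>V. fst (c v), \<lambda>v\<in>V. snd (c v))"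
        and i = "\<lambda>(a, a'). \<lambda>v\<in>V. (a v, a' v)"])
    fix c assume c: "c \<in> Pi\<^sub>E V (\<lambda>v. A v \<times> B v)"
    show eq: "(case (\<lambda>v\<in>V. fst (c v), \<lambda>v\<in>V. snd (c v)) of (a, a') \<Rightarrow> \<lambda>v\<in>V. (a v, a' v)) = c"
      using c by (auto simp: fun_eq_iff PiE_def extensional_def)
    have fs: "fst (c v) \<in> A v" "snd (c v) \<in> B v" if "v \<in> V" for v
      using c that by (auto simp: PiE_iff mem_Times_iff)
    then show "(\<lambda>v\<in>V. fst (c v), \<lambda>v\<in>V. snd (c v)) \<in> Pi\<^sub>E V A \<times> Pi\<^sub>E V B" by auto
    show "(case (\<lambda>v\<in>V. fst (c v), \<lambda>v\<in>V. snd (c v)) of (a, a') \<Rightarrow> G (\<lambda>v\<in>V. (a v, a' v)) * (S a * T a')) = G c * kron V S T c"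
      using c eq by (auto simp: kron_def PiE_def)
  next
    fix p assume p: "p \<in> Pi\<^sub>E V A \<times> Pi\<^sub>E V B"
    show "(\<lambda>v\<in>V. fst ((case p of (a, a') \<Rightarrow> \<lambda>v\<in>V. (a v, a' v)) v),
      \<lambda>v\<in>V. snd ((case p of (a, a') \<Rightarrow> \<lambda>v\<in>V. (a v, a' v)) v)) = p"
      using p by (cases p) (auto simp: fun_eq_iff PiE_def extensional_def)
    show "(case p of (a, a') \<Rightarrow> \<lambda>v\<in>V. (a v, a' v)) \<in> Pi\<^sub>E V (\<lambda>v. A v \<times> B v)"
      using p by (cases p) auto
  qed
  then show ?thesis by (simp add: sum.cartesian_product)
qed

lemma det_nonzero_GL:
  assumes "A \<in> carrier_mat k k" "det A \<noteq> 0"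
  shows "A \<in> GL k"
proof -
  have "A \<in> Units (ring_mat TYPE(complex) k k)" by (rule det_non_zero_imp_unit[OF assms])
  then obtain B where "B \<in> carrier_mat k k" "B * A = 1\<^sub>m k" "A * B = 1\<^sub>m k"
    by (auto simp: Units_def ring_mat_simps)
  then show ?thesis
    using assms(1) by (auto simp: GL_def invertible_mat_def inverts_mat_def square_mat.simps)
qed

lemma det_poly_funs:
  assumes "\<And>i j. i < k \<Longrightarrow> j < k \<Longrightarrow> (\<lambda>x. f x (i, j)) \<in> poly_funs"
  shows "(\<lambda>x. det (mat k k (f x))) \<in> poly_funs"
proof -
  have "det (mat k k (f x)) = (\<Sum>p | p permutes {0..<k}. signof p * (\<Prod>i = 0..<k. f x (i, p i)))" for x
  proof -
    have "mat k k (f x) $$ (i, p i) = f x (i, p i)" if "p permutes {0..<k}" "i \<in> {0..<k}" for p i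
      using that permutes_in_image[OF that(1), of i] by simp
    then show ?thesis
      by (subst det_def'[of _ k]) (auto intro!: sum.cong prod.cong)
  qed
  moreover have "(\<lambda>x. \<Sum>p | p permutes {0..<k}. signof p * (\<Prod>i = 0..<k. f x (i, p i))) \<in> poly_funs"
  proof (intro poly_funs_sum poly_funs.mult poly_funs.const poly_funs_prod)
    fix p i assume "p \<in> {p. p permutes {0..<k}}" "i \<in> {0..<k}"
    then have "i < k" "p i < k" using permutes_in_image[of p "{0..<k}" i] by auto
    then show "(\<lambda>x. f x (i, p i)) \<in> poly_funs" by (rule assms)
  qed
  ultimately show ?thesis by simp
qed

lemma generically_coord_spaceD:
  assumes "generically (coord_space I) Q"
  obtains u x0 where "u \<in> poly_funs" "x0 \<in> coord_space I" "u x0 \<noteq> 0" "\<forall>x\<in>coord_space I. u x \<noteq> 0 \<longrightarrow> Q x"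
proof -
  obtain U where U: "openin (subtopology zariski (coord_space I)) U" "coord_space I \<subseteq> zariski closure_of U"
    "\<forall>x\<in>U. Q x" using assms by (auto simp: generically_def)
  have "(\<lambda>_. 0) \<in> coord_space I" by (simp add: coord_space_def)
  then obtain x0 where x0: "x0 \<in> U" using U(2) by (metis closure_of_empty empty_iff equals0I subsetD)
  obtain T where T: "openin zariski T" "U = T \<inter> coord_space I" using U(1) by (auto simp: openin_subtopology)
  then obtain u where "u \<in> poly_funs" "u x0 \<noteq> 0" "{x. u x \<noteq> 0} \<subseteq> T" using x0 openin_zariski by blast
  then show ?thesis using that[of u x0] x0 T(2) U(3) by blast
qed

context augmentation
begin

lemma coord_space_image: "(\<lambda>x b. F K2 b x) ` coord_space coords = range (\<lambda>x b. F K2 b x)"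
proof (intro equalityI subsetI)
  fix T assume "T \<in> range (\<lambda>x b. F K2 b x)"
  then obtain x where x: "T = (\<lambda>b. F K2 b x)" by blast
  let ?x = "\<lambda>i. if i \<in> coords then x i else 0"
  have "F K2 b x = F K2 b ?x" for b by (rule F_K2_coords) simp
  moreover have "?x \<in> coord_space coords" by (simp add: coord_space_def)
  ultimately show "T \<in> (\<lambda>x b. F K2 b x) ` coord_space coords" using x by blast
qed blast

text \<open>It suffices to check a property at parameters off a hypersurface: their images contain a
  nonempty open part of the variety, and this part is dense because the parameter space has no zero
  divisors.\<close>

lemma TNS_generically:
  assumes \<gamma>: "\<gamma> \<in> poly_funs" "x0 \<in> coord_space coords" "\<gamma> x0 \<noteq> 0"
    and P: "\<And>x. x \<in> coord_space coords \<Longrightarrow> \<gamma> x \<noteq> 0 \<Longrightarrow> P (\<lambda>b. F K2 b x)"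
  shows "generically (TNS V E bond n) P"
proof -
  let ?f = "\<lambda>x b. F K2 b x"
  have TNS: "TNS V E bond n = zariski closure_of (?f ` coord_space coords)"
    by (simp only: TNS_diagonal coord_space_image)
  obtain \<alpha> where \<alpha>: "\<alpha> \<in> poly_funs" "\<exists>x\<in>coord_space coords. \<alpha> (?f x) \<noteq> 0"
    "\<forall>y\<in>zariski closure_of (?f ` coord_space coords). \<alpha> y \<noteq> 0 \<longrightarrow> (\<exists>x\<in>coord_space coords. ?f x = y \<and> \<gamma> x \<noteq> 0)"
    using image_contains_open[of "F K2", OF state_sum_poly finite_coords \<gamma>] by blast
  define U where "U = TNS V E bond n \<inter> {y. \<alpha> y \<noteq> 0}"
  have "openin (subtopology zariski (TNS V E bond n)) U"
    unfolding U_def openin_subtopology using openin_basic[OF \<alpha>(1)] by blast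
  moreover have "TNS V E bond n \<subseteq> zariski closure_of U"
  proof
    fix y assume y: "y \<in> TNS V E bond n"
    show "y \<in> zariski closure_of U"
      unfolding closure_of_zariski
    proof (intro ballI impI)
      fix p assume p: "p \<in> poly_funs" "\<forall>s\<in>U. p s = 0"
      have image: "?f x \<in> TNS V E bond n" if "x \<in> coord_space coords" for x
        unfolding TNS using that closure_of_subset[of "?f ` coord_space coords" zariski] by auto
      have "(\<forall>x\<in>coord_space coords. p (?f x) = 0) \<or> (\<forall>x\<in>coord_space coords. \<alpha> (?f x) = 0)"
      proof (rule poly_funs_no_zero_divisors)
        show "(\<lambda>x. p (?f x)) \<in> poly_funs" by (rule poly_funs_compose[OF p(1) state_sum_poly])
        show "(\<lambda>x. \<alpha> (?f x)) \<in> poly_funs" by (rule poly_funs_compose[OF \<alpha>(1) state_sum_poly])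
        show "p (?f x) * \<alpha> (?f x) = 0" if "x \<in> coord_space coords" for x
          using p(2) image[OF that] by (auto simp: U_def)
      qed (auto simp: coord_space_def)
      then have "\<forall>x\<in>coord_space coords. p (?f x) = 0" using \<alpha>(2) by blast
      then show "p y = 0" by (intro closure_of_zariskiD[OF y[unfolded TNS] p(1)]) auto
    qed
  qed
  moreover have "P y" if "y \<in> U" for y
  proof -
    have "y \<in> zariski closure_of (?f ` coord_space coords)" "\<alpha> y \<noteq> 0" using that by (auto simp: U_def TNS)
    then obtain x where "x \<in> coord_space coords" "?f x = y" "\<gamma> x \<noteq> 0" using \<alpha>(3) by blast
    then show ?thesis using P[of x] by simp
  qed
  ultimately show ?thesis unfolding generically_def by blast
qed

section \<open>Splitting the index at a vertex into pencil part and network part\<close>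

definition split_config :: "nat \<Rightarrow> (nat set \<Rightarrow> nat) \<Rightarrow> nat \<times> (nat set \<Rightarrow> nat)" where
  "split_config j \<kappa> = (label j \<kappa>, restrict \<kappa> {e \<in> E'. j \<in> e})"

definition join_config :: "nat \<Rightarrow> nat \<times> (nat set \<Rightarrow> nat) \<Rightarrow> nat set \<Rightarrow> nat" where
  "join_config j = (\<lambda>(i, \<kappa>). restrict (\<lambda>e. if e \<in> E' then \<kappa> e else i) {e \<in> E. j \<in> e})"

definition join_global :: "nat \<Rightarrow> (nat set \<Rightarrow> nat) \<Rightarrow> nat set \<Rightarrow> nat" where
  "join_global i k = restrict (\<lambda>e. if e \<in> E' then k e else i) E"

lemma pencil_indices_pos: "j \<in> {1..d} \<Longrightarrow> pencil_indices m j = vertex_labels j"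
  by (auto simp: pencil_indices_def vertex_labels_def)

lemma split_join: "j \<in> {1..d} \<Longrightarrow> c \<in> normal_indices m E' bond j \<Longrightarrow> split_config j (join_config j c) = c"
proof -
  assume j: "j \<in> {1..d}" and c: "c \<in> normal_indices m E' bond j"
  obtain i \<kappa> where i: "c = (i, \<kappa>)" "i \<in> vertex_labels j" "\<kappa> \<in> bond_indices E' bond j"
    using c j by (auto simp: normal_indices_def pencil_indices_pos)
  have "restrict (join_config j c) {e \<in> E'. j \<in> e} = \<kappa>"
    using i(3) by (auto simp: fun_eq_iff join_config_def i(1) bond_indices_def PiE_def extensional_def restrict_def)
  moreover have "label j (join_config j c) = i"
    using i(2) j by (auto simp: label_def join_config_def i(1) vertex_labels_def)
  ultimately show ?thesis by (simp add: split_config_def i(1))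
qed

lemma join_config_L: "j \<in> {1..d} \<Longrightarrow> c \<in> normal_indices m E' bond j \<Longrightarrow> join_config j c \<in> L j"
proof -
  assume j: "j \<in> {1..d}" and c: "c \<in> normal_indices m E' bond j"
  obtain i \<kappa> where i: "c = (i, \<kappa>)" "i \<in> vertex_labels j" "\<kappa> \<in> bond_indices E' bond j"
    using c j by (auto simp: normal_indices_def pencil_indices_pos)
  have "(if e \<in> E' then \<kappa> e else i) < bond e" if "e \<in> E" "j \<in> e" for e
    using that(1)
  proof (rule E_cases)
    assume "e \<in> E'"
    then show ?thesis using i(3) that(2) by (auto simp: bond_indices_def)
  qed (use i(2) vertex_labels_lt in auto)
  then show ?thesis by (auto simp: join_config_def i(1) bond_indices_def)
qed

lemma join_global_K2:
  assumes "i < m" "k \<in> Pi\<^sub>E E' (\<lambda>e. {..<bond e})"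
  shows "join_global i k \<in> K2" "join_global i k e1 = i"
proof -
  have "(if e \<in> E' then k e else i) < bond e" if "e \<in> E" for e
    using that by (rule E_cases) (use assms in auto)
  then show "join_global i k \<in> K2" "join_global i k e1 = i"
    by (auto simp: join_global_def K2_def K_def)
qed

lemma lc_join_global:
  assumes "j \<in> {1..d}"
  shows "lc j (join_global i k) = join_config j (if j = 1 \<or> j = 2 then i else 0, local_config E' j k)"
proof
  fix e
  show "lc j (join_global i k) e = join_config j (if j = 1 \<or> j = 2 then i else 0, local_config E' j k) e"
  proof (cases "e \<in> E \<and> j \<in> e")
    case True
    then have "e \<in> E \<Longrightarrow> ?thesis"
    proof (elim E_cases)
      assume "e \<in> E'"
      then show ?thesis using True by (simp add: lc_apply join_global_def join_config_def local_config_def)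
    qed (use True assms in \<open>auto simp: lc_apply join_global_def join_config_def\<close>)
    then show ?thesis using True by blast
  qed (auto simp: lc_apply join_config_def)
qed

text \<open>A surviving configuration is a summand index together with a configuration of the
  smaller network.\<close>

lemma sum_K2: "(\<Sum>k\<in>K2. g k) = (\<Sum>i<m. \<Sum>k\<in>Pi\<^sub>E E' (\<lambda>e. {..<bond e}). g (join_global i k))"
  for g :: "(nat set \<Rightarrow> nat) \<Rightarrow> complex"
proof -
  have "(\<Sum>k\<in>K2. g k) = (\<Sum>(i, k)\<in>{..<m} \<times> Pi\<^sub>E E' (\<lambda>e. {..<bond e}). g (join_global i k))"
  proof (rule sum.reindex_bij_witness[where j = "\<lambda>k. (k e1, restrict k E')" and i = "\<lambda>(i, k). join_global i k"])
    fix k assume k: "k \<in> K2"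
    have r: "restrict k E' \<in> Pi\<^sub>E E' (\<lambda>e. {..<bond e})" using K_lt[OF K2_K[OF k]] by auto
    then show "(k e1, restrict k E') \<in> {..<m} \<times> Pi\<^sub>E E' (\<lambda>e. {..<bond e})" using K2_m[OF k] by simp
    have "join_global (k e1) (restrict k E') = k"
    proof (rule K2_eqI[OF join_global_K2(1)[OF K2_m[OF k] r] k])
      show "join_global (k e1) (restrict k E') e1 = k e1" by (rule join_global_K2(2)[OF K2_m[OF k] r])
    qed (simp add: join_global_def)
    then show "(case (k e1, restrict k E') of (i, k) \<Rightarrow> join_global i k) = k"
      "(case (k e1, restrict k E') of (i, k) \<Rightarrow> g (join_global i k)) = g k" by simp_all
  next
    fix p assume "p \<in> {..<m} \<times> Pi\<^sub>E E' (\<lambda>e. {..<bond e})"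
    then obtain i k where p: "p = (i, k)" "i < m" "k \<in> Pi\<^sub>E E' (\<lambda>e. {..<bond e})" by auto
    then show "(case p of (i, k) \<Rightarrow> join_global i k) \<in> K2" using join_global_K2 by simp
    have "restrict (join_global i k) E' = k"
      using p(3) by (auto simp: fun_eq_iff join_global_def PiE_def extensional_def restrict_def)
    then show "((case p of (i, k) \<Rightarrow> join_global i k) e1, restrict (case p of (i, k) \<Rightarrow> join_global i k) E') = p"
      using p join_global_K2(2)[OF p(2,3)] by simp
  qed
  then show ?thesis by (simp add: sum.cartesian_product)
qed

lemma sum_diag_pencil:
  "(\<Sum>a\<in>Pi\<^sub>E V (pencil_indices m). H a * diag_pencil d m y a) =
    (\<Sum>i<m. \<Sum>s<2. y (i, s) * H (\<lambda>v\<in>V. if v = 0 then s else if v = 1 \<or> v = 2 then i else 0))"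
proof -
  let ?pt = "\<lambda>i s. \<lambda>v\<in>V. if v = 0 then s else if v = 1 \<or> v = 2 then i else (0 :: nat)"
  let ?A = "Pi\<^sub>E V (pencil_indices m)"
  have fin: "finite ?A" by (intro finite_PiE) (auto simp: pencil_indices_def)
  have "(\<Sum>a\<in>?A. H a * diag_pencil d m y a) =
    (\<Sum>a\<in>?A. \<Sum>i<m. H a * (y (i, a 0) * of_bool (a 1 = i) * of_bool (a 2 = i)))"
    by (intro sum.cong refl) (simp only: diag_pencil_def if_True sum_distrib_left)
  also have "\<dots> = (\<Sum>i<m. \<Sum>a\<in>?A. H a * (y (i, a 0) * of_bool (a 1 = i) * of_bool (a 2 = i)))"
    by (rule sum.swap)
  also have "\<dots> = (\<Sum>i<m. \<Sum>s<2. y (i, s) * H (?pt i s))"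
  proof (intro sum.cong refl)
    fix i assume i: "i \<in> {..<m}"
    have "(\<Sum>a\<in>?A. H a * (y (i, a 0) * of_bool (a 1 = i) * of_bool (a 2 = i))) =
      (\<Sum>a\<in>{a \<in> ?A. a 1 = i \<and> a 2 = i}. y (i, a 0) * H a)"
      by (rule sum.mono_neutral_cong_right) (use fin in auto)
    also have "\<dots> = (\<Sum>s<2. y (i, s) * H (?pt i s))"
    proof (rule sum.reindex_bij_witness[where i = "?pt i" and j = "\<lambda>a. a 0"])
      fix a assume a: "a \<in> {a \<in> ?A. a 1 = i \<and> a 2 = i}"
      show pt: "?pt i (a 0) = a"
      proof
        fix v
        have "a v \<in> pencil_indices m v" if "v \<in> V" using a that by auto
        then show "?pt i (a 0) v = a v"
          using a by (cases "v \<in> V") (auto simp: pencil_indices_def PiE_def extensional_def)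
      qed
      have "a 0 \<in> pencil_indices m 0" using a by auto
      then show "a 0 \<in> {..<2}" by (simp add: pencil_indices_def)
      show "y (i, a 0) * H (?pt i (a 0)) = y (i, a 0) * H a" by (simp only: pt)
    next
      fix s :: nat assume s: "s \<in> {..<2}"
      show "?pt i s 0 = s" by simp
      show "?pt i s \<in> {a \<in> ?A. a 1 = i \<and> a 2 = i}"
        using s i d by (auto simp: pencil_indices_def)
    qed
    finally show "(\<Sum>a\<in>?A. H a * (y (i, a 0) * of_bool (a 1 = i) * of_bool (a 2 = i))) =
      (\<Sum>s<2. y (i, s) * H (?pt i s))" .
  qed
  finally show ?thesis .
qed

context
  fixes \<phi> :: "nat \<Rightarrow> nat \<times> (nat set \<Rightarrow> nat) \<Rightarrow> nat"
  assumes \<phi>: "identification d m E' bond n \<phi>"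
begin

text \<open>The matrix at \<open>j\<close> with its columns arranged by the given, arbitrary
  identification \<open>\<phi>\<close>.\<close>

definition point_matrix :: "(nat \<times> nat \<times> (nat set \<Rightarrow> nat) \<Rightarrow> complex) \<Rightarrow> nat \<Rightarrow> complex mat" where
  "point_matrix x j = mat (n j) (n j)
     (\<lambda>(r, q). x (j, r, join_config j (inv_into (normal_indices m E' bond j) (\<phi> j) q)))"

definition point_pencil :: "(nat \<times> nat \<times> (nat set \<Rightarrow> nat) \<Rightarrow> complex) \<Rightarrow> nat \<times> nat \<Rightarrow> complex" where
  "point_pencil x = (\<lambda>(i, s). if i < m \<and> s < 2 then x (0, s, lc 0 (zero_config i)) else 0)"

lemma \<phi>_bij: "j \<in> {1..d} \<Longrightarrow> bij_betw (\<phi> j) (normal_indices m E' bond j) {..<n j}"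
  using \<phi> by (auto simp: identification_def phys_indices_def)

lemma \<phi>_0: "\<phi> 0 = fst"
  using \<phi> by (simp add: identification_def)

lemma point_matrix_entry:
  assumes "j \<in> {1..d}" "r < n j" "c \<in> normal_indices m E' bond j"
  shows "point_matrix x j $$ (r, \<phi> j c) = x (j, r, join_config j c)"
proof -
  have "\<phi> j c < n j" using \<phi>_bij[OF assms(1)] assms(3) by (auto simp: bij_betw_def)
  moreover have "inv_into (normal_indices m E' bond j) (\<phi> j) (\<phi> j c) = c"
    using \<phi>_bij[OF assms(1)] assms(3) by (simp add: bij_betw_def)
  ultimately show ?thesis using assms(2) by (simp add: point_matrix_def)
qed

text \<open>An exact identity at every parameter point: the matrices at 1, ..., d act, and the
  diagonal matrix entries at vertex 0 become the points z_i. Genericity enters afterwards, when the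
  acting matrices have to be invertible.\<close>

lemma state_sum_normal_form:
  "mat_action V n ((point_matrix x)(0 := 1\<^sub>m 2)) (normal_form d m E' bond n \<phi> (point_pencil x)) = (\<lambda>b. F K2 b x)"
proof
  fix b
  let ?g = "(point_matrix x)(0 := 1\<^sub>m 2)"
  let ?NI = "normal_indices m E' bond"
  let ?P = "Pi\<^sub>E E' (\<lambda>e. {..<bond e})"
  let ?Y = "\<lambda>v r c. ?g v $$ (r, \<phi> v c)"
  let ?pt = "\<lambda>i s. \<lambda>v\<in>V. if v = 0 then s else if v = 1 \<or> v = 2 then i else (0 :: nat)"
  have \<phi>_in: "\<phi> v c \<in> phys_indices n v" if "v \<in> V" "c \<in> ?NI v" for v c
  proof (cases "v = 0")
    case True
    then show ?thesis using that(2) n_0 by (auto simp: \<phi>_0 normal_indices_def pencil_indices_def phys_indices_def)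
  next
    case False
    then show ?thesis using that \<phi>_bij[of v] by (auto simp: bij_betw_def phys_indices_def)
  qed
  have "mat_action V n ?g (normal_form d m E' bond n \<phi> (point_pencil x)) =
    tensor_map V ?NI (phys_indices n) ?Y (kron V (diag_pencil d m (point_pencil x)) (graph_tensor V E' bond))"
    unfolding mat_action_def normal_form_def
    by (rule tensor_map_reindex[OF _ _ \<phi>_in]) (simp_all add: phys_indices_def)
  moreover have "tensor_map V ?NI (phys_indices n) ?Y (kron V (diag_pencil d m (point_pencil x)) (graph_tensor V E' bond)) b
    = F K2 b x"
  proof (cases "b \<in> Pi\<^sub>E V (phys_indices n)")
    case True
    have b: "b v < n v" if "v \<in> V" for v using True that by (auto simp: PiE_iff phys_indices_def)
    have edges: "e \<subseteq> V \<and> e \<noteq> {}" if "e \<in> E'" for e using edge_E that by simp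
    have factor: "(\<Prod>v\<in>V. ?Y v (b v) ((\<lambda>v\<in>V. (?pt i s v, (\<lambda>v\<in>V. local_config E' v k) v)) v)) =
      of_bool (b 0 = s) * (\<Prod>v\<in>{1..d}. x (v, b v, lc v (join_global i k)))"
      if i: "i < m" and s: "s < 2" and k: "k \<in> ?P" for i s k
    proof -
      have "(\<Prod>v\<in>V. ?Y v (b v) ((\<lambda>v\<in>V. (?pt i s v, (\<lambda>v\<in>V. local_config E' v k) v)) v)) =
        ?Y 0 (b 0) (s, local_config E' 0 k) *
        (\<Prod>v\<in>{1..d}. ?Y v (b v) ((\<lambda>v\<in>V. (?pt i s v, (\<lambda>v\<in>V. local_config E' v k) v)) v))"
        by (subst prod.atLeast_Suc_atMost) auto
      also have "?Y 0 (b 0) (s, local_config E' 0 k) = of_bool (b 0 = s)"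
        using b[of 0] s n_0 by (simp add: \<phi>_0)
      also have "(\<Prod>v\<in>{1..d}. ?Y v (b v) ((\<lambda>v\<in>V. (?pt i s v, (\<lambda>v\<in>V. local_config E' v k) v)) v)) =
        (\<Prod>v\<in>{1..d}. x (v, b v, lc v (join_global i k)))"
      proof (intro prod.cong refl)
        fix v assume v: "v \<in> {1..d}"
        let ?c = "(if v = 1 \<or> v = 2 then i else 0, local_config E' v k)"
        have "local_config E' v k \<in> bond_indices E' bond v"
          using k by (auto simp: local_config_def bond_indices_def)
        then have "?c \<in> ?NI v" using v i by (simp add: normal_indices_def pencil_indices_def)
        then show "?Y v (b v) ((\<lambda>v\<in>V. (?pt i s v, (\<lambda>v\<in>V. local_config E' v k) v)) v) = x (v, b v, lc v (join_global i k))"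
          using v point_matrix_entry[OF v b[of v], of ?c x] by (simp add: lc_join_global)
      qed
      finally show ?thesis .
    qed
    have "tensor_map V ?NI (phys_indices n) ?Y (kron V (diag_pencil d m (point_pencil x)) (graph_tensor V E' bond)) b =
      (\<Sum>c\<in>Pi\<^sub>E V (\<lambda>v. pencil_indices m v \<times> bond_indices E' bond v). (\<Prod>v\<in>V. ?Y v (b v) (c v)) *
        kron V (diag_pencil d m (point_pencil x)) (graph_tensor V E' bond) c)"
      using True by (simp add: tensor_map_def normal_indices_def[abs_def])
    also have "\<dots> = (\<Sum>a\<in>Pi\<^sub>E V (pencil_indices m). \<Sum>a'\<in>Pi\<^sub>E V (bond_indices E' bond).
      (\<Prod>v\<in>V. ?Y v (b v) ((\<lambda>v\<in>V. (a v, a' v)) v)) * (diag_pencil d m (point_pencil x) a * graph_tensor V E' bond a'))"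
      by (rule sum_kron[where G = "\<lambda>c. \<Prod>v\<in>V. ?Y v (b v) (c v)"]) simp
    also have "\<dots> = (\<Sum>a\<in>Pi\<^sub>E V (pencil_indices m). (\<Sum>a'\<in>Pi\<^sub>E V (bond_indices E' bond).
      (\<Prod>v\<in>V. ?Y v (b v) ((\<lambda>v\<in>V. (a v, a' v)) v)) * graph_tensor V E' bond a') * diag_pencil d m (point_pencil x) a)"
      unfolding sum_distrib_right by (intro sum.cong refl) (simp add: mult_ac)
    also have "\<dots> = (\<Sum>a\<in>Pi\<^sub>E V (pencil_indices m). (\<Sum>k\<in>?P.
      \<Prod>v\<in>V. ?Y v (b v) ((\<lambda>v\<in>V. (a v, (\<lambda>v\<in>V. local_config E' v k) v)) v)) * diag_pencil d m (point_pencil x) a)"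
      by (intro sum.cong refl arg_cong2[of _ _ _ _ "(*)"] graph_tensor_sum) (use finite_E' edges in auto)
    also have "\<dots> = (\<Sum>i<m. \<Sum>s<2. point_pencil x (i, s) * (\<Sum>k\<in>?P.
      \<Prod>v\<in>V. ?Y v (b v) ((\<lambda>v\<in>V. (?pt i s v, (\<lambda>v\<in>V. local_config E' v k) v)) v)))"
      by (rule sum_diag_pencil)
    also have "\<dots> = (\<Sum>i<m. \<Sum>s<2. if s = b 0 then point_pencil x (i, s) *
      (\<Sum>k\<in>?P. \<Prod>v\<in>{1..d}. x (v, b v, lc v (join_global i k))) else 0)"
    proof (intro sum.cong refl)
      fix i s assume "i \<in> {..<m}" "s \<in> {..<2 :: nat}"
      then have "(\<Sum>k\<in>?P. \<Prod>v\<in>V. ?Y v (b v) ((\<lambda>v\<in>V. (?pt i s v, (\<lambda>v\<in>V. local_config E' v k) v)) v)) =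
        (\<Sum>k\<in>?P. of_bool (b 0 = s) * (\<Prod>v\<in>{1..d}. x (v, b v, lc v (join_global i k))))"
        by (intro sum.cong refl factor) auto
      then show "point_pencil x (i, s) * (\<Sum>k\<in>?P.
        \<Prod>v\<in>V. ?Y v (b v) ((\<lambda>v\<in>V. (?pt i s v, (\<lambda>v\<in>V. local_config E' v k) v)) v)) =
        (if s = b 0 then point_pencil x (i, s) *
          (\<Sum>k\<in>?P. \<Prod>v\<in>{1..d}. x (v, b v, lc v (join_global i k))) else 0)" by simp
    qed
    also have "\<dots> = (\<Sum>i<m. point_pencil x (i, b 0) * (\<Sum>k\<in>?P. \<Prod>v\<in>{1..d}. x (v, b v, lc v (join_global i k))))"
      using b[of 0] n_0 by simp
    also have "\<dots> = (\<Sum>i<m. \<Sum>k\<in>?P. \<Prod>v\<in>V. x (v, b v, lc v (join_global i k)))"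
      unfolding sum_distrib_left
    proof (intro sum.cong refl)
      fix i k assume i: "i \<in> {..<m}" and k: "k \<in> ?P"
      have "lc 0 (zero_config i) = lc 0 (join_global i k)"
        using lc_0_eq_iff[OF zero_config_K2 join_global_K2(1)[OF _ k], of i i] join_global_K2(2)[OF _ k, of i] i
        by (simp add: zero_config_def)
      then have "point_pencil x (i, b 0) = x (0, b 0, lc 0 (join_global i k))"
        using i b[of 0] n_0 by (simp add: point_pencil_def)
      then show "point_pencil x (i, b 0) * (\<Prod>v\<in>{1..d}. x (v, b v, lc v (join_global i k))) =
        (\<Prod>v\<in>V. x (v, b v, lc v (join_global i k)))"
        by (subst prod.atLeast_Suc_atMost) auto
    qed
    also have "\<dots> = F K2 b x" using True by (simp add: state_sum_def sum_K2)
    finally show ?thesis .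
  qed (simp add: tensor_map_def state_sum_def)
  ultimately show "mat_action V n ?g (normal_form d m E' bond n \<phi> (point_pencil x)) b = F K2 b x" by simp
qed

lemma generic_normal_form:
  assumes Q: "generically (coord_space ({..<m} \<times> {..<2})) Q"
  shows "generically (TNS V E bond n)
    (\<lambda>T. \<exists>z g. z \<in> coord_space ({..<m} \<times> {..<2}) \<and> Q z \<and> (\<forall>j\<in>{1..d}. g j \<in> GL (n j)) \<and>
      T = mat_action V n (g(0 := 1\<^sub>m 2)) (normal_form d m E' bond n \<phi> z))"
proof -
  obtain u z0 where u: "u \<in> poly_funs" "z0 \<in> coord_space ({..<m} \<times> {..<2})" "u z0 \<noteq> 0"
    "\<forall>z\<in>coord_space ({..<m} \<times> {..<2}). u z \<noteq> 0 \<longrightarrow> Q z" by (rule generically_coord_spaceD[OF Q])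
  have pencil: "point_pencil x \<in> coord_space ({..<m} \<times> {..<2})" for x
    by (auto simp: coord_space_def point_pencil_def)
  define \<gamma> where "\<gamma> x = u (point_pencil x) * (\<Prod>j\<in>{1..d}. det (point_matrix x j))" for x
  have "(\<lambda>x. u (point_pencil x)) \<in> poly_funs"
  proof (rule poly_funs_compose[OF u(1)])
    show "(\<lambda>x. point_pencil x q) \<in> poly_funs" for q
      unfolding point_pencil_def by (cases q) (auto intro!: poly_funs_if poly_funs.coord poly_funs.const)
  qed
  moreover have "(\<lambda>x. det (point_matrix x j)) \<in> poly_funs" for j
    unfolding point_matrix_def by (rule det_poly_funs) (simp add: poly_funs.coord)
  ultimately have \<gamma>_poly: "\<gamma> \<in> poly_funs"
    unfolding \<gamma>_def by (intro poly_funs.mult poly_funs_prod)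
  \<comment> \<open>Witness that \<gamma> is not identically zero: the pencil \<open>z0\<close>
    together with identity matrices with respect to \<open>\<phi>\<close>.\<close>
  define x0 where "x0 = (\<lambda>(j, r, \<kappa>). if (j, r, \<kappa>) \<in> coords then
    (if j = 0 then z0 (\<kappa> e1, r) else of_bool (r = \<phi> j (split_config j \<kappa>))) else 0)"
  have x0: "x0 \<in> coord_space coords" by (auto simp: coord_space_def x0_def)
  have "point_pencil x0 = z0"
  proof
    fix q :: "nat \<times> nat"
    obtain i s where q: "q = (i, s)" by (cases q)
    show "point_pencil x0 q = z0 q"
    proof (cases "i < m \<and> s < 2")
      case True
      then have "(0, s, lc 0 (zero_config i)) \<in> coords" using n_0 zero_config_K2 by (auto simp: coords_def)
      moreover have "lc 0 (zero_config i) e1 = i" by (simp add: lc_apply zero_config_def)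
      ultimately show ?thesis using True by (simp add: point_pencil_def q x0_def)
    next
      case False
      then show ?thesis using u(2) by (auto simp: point_pencil_def q coord_space_def)
    qed
  qed
  moreover have "point_matrix x0 j = 1\<^sub>m (n j)" if j: "j \<in> {1..d}" for j
  proof (rule eq_matI)
    fix r q assume rq: "r < dim_row (1\<^sub>m (n j))" "q < dim_col (1\<^sub>m (n j))"
    then have "q \<in> \<phi> j ` normal_indices m E' bond j" using \<phi>_bij[OF j] by (simp add: bij_betw_def)
    then obtain c where c: "c \<in> normal_indices m E' bond j" "q = \<phi> j c" by blast
    have "(j, r, join_config j c) \<in> coords"
      using rq j join_config_L[OF j c(1)] by (simp add: coords_def lc_K2)
    then have "x0 (j, r, join_config j c) = of_bool (r = q)"
      using j split_join[OF j c(1)] c(2) by (simp add: x0_def)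
    then show "point_matrix x0 j $$ (r, q) = 1\<^sub>m (n j) $$ (r, q)"
      using point_matrix_entry[OF j _ c(1), of r x0] rq c(2) by simp
  qed (simp_all add: point_matrix_def)
  ultimately have "\<gamma> x0 \<noteq> 0" using u(3) by (simp add: \<gamma>_def)
  then show ?thesis
  proof (rule TNS_generically[OF \<gamma>_poly x0])
    fix x assume "x \<in> coord_space coords" "\<gamma> x \<noteq> 0"
    then have "u (point_pencil x) \<noteq> 0" "\<And>j. j \<in> {1..d} \<Longrightarrow> det (point_matrix x j) \<noteq> 0"
      by (auto simp: \<gamma>_def)
    then have "Q (point_pencil x)" "\<forall>j\<in>{1..d}. point_matrix x j \<in> GL (n j)"
      using u(4) pencil by (auto intro!: det_nonzero_GL simp: point_matrix_def)
    then show "\<exists>z g. z \<in> coord_space ({..<m} \<times> {..<2}) \<and> Q z \<and> (\<forall>j\<in>{1..d}. g j \<in> GL (n j)) \<and>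
      (\<lambda>b. F K2 b x) = mat_action V n (g(0 := 1\<^sub>m 2)) (normal_form d m E' bond n \<phi> z)"
      using pencil state_sum_normal_form[of x]
      by (intro exI[of _ "point_pencil x"] exI[of _ "point_matrix x"]) simp
  qed
qed

end

end

lemma bond_indices_cong: "(\<And>e. e \<in> E \<Longrightarrow> m e = m' e) \<Longrightarrow> bond_indices E m v = bond_indices E m' v"
  unfolding bond_indices_def by (intro PiE_cong) auto

lemma graph_tensor_cong: "(\<And>e. e \<in> E \<Longrightarrow> m e = m' e) \<Longrightarrow> graph_tensor V E m = graph_tensor V E m'"
proof -
  assume "\<And>e. e \<in> E \<Longrightarrow> m e = m' e"
  then have "bond_indices E m = bond_indices E m'" by (intro ext bond_indices_cong)
  then show ?thesis by (simp only: graph_tensor_def)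
qed

text \<open>Genericity of the points z_i is expressed by quantifying over all generic conditions
  \<open>Q\<close>: a generic tensor has a normal form with \<open>Q z\<close>. The identity matrix
  at 0 records that the group acts at 1, ..., d only. For m = 1 or m12 = 1 the formula gives defect
  0, hence the condition in front of \<open>defective\<close>.\<close>

theorem theorem6p1:
  fixes d m m12 :: nat
    and E' E :: "nat set set"
    and m' bond :: "nat set \<Rightarrow> nat"
    and n :: "nat \<Rightarrow> nat"
  assumes "2 \<le> d"
    and "network {1..d} E'"
    and "\<forall>e\<in>E'. 0 < m' e"
    and "0 < m"
    and "E = E' \<union> {{0, 1}, {0, 2}}"
    and "\<forall>e\<in>E'. bond e = m' e"
    and "bond {0, 1} = m"
    and "bond {0, 2} = m"
    and "m12 = (if {1, 2} \<in> E' then bond {1, 2} else 1)"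
    and "n 0 = 2"
    and "\<forall>j\<in>{1..d}. n j = (\<Prod>e\<in>{e \<in> E. j \<in> e}. bond e)"
  shows "(1 < m \<and> 1 < m12 \<longrightarrow> defective {0..d} E bond n)
    \<and> TNS_defect {0..d} E bond n = (int m - 1) * ((int m12)\<^sup>2 - 1)
    \<and> fiberdefect {0..d} E bond n = (int m - 1) * ((int m12)\<^sup>2 - 1)
    \<and> (\<forall>\<phi> Q. identification d m E' m' n \<phi> \<longrightarrow>
          generically (coord_space ({..<m} \<times> {..<2})) Q \<longrightarrow>
          generically (TNS {0..d} E bond n)
            (\<lambda>T. \<exists>z g. z \<in> coord_space ({..<m} \<times> {..<2}) \<and> Q z \<and> (\<forall>j\<in>{1..d}. g j \<in> GL (n j)) \<and>
                  T = mat_action {0..d} n (g(0 := 1\<^sub>m 2)) (normal_form d m E' m' n \<phi> z)))"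
proof -
  interpret augmentation d m E' E bond n
    by unfold_locales (use assms in auto)
  have eq: "\<And>e. e \<in> E' \<Longrightarrow> m' e = bond e" using assms(6) by simp
  have NI: "normal_indices m E' m' = normal_indices m E' bond"
    by (simp add: normal_indices_def[abs_def] bond_indices_cong[OF eq])
  have "generically (TNS {0..d} E bond n)
      (\<lambda>T. \<exists>z g. z \<in> coord_space ({..<m} \<times> {..<2}) \<and> Q z \<and> (\<forall>j\<in>{1..d}. g j \<in> GL (n j)) \<and>
        T = mat_action {0..d} n (g(0 := 1\<^sub>m 2)) (normal_form d m E' m' n \<phi> z))"
    if "identification d m E' m' n \<phi>" "generically (coord_space ({..<m} \<times> {..<2})) Q" for \<phi> Q
  proof -
    have "identification d m E' bond n \<phi>" using that(1) by (simp add: identification_def NI)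
    moreover have "normal_form d m E' m' n \<phi> = normal_form d m E' bond n \<phi>"
      by (simp add: normal_form_def[abs_def] NI graph_tensor_cong[OF eq])
    ultimately show ?thesis using generic_normal_form[OF _ that(2), of \<phi>] by simp
  qed
  moreover have "augmentation.m12 E' bond = m12"
    using assms(9) by (simp add: m12_def)
  ultimately show ?thesis
    using defective_TNS TNS_defect_eq fiberdefect_eq by auto
qed

end
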